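(* Let $\Omega\subset\mathbb{R}^N$ be a uniformly convex domain, let $f$ be a bounded continuous function on $\Omega$, let $k\in\{1,\dots,N\}$, and let $\mathcal{I}$ be either $\mathcal{I}_k^+$ or $\mathcal{I}_k^-$. Then there exists a unique function $u\in C(\mathbb{R}^N)$ solving $$\begin{cases}\mathcal{I}u=f(x)&\text{in }\Omega\\ u=0&\text{in }\mathbb{R}^N\setminus\Omega.\end{cases}$$
   Context: Fix $s\in(0,1)$. A uniformly convex domain is a bounded domain $\Omega\subset\mathbb{R}^N$ of the form $\Omega=\bigcap_{y\in Y}B_R(y)$ for some $R>0$ and some set $Y\subset\mathbb{R}^N$, where $B_R(y)$ is the ball of center $y$ and radius $R$. Set $\delta(u,x,y)=u(x+y)+u(x-y)-2u(x)$, let $C_s=C_{1,s}>0$ be the normalizing constant of the one-dimensional fractional Laplacian, and let $\mathcal{V}_k$ be the family of $k$-dimensional orthonormal sets in $\mathbb{R}^N$. The operators are $\mathcal{I}_k^+u(x)=\sup_{\{\xi_i\}\in\mathcal{V}_k}\sum_{i=1}^k\mathcal{I}_{\xi_i}u(x)$ and $\mathcal{I}_k^-u(x)=\inf_{\{\xi_i\}\in\mathcal{V}_k}\sum_{i=1}^k\mathcal{I}_{\xi_i}u(x)$, where $\mathcal{I}_\xi u(x)=C_s\int_0^{+\infty}\delta(u,x,\tau\xi)\tau^{-1-2s}\,d\tau$. Viscosity solutions: $u\in L^\infty(\mathbb{R}^N)\cap LSC(\Omega)$ (resp. $USC(\Omega)$) is a supersolution (resp. subsolution) of $\mathcal{I}_k^+u=f$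 in $\Omega$ if for every $x_0\in\Omega$, $\rho>0$ and $\varphi\in C^2(B_\rho(x_0))$ such that $x_0$ is a minimum (resp. maximum) point of $u-\varphi$ in $B_\rho(x_0)$, $$C_s\sup_{\{\xi_i\}\in\mathcal{V}_k}\sum_{i=1}^k\left(\int_0^\rho\frac{\delta(\varphi,x_0,\tau\xi_i)}{\tau^{1+2s}}\,d\tau+\int_\rho^{+\infty}\frac{\delta(u,x_0,\tau\xi_i)}{\tau^{1+2s}}\,d\tau\right)\le f(x_0)\quad(\text{resp. }\ge f(x_0)).$$ For $\mathcal{I}_k^-$ replace $\sup$ by $\inf$. A solution is a continuous function that is both a subsolution and a supersolution. *)

theory Defs
  imports "HOL-Analysis.Analysis"
begin

definition uniformly_convex_domain :: "'a::euclidean_space set \<Rightarrow> bool" where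
  "uniformly_convex_domain \<Omega> \<longleftrightarrow>
     open \<Omega> \<and> connected \<Omega> \<and> \<Omega> \<noteq> {} \<and> bounded \<Omega> \<and>
     (\<exists>R>0. \<exists>Y. \<Omega> = (\<Inter>y\<in>Y. ball y R))"

definition second_diff :: "('a::real_vector \<Rightarrow> real) \<Rightarrow> 'a \<Rightarrow> 'a \<Rightarrow> real" where
  "second_diff u x y = u (x + y) + u (x - y) - 2 * u x"

text \<open>The usual constant $C_{1,s} = \bigl(\int_{\mathbb R} (1-\cos z)\,|z|^{-1-2s}\,dz\bigr)^{-1}$,
  for which $-(-d^2/dt^2)^s$ is the operator $v \mapsto C_{1,s}\int_0^\infty
  (v(t+r)+v(t-r)-2v(t))\,r^{-1-2s}\,dr$, that is, the Fourier multiplier $-|z|^{2s}$.\<close>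

definition frac_const :: "real \<Rightarrow> real" where
  "frac_const s = inverse (LBINT z. (1 - cos z) / \<bar>z\<bar> powr (1 + 2 * s))"

definition orthonormal_sets :: "nat \<Rightarrow> 'a::euclidean_space set set" where
  "orthonormal_sets k =
     {B. finite B \<and> card B = k \<and> pairwise orthogonal B \<and> (\<forall>\<xi>\<in>B. norm \<xi> = 1)}"

text \<open>Lebesgue integral over \<open>A\<close> with values in the extended reals. A test function is
  \<open>C\<^sup>2\<close> only in the open ball, so it may be unbounded near the sphere and the integral of
  its second difference may be infinite; a real-valued integral would then be the
  meaningless default 0. When the test function touches a bounded function from below
  (above), only the value \<open>-\<infinity>\<close> (\<open>\<infinity>\<close>) can occur, so the case
  \<open>\<infinity> - \<infinity>\<close> never arises below.\<close>

definition ext_integral :: "real set \<Rightarrow> (real \<Rightarrow> real) \<Rightarrow> ereal" where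
  "ext_integral A g =
     enn2ereal (\<integral>\<^sup>+t\<in>A. ennreal (g t) \<partial>lborel) - enn2ereal (\<integral>\<^sup>+t\<in>A. ennreal (- g t) \<partial>lborel)"

text \<open>The parameter \<open>ext\<close> is the extremum over orthonormal sets: \<open>Sup\<close> gives
  $\mathcal I_k^+$ and \<open>Inf\<close> gives $\mathcal I_k^-$.\<close>

definition test_value ::
  "(ereal set \<Rightarrow> ereal) \<Rightarrow> real \<Rightarrow> nat \<Rightarrow> ('a::euclidean_space \<Rightarrow> real) \<Rightarrow> ('a \<Rightarrow> real) \<Rightarrow> real \<Rightarrow> 'a \<Rightarrow> ereal"
  where
  "test_value ext s k u \<phi> \<rho> x =
     ereal (frac_const s) *
     ext ((\<lambda>B. \<Sum>\<xi>\<in>B.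
              ext_integral {0<..<\<rho>} (\<lambda>\<tau>. second_diff \<phi> x (\<tau> *\<^sub>R \<xi>) / \<tau> powr (1 + 2 * s))
            + ext_integral {\<rho><..} (\<lambda>\<tau>. second_diff u x (\<tau> *\<^sub>R \<xi>) / \<tau> powr (1 + 2 * s)))
          ` orthonormal_sets k)"

definition C2_on :: "'a::euclidean_space set \<Rightarrow> ('a \<Rightarrow> real) \<Rightarrow> bool" where
  "C2_on S \<phi> \<longleftrightarrow>
     (\<exists>(D :: 'a \<Rightarrow> 'a \<Rightarrow>\<^sub>L real) (H :: 'a \<Rightarrow> 'a \<Rightarrow>\<^sub>L 'a \<Rightarrow>\<^sub>L real).
        (\<forall>x\<in>S. (\<phi> has_derivative blinfun_apply (D x)) (at x)) \<and>
        (\<forall>x\<in>S. (D has_derivative blinfun_apply (H x)) (at x)) \<and>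
        continuous_on S H)"

definition lsc_on :: "'a::topological_space set \<Rightarrow> ('a \<Rightarrow> real) \<Rightarrow> bool" where
  "lsc_on S u \<longleftrightarrow> (\<forall>c. openin (top_of_set S) {x\<in>S. c < u x})"

definition usc_on :: "'a::topological_space set \<Rightarrow> ('a \<Rightarrow> real) \<Rightarrow> bool" where
  "usc_on S u \<longleftrightarrow> (\<forall>c. openin (top_of_set S) {x\<in>S. u x < c})"

text \<open>The operators evaluate \<open>u\<close> on lines, which are null sets, so membership in
  $L^\infty$ is read pointwise: Borel measurable and bounded everywhere.\<close>

definition bounded_measurable :: "('a::euclidean_space \<Rightarrow> real) \<Rightarrow> bool" where
  "bounded_measurable u \<longleftrightarrow> u \<in> borel_measurable borel \<and> bounded (range u)"

definition visc_supersolution ::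
  "(ereal set \<Rightarrow> ereal) \<Rightarrow> real \<Rightarrow> nat \<Rightarrow> 'a::euclidean_space set \<Rightarrow> ('a \<Rightarrow> real) \<Rightarrow> ('a \<Rightarrow> real) \<Rightarrow> bool"
  where
  "visc_supersolution ext s k \<Omega> f u \<longleftrightarrow>
     bounded_measurable u \<and> lsc_on \<Omega> u \<and>
     (\<forall>x\<in>\<Omega>. \<forall>\<rho>>0. \<forall>\<phi>. C2_on (ball x \<rho>) \<phi> \<and> (\<forall>y\<in>ball x \<rho>. u x - \<phi> x \<le> u y - \<phi> y) \<longrightarrow>
        test_value ext s k u \<phi> \<rho> x \<le> ereal (f x))"

definition visc_subsolution ::
  "(ereal set \<Rightarrow> ereal) \<Rightarrow> real \<Rightarrow> nat \<Rightarrow> 'a::euclidean_space set \<Rightarrow> ('a \<Rightarrow> real) \<Rightarrow> ('a \<Rightarrow> real) \<Rightarrow> bool"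
  where
  "visc_subsolution ext s k \<Omega> f u \<longleftrightarrow>
     bounded_measurable u \<and> usc_on \<Omega> u \<and>
     (\<forall>x\<in>\<Omega>. \<forall>\<rho>>0. \<forall>\<phi>. C2_on (ball x \<rho>) \<phi> \<and> (\<forall>y\<in>ball x \<rho>. u y - \<phi> y \<le> u x - \<phi> x) \<longrightarrow>
        test_value ext s k u \<phi> \<rho> x \<ge> ereal (f x))"

definition visc_solution ::
  "(ereal set \<Rightarrow> ereal) \<Rightarrow> real \<Rightarrow> nat \<Rightarrow> 'a::euclidean_space set \<Rightarrow> ('a \<Rightarrow> real) \<Rightarrow> ('a \<Rightarrow> real) \<Rightarrow> bool"
  where
  "visc_solution ext s k \<Omega> f u \<longleftrightarrow>
     continuous_on UNIV u \<and> visc_subsolution ext s k \<Omega> f u \<and> visc_supersolution ext s k \<Omega> f u"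

end

theory Submission
  imports Defs
begin

text \<open>Both uniqueness and existence rest on a comparison principle, proved by doubling variables: at a
  maximum of \<open>u x - v y - c * (norm (x - y))\<^sup>2\<close> over the whole space, the second differences of \<open>u\<close> at
  \<open>x\<close> and of \<open>v\<close> at \<open>y\<close> are ordered for every step, and strictly so for steps longer than the diameter
  of the domain, where both functions vanish. Existence avoids Perron's method, and with it the
  semicontinuity of the operators along a Perron family: truncating the integral at step \<open>h\<close> and
  rounding steps up to multiples of \<open>h\<close> gives a monotone scheme, solved by the Knaster-Tarski
  argument between two barriers. The upper and lower half-relaxed limits as \<open>h\<close> tends to 0 are a sub- and a
  supersolution vanishing outside the domain, so they coincide by comparison. The barrier is the
  infimum over the balls \<open>ball y R\<close> whose intersection is the domain of powers of
  \<open>R\<^sup>2 - (norm (x - y))\<^sup>2\<close> with a small exponent. Super- and subsolutions, and suprema and infima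
  over frames, are exchanged by negation.\<close>

section \<open>The jump measure\<close>

text \<open>Paraboloids serve two purposes. Their openings at doubled maxima grow with the penalty,
  but the steps below \<open>\<rho>\<close> contribute only a multiple of
  \<open>\<rho> powr (2 - 2 * s)\<close>, so letting \<open>\<rho>\<close> tend to 0 at a fixed
  opening removes them. The same smallness lets a paraboloid replace an arbitrary test function on a
  small ball, so that the analysis runs with finite real integrals and extended reals occur only
  where test values are translated. The equation has no zeroth-order term from which a comparison
  principle could draw strictness; the gain comes from jumps that leave the domain. The barrier is
  estimated along each unit direction with one constant, and thus serves both extrema and every
  \<open>k\<close>. This is where intersections of balls enter: along a line the barrier of a ball
  is concave until the nearer exit, beyond which one of the two shifted values is 0, and the
  estimate survives infima over balls of equal radius.\<close>

definition levy_measure :: "real \<Rightarrow> real measure" where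
  "levy_measure s = density lborel (\<lambda>\<tau>. ennreal (indicator {0<..} \<tau> / \<tau> powr (1 + 2 * s)))"

lemma sets_levy_measure [measurable_cong, simp]: "sets (levy_measure s) = sets borel"
  by (simp add: levy_measure_def)

lemma space_levy_measure [simp]: "space (levy_measure s) = UNIV"
  by (simp add: levy_measure_def)

text \<open>Explicit integrals of powers are available as gauge integrals over closed sets; for
  nonnegative integrands they pass through the nonnegative Lebesgue integral. The equality is only
  almost everywhere because the integrands used later are cut at a strict inequality.\<close>

lemma has_bochner_integral_levy_measure:
  assumes [measurable]: "g \<in> borel_measurable borel"
    and int: "(G has_integral I) S"
    and G: "\<And>\<tau>. \<tau> \<in> S \<Longrightarrow> 0 \<le> G \<tau>"
    and eq: "AE \<tau> in lborel. indicator {0<..} \<tau> / \<tau> powr (1 + 2 * s) * g \<tau> = indicator S \<tau> * G \<tau>"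
  shows "has_bochner_integral (levy_measure s) g I"
  unfolding levy_measure_def
proof (rule has_bochner_integral_density)
  have I: "0 \<le> I"
    using has_integral_nonneg[OF int G] .
  have "AE \<tau> in lborel. 0 \<le> indicator {0<..} \<tau> / \<tau> powr (1 + 2 * s) * g \<tau>"
    using eq by eventually_elim (use G in \<open>auto simp: indicator_def\<close>)
  moreover have "(\<integral>\<^sup>+\<tau>. ennreal (indicator {0<..} \<tau> / \<tau> powr (1 + 2 * s) * g \<tau>) \<partial>lborel) = ennreal I"
    using nn_integral_has_integral_lebesgue[OF G int] eq
    by (subst nn_integral_cong_AE[where v = "\<lambda>\<tau>. ennreal (indicator S \<tau> * G \<tau>)"]) auto
  ultimately show "has_bochner_integral lborel (\<lambda>\<tau>. (indicator {0<..} \<tau> / \<tau> powr (1 + 2 * s)) *\<^sub>R g \<tau>) I"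
    using I by (intro has_bochner_integral_nn_integral) auto
qed auto

lemma AE_levy_measure_pos: "AE \<tau> in levy_measure s. 0 < \<tau>"
  unfolding levy_measure_def by (subst AE_density) (auto simp: indicator_def)

lemma AE_levy_measure_neq: "AE \<tau> in levy_measure s. \<tau> \<noteq> a"
  unfolding levy_measure_def using AE_lborel_singleton[of a]
  by (subst AE_density) (auto elim: eventually_mono)

lemma has_integral_levy_below:
  assumes "s < 1" "0 < \<rho>"
  shows "has_bochner_integral (levy_measure s) (\<lambda>\<tau>. if \<tau> < \<rho> then \<tau>\<^sup>2 else 0)
    (\<rho> powr (2 - 2 * s) / (2 - 2 * s))"
proof (rule has_bochner_integral_levy_measure[where S = "{0..\<rho>}" and G = "\<lambda>\<tau>. \<tau> powr (1 - 2 * s)"])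
  show "((\<lambda>\<tau>. \<tau> powr (1 - 2 * s)) has_integral \<rho> powr (2 - 2 * s) / (2 - 2 * s)) {0..\<rho>}"
    using has_integral_powr_from_0[of "1 - 2 * s" \<rho>] assms by (simp add: algebra_simps)
  show "AE \<tau> in lborel. indicator {0<..} \<tau> / \<tau> powr (1 + 2 * s) * (if \<tau> < \<rho> then \<tau>\<^sup>2 else 0) =
      indicator {0..\<rho>} \<tau> * \<tau> powr (1 - 2 * s)"
    using AE_lborel_singleton[of \<rho>]
  proof eventually_elim
    case (elim \<tau>)
    have "\<tau>\<^sup>2 / \<tau> powr (1 + 2 * s) = \<tau> powr (1 - 2 * s)" if "0 < \<tau>"
    proof -
      have "\<tau>\<^sup>2 = \<tau> powr 2" using that by simp
      then show ?thesis by (simp only: powr_diff[symmetric]) (simp add: algebra_simps)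
    qed
    with elim show ?case by (auto simp: indicator_def)
  qed
qed auto

lemma has_integral_levy_above_powr:
  assumes "a < 2 * s" "0 < d"
  shows "has_bochner_integral (levy_measure s) (\<lambda>\<tau>. if \<tau> < d then 0 else \<tau> powr a)
    (d powr (a - 2 * s) / (2 * s - a))"
proof (rule has_bochner_integral_levy_measure[where S = "{d..}" and G = "\<lambda>\<tau>. \<tau> powr (a - 1 - 2 * s)"])
  have "((\<lambda>\<tau>. \<tau> powr (a - 1 - 2 * s)) has_integral - (d powr (a - 2 * s) / (a - 2 * s))) {d..}"
    using has_integral_powr_to_inf[of "a - 1 - 2 * s" d] assms by (simp add: algebra_simps)
  moreover have "- (d powr (a - 2 * s) / (a - 2 * s)) = d powr (a - 2 * s) / (2 * s - a)"
    using assms by (simp add: field_simps)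
  ultimately show "((\<lambda>\<tau>. \<tau> powr (a - 1 - 2 * s)) has_integral d powr (a - 2 * s) / (2 * s - a)) {d..}"
    by simp
  have "\<tau> powr a / \<tau> powr (1 + 2 * s) = \<tau> powr (a - 1 - 2 * s)" for \<tau> :: real
    by (simp only: powr_diff[symmetric]) (simp add: algebra_simps)
  then show "AE \<tau> in lborel. indicator {0<..} \<tau> / \<tau> powr (1 + 2 * s) * (if \<tau> < d then 0 else \<tau> powr a) =
      indicator {d..} \<tau> * \<tau> powr (a - 1 - 2 * s)"
    using assms by (auto simp: indicator_def)
qed auto

text \<open>The standard majorant: second differences are quadratic at small steps, integrable since
  \<open>s < 1\<close>, and bounded at large ones, integrable since \<open>0 < s\<close>.\<close>

lemma has_integral_levy_split:
  assumes "0 < s" "s < 1" "0 < \<rho>"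
  shows "has_bochner_integral (levy_measure s) (\<lambda>\<tau>. if \<tau> < \<rho> then a * \<tau>\<^sup>2 else b)
    (a * (\<rho> powr (2 - 2 * s) / (2 - 2 * s)) + b * (\<rho> powr (- 2 * s) / (2 * s)))"
proof -
  have "has_bochner_integral (levy_measure s)
     (\<lambda>\<tau>. a * (if \<tau> < \<rho> then \<tau>\<^sup>2 else 0) + b * (if \<tau> < \<rho> then 0 else \<tau> powr 0))
    (a * (\<rho> powr (2 - 2 * s) / (2 - 2 * s)) + b * (\<rho> powr (0 - 2 * s) / (2 * s - 0)))"
    using assms
    by (intro has_bochner_integral_add has_bochner_integral_mult_right has_integral_levy_below
        has_integral_levy_above_powr) auto
  then show ?thesis
    by (rule has_bochner_integral_cong[THEN iffD1, rotated -1]) (use assms in auto)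
qed

lemma integrable_levy_split:
  assumes "0 < s" "s < 1" "0 < \<rho>"
    and [measurable]: "g \<in> borel_measurable borel"
    and "\<And>\<tau>. 0 < \<tau> \<Longrightarrow> \<bar>g \<tau>\<bar> \<le> (if \<tau> < \<rho> then a * \<tau>\<^sup>2 else b)"
  shows "integrable (levy_measure s) g"
proof (rule Bochner_Integration.integrable_bound)
  show "integrable (levy_measure s) (\<lambda>\<tau>. if \<tau> < \<rho> then a * \<tau>\<^sup>2 else b)"
    using has_integral_levy_split[OF assms(1-3)] by (rule integrable.intros)
  show "AE \<tau> in levy_measure s. norm (g \<tau>) \<le> norm (if \<tau> < \<rho> then a * \<tau>\<^sup>2 else b)"
    using AE_levy_measure_pos
  proof eventually_elim
    case (elim \<tau>)
    then show ?case using assms(5)[of \<tau>] by (auto split: if_splits)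
  qed
qed auto

lemma integral_levy_mono:
  fixes g g' :: "real \<Rightarrow> real"
  assumes "integrable (levy_measure s) g" "integrable (levy_measure s) g'"
    and "\<And>\<tau>. 0 < \<tau> \<Longrightarrow> g \<tau> \<le> g' \<tau>"
  shows "integral\<^sup>L (levy_measure s) g \<le> integral\<^sup>L (levy_measure s) g'"
  by (rule integral_mono_AE[OF assms(1,2)])
    (rule eventually_mono[OF AE_levy_measure_pos assms(3)])

lemma integral_levy_split_bound:
  assumes "0 < s" "s < 1" "0 < \<rho>" "integrable (levy_measure s) g"
    and "\<And>\<tau>. 0 < \<tau> \<Longrightarrow> g \<tau> \<le> (if \<tau> < \<rho> then a * \<tau>\<^sup>2 else b)"
  shows "integral\<^sup>L (levy_measure s) g
    \<le> a * (\<rho> powr (2 - 2 * s) / (2 - 2 * s)) + b * (\<rho> powr (- 2 * s) / (2 * s))"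
  using integral_levy_mono[OF assms(4) _ assms(5)]
    has_bochner_integral_iff[THEN iffD1, OF has_integral_levy_split[OF assms(1-3), of a b]]
  by auto

text \<open>A divergent integral would get the default value 0, and so would its inverse. Finiteness
  therefore has to be proved along with positivity; it follows from the bounds
  \<open>z\<^sup>2\<close> near 0 and 2 elsewhere for \<open>1 - cos z\<close>.\<close>

lemma frac_const_pos:
  assumes "0 < s" "s < 1"
  shows "0 < frac_const s"
proof -
  define g where "g z = (1 - cos z) / \<bar>z\<bar> powr (1 + 2 * s)" for z :: real
  have [measurable]: "g \<in> borel_measurable borel"
    unfolding g_def by measurable
  have g0: "0 \<le> g z" for z
    by (simp add: g_def)
  have cosb: "1 - cos z \<le> z\<^sup>2" for z :: real
  proof -
    have "1 - cos z = 2 * (sin (z/2))\<^sup>2"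
      using cos_double_sin[of "z/2"] by simp
    also have "(sin (z/2))\<^sup>2 \<le> (z/2)\<^sup>2"
      by (rule abs_le_square_iff[THEN iffD1, OF abs_sin_x_le_abs_x])
    finally have "1 - cos z \<le> z\<^sup>2 / 2" by (simp add: power_divide)
    then show ?thesis using zero_le_power2[of z] by linarith
  qed
  have "integrable (levy_measure s) (\<lambda>z. 1 - cos z)"
    using assms
  proof (rule integrable_levy_split[where \<rho> = 1 and a = 1 and b = 2])
    show "\<bar>1 - cos z\<bar> \<le> (if z < 1 then 1 * z\<^sup>2 else 2)" for z :: real
      using cosb[of z] cos_le_one[of z] cos_ge_minus_one[of z] by (auto simp del: cos_le_one simp: abs_if)
  qed auto
  then have pos: "integrable lborel (\<lambda>z. indicator {0<..} z * g z)"
    unfolding levy_measure_def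
    by (subst (asm) integrable_density) (auto simp: g_def indicator_def if_distrib cong: if_cong
        elim!: Bochner_Integration.integrable_cong[THEN iffD1, rotated -1])
  then have neg: "integrable lborel (\<lambda>z. indicator {0<..} (- z) * g (- z))"
    using lborel_integrable_real_affine[OF pos, of "-1" 0] by simp
  have gint: "integrable lborel g"
    by (rule Bochner_Integration.integrable_cong[THEN iffD1, rotated -1,
          OF Bochner_Integration.integrable_add[OF pos neg]])
      (auto simp: g_def indicator_def)
  \<comment> \<open>A lower bound for \<open>g\<close> on the interval from 1 to 2, which has length
    1: the cosine decreases there and the denominator is largest at 2.\<close>
  define \<eta> where "\<eta> = (1 - cos 1) / 2 powr (1 + 2 * s)"
  have "cos 1 < cos (0::real)"
    by (rule cos_monotone_0_pi) (use pi_gt3 in auto)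
  then have \<eta>: "0 < \<eta>"
    by (simp add: \<eta>_def)
  have "\<eta> * indicator {1..2} z \<le> g z" for z
  proof (cases "z \<in> {1..2}")
    case True
    have "cos z \<le> cos 1"
      by (rule cos_monotone_0_pi_le) (use True pi_gt3 in auto)
    then have "\<eta> \<le> g z"
      unfolding \<eta>_def g_def using True assms by (intro frac_le) (auto intro!: powr_mono2)
    with True show ?thesis by simp
  qed (use g0 in auto)
  then have "(LBINT z. \<eta> * indicator {1..2::real} z) \<le> (LBINT z. g z)"
    using gint by (intro integral_mono) auto
  then have "\<eta> \<le> (LBINT z. g z)"
    by simp
  with \<eta> show ?thesis
    by (simp add: frac_const_def g_def)
qed

section \<open>Extrema over orthonormal frames\<close>

text \<open>A Boolean flag instead of the operator itself, because negation flips it. The values are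
  real, so the order estimates below require boundedness on the unit sphere.\<close>

definition extremum :: "bool \<Rightarrow> nat \<Rightarrow> ('a::euclidean_space \<Rightarrow> real) \<Rightarrow> real" where
  "extremum upper k g =
     (if upper then Sup (sum g ` orthonormal_sets k) else Inf (sum g ` orthonormal_sets k))"

lemma orthonormal_sets_nonempty:
  assumes "k \<le> DIM('a)"
  shows "orthonormal_sets k \<noteq> ({} :: 'a::euclidean_space set set)"
proof -
  obtain B where "B \<subseteq> (Basis :: 'a set)" "card B = k"
    using obtain_subset_with_card_n[OF assms] by blast
  then have "B \<in> orthonormal_sets k"
    unfolding orthonormal_sets_def pairwise_def orthogonal_def
    by (auto intro: finite_subset simp: inner_Basis subset_iff)
  then show ?thesis by blast
qed

lemma sum_orthonormal_le:
  fixes g g' :: "'a::euclidean_space \<Rightarrow> real"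
  assumes "B \<in> orthonormal_sets k" "\<And>\<xi>. norm \<xi> = 1 \<Longrightarrow> g \<xi> \<le> g' \<xi> + e"
  shows "sum g B \<le> sum g' B + real k * e"
proof -
  have "sum g B \<le> (\<Sum>\<xi>\<in>B. g' \<xi> + e)"
    using assms by (intro sum_mono) (auto simp: orthonormal_sets_def)
  then show ?thesis
    using assms(1) by (simp add: sum.distrib orthonormal_sets_def)
qed

lemma bounded_sum_orthonormal:
  fixes g :: "'a::euclidean_space \<Rightarrow> real"
  assumes "bounded (g ` sphere 0 1)"
  shows "bounded (sum g ` orthonormal_sets k)"
proof -
  obtain K where K: "\<And>\<xi>. norm \<xi> = 1 \<Longrightarrow> \<bar>g \<xi>\<bar> \<le> K"
    using assms by (metis bounded_iff image_eqI mem_sphere_0 real_norm_def)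
  have "\<bar>sum g B\<bar> \<le> real k * K" if "B \<in> orthonormal_sets k" for B
    using sum_orthonormal_le[OF that, of g "\<lambda>_. 0" K] sum_orthonormal_le[OF that, of "\<lambda>_. 0" g K] K
    by (fastforce simp: abs_le_iff)
  then show ?thesis
    by (auto simp: bounded_iff)
qed

lemma extremum_neg:
  "extremum upper k (\<lambda>\<xi>. - g \<xi>) = - extremum (\<not> upper) k g"
proof -
  have "sum (\<lambda>\<xi>. - g \<xi>) ` orthonormal_sets k = uminus ` sum g ` orthonormal_sets k"
    by (auto simp: sum_negf image_iff)
  then show ?thesis
    by (simp add: extremum_def Inf_real_def image_comp comp_def)
qed

lemma extremum_const:
  assumes "k \<le> DIM('a)"
  shows "extremum upper k (\<lambda>_ :: 'a::euclidean_space. c) = real k * c"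
proof -
  have "sum (\<lambda>_ :: 'a. c) ` orthonormal_sets k = (\<lambda>_. real k * c) ` (orthonormal_sets k :: 'a set set)"
    by (intro image_cong) (auto simp: orthonormal_sets_def)
  then show ?thesis
    using orthonormal_sets_nonempty[OF assms] by (simp add: extremum_def)
qed

lemma extremum_mono:
  fixes g g' :: "'a::euclidean_space \<Rightarrow> real"
  assumes k: "k \<le> DIM('a)"
    and bdd: "bounded (g ` sphere 0 1)" "bounded (g' ` sphere 0 1)"
    and le: "\<And>\<xi>. norm \<xi> = 1 \<Longrightarrow> g \<xi> \<le> g' \<xi> + e"
  shows "extremum upper k g \<le> extremum upper k g' + real k * e"
proof -
  have ne: "orthonormal_sets k \<noteq> ({} :: 'a set set)"
    using orthonormal_sets_nonempty[OF k] .
  note b = bounded_sum_orthonormal[OF bdd(1), of k] bounded_sum_orthonormal[OF bdd(2), of k]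
  have "Sup (sum g ` orthonormal_sets k) \<le> Sup (sum g' ` orthonormal_sets k) + real k * e"
  proof (rule cSup_least)
    fix z assume "z \<in> sum g ` orthonormal_sets k"
    then obtain B where B: "B \<in> orthonormal_sets k" "z = sum g B" by auto
    have "sum g' B \<le> Sup (sum g' ` orthonormal_sets k)"
      using B(1) b(2) by (intro cSup_upper bounded_imp_bdd_above) auto
    then show "z \<le> Sup (sum g' ` orthonormal_sets k) + real k * e"
      using sum_orthonormal_le[of B k g g' e] le B by fastforce
  qed (use ne in auto)
  moreover have "Inf (sum g ` orthonormal_sets k) - real k * e \<le> Inf (sum g' ` orthonormal_sets k)"
  proof (rule cInf_greatest)
    fix z assume "z \<in> sum g' ` orthonormal_sets k"
    then obtain B where B: "B \<in> orthonormal_sets k" "z = sum g' B" by auto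
    have "Inf (sum g ` orthonormal_sets k) \<le> sum g B"
      using B(1) b(1) by (intro cInf_lower bounded_imp_bdd_below) auto
    then show "Inf (sum g ` orthonormal_sets k) - real k * e \<le> z"
      using sum_orthonormal_le[of B k g g' e] le B by fastforce
  qed (use ne in auto)
  ultimately show ?thesis
    by (auto simp: extremum_def)
qed

text \<open>At a doubled maximum only the sum of the two directional integrals is controlled. Moving
  one of them to the other side by negation turns the claim into monotonicity of a single
  extremum.\<close>

lemma extremum_dual_le:
  fixes g g' :: "'a::euclidean_space \<Rightarrow> real"
  assumes "k \<le> DIM('a)" "bounded (g ` sphere 0 1)" "bounded (g' ` sphere 0 1)"
    and "\<And>\<xi>. norm \<xi> = 1 \<Longrightarrow> g \<xi> + g' \<xi> \<le> e"
  shows "extremum upper k g + extremum (\<not> upper) k g' \<le> real k * e"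
proof -
  have "bounded ((\<lambda>\<xi>. - g' \<xi>) ` sphere 0 1)"
    using assms(3) by (auto simp: bounded_iff)
  moreover have "g \<xi> \<le> - g' \<xi> + e" if "norm \<xi> = 1" for \<xi>
    using assms(4)[OF that] by simp
  ultimately have "extremum upper k g \<le> extremum upper k (\<lambda>\<xi>. - g' \<xi>) + real k * e"
    using assms(1,2) by (intro extremum_mono) auto
  then show ?thesis by (simp add: extremum_neg)
qed

section \<open>Compactness of orthonormal frames\<close>

lemma convergent_subsequence_finite_family:
  fixes v :: "nat \<Rightarrow> nat \<Rightarrow> 'a::heine_borel"
  assumes "\<And>i. i < k \<Longrightarrow> bounded (range (\<lambda>j. v j i))"
  shows "\<exists>r l. strict_mono (r :: nat \<Rightarrow> nat) \<and> (\<forall>i<k. (\<lambda>j. v (r j) i) \<longlonglongrightarrow> l i)"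
  using assms
proof (induction k)
  case 0
  then show ?case by (auto intro!: exI[of _ id] simp: strict_mono_def)
next
  case (Suc k)
  then obtain r l where r: "strict_mono (r :: nat \<Rightarrow> nat)"
    and l: "\<And>i. i < k \<Longrightarrow> (\<lambda>j. v (r j) i) \<longlonglongrightarrow> l i" by force
  have "bounded (range (\<lambda>j. v (r j) k))"
    by (rule bounded_subset[OF Suc.prems[of k]]) auto
  then obtain l' r' where r': "strict_mono (r' :: nat \<Rightarrow> nat)" "((\<lambda>j. v (r j) k) \<circ> r') \<longlonglongrightarrow> l'"
    using bounded_imp_convergent_subsequence by blast
  have "(\<lambda>j. v ((r \<circ> r') j) i) \<longlonglongrightarrow> (l(k := l')) i" if "i < Suc k" for i
    using r'(2) LIMSEQ_subseq_LIMSEQ[OF l r'(1), of i] that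
    by (cases "i = k") (auto simp: comp_def)
  moreover have "strict_mono (r \<circ> r')"
    using r r'(1) by (rule strict_mono_o)
  ultimately show ?case by blast
qed

text \<open>Frames are sets, which do not converge as such. An enumeration makes them tuples of
  vectors, and the inner product relations are closed conditions, hence survive limits.\<close>

lemma orthonormal_sets_enum:
  assumes "B \<in> orthonormal_sets k"
  obtains v where "B = v ` {..<k}" "inj_on v {..<k}"
    "\<And>i j. i < k \<Longrightarrow> j < k \<Longrightarrow> v i \<bullet> v j = (if i = j then 1 else 0)"
proof -
  have B: "finite B" "card B = k" "pairwise orthogonal B" "\<And>\<xi>. \<xi> \<in> B \<Longrightarrow> norm \<xi> = 1"
    using assms by (auto simp: orthonormal_sets_def)
  obtain v where v: "bij_betw v {..<k} B"
    using ex_bij_betw_nat_finite[OF B(1)] B(2) by (auto simp: atLeast0LessThan)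
  show thesis
  proof (rule that[of v])
    show "B = v ` {..<k}" "inj_on v {..<k}"
      using v by (auto simp: bij_betw_def)
    fix i j assume ij: "i < k" "j < k"
    then have "v i \<in> B" "v j \<in> B" "v i = v j \<longleftrightarrow> i = j"
      using v by (auto simp: bij_betw_def inj_on_def)
    then show "v i \<bullet> v j = (if i = j then 1 else 0)"
      using B(3,4) by (auto simp: pairwise_def orthogonal_def norm_eq_1)
  qed
qed

lemma orthonormal_sets_image:
  assumes "\<And>i j. i < k \<Longrightarrow> j < k \<Longrightarrow> v i \<bullet> v j = (if i = j then 1 else 0)"
  shows "v ` {..<k} \<in> orthonormal_sets k" "inj_on v {..<k}"
proof -
  show inj: "inj_on v {..<k}"
    using assms by (auto simp: inj_on_def) (metis zero_neq_one)
  then show "v ` {..<k} \<in> orthonormal_sets k"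
    using assms by (auto simp: orthonormal_sets_def pairwise_def orthogonal_def card_image norm_eq_1)
qed

text \<open>For a supremum, almost optimal frames subconverge by compactness; for an infimum it suffices
  to test with constant sequences.\<close>

lemma extremum_limsup:
  fixes g :: "nat \<Rightarrow> 'a::euclidean_space \<Rightarrow> real"
  assumes k: "k \<le> DIM('a)"
    and bdd: "\<And>j. bounded (g j ` sphere 0 1)" "bounded (G ` sphere 0 1)"
    and lim: "\<And>r \<xi> l e. strict_mono r \<Longrightarrow> (\<And>j. norm (\<xi> j) = 1) \<Longrightarrow> \<xi> \<longlonglongrightarrow> l \<Longrightarrow> 0 < e \<Longrightarrow>
        \<forall>\<^sub>F j in sequentially. g (r j) (\<xi> j) \<le> G l + e"
    and L: "\<And>j. L j \<le> extremum upper k (g j)" "L \<longlonglongrightarrow> L0"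
  shows "L0 \<le> extremum upper k G"
proof -
  have ne: "orthonormal_sets k \<noteq> ({} :: 'a set set)"
    using orthonormal_sets_nonempty[OF k] .
  show ?thesis
  proof (cases upper)
    case False
    have "L0 \<le> z" if "z \<in> sum G ` orthonormal_sets k" for z
    proof -
      obtain B where B: "B \<in> orthonormal_sets k" "z = sum G B"
        using \<open>z \<in> _\<close> by auto
      have "L0 \<le> z + e" if e: "0 < e" for e
      proof -
        \<comment> \<open>The share of the error for one direction: \<open>k\<close> shares add up
          to at most \<open>e\<close>, and the denominator is positive for every
          \<open>k\<close>.\<close>
        have "\<forall>\<^sub>F j in sequentially. \<forall>\<xi>\<in>B. g j \<xi> \<le> G \<xi> + e / (real k + 1)"
        proof (rule eventually_ball_finite)
          show "finite B"
            using B by (simp add: orthonormal_sets_def)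
          show "\<forall>\<xi>\<in>B. \<forall>\<^sub>F j in sequentially. g j \<xi> \<le> G \<xi> + e / (real k + 1)"
            using lim[of id "\<lambda>_. _"] e B(1) by (auto simp: orthonormal_sets_def strict_mono_def)
        qed
        then have "\<forall>\<^sub>F j in sequentially. L j \<le> z + e"
        proof eventually_elim
          case (elim j)
          have "L j \<le> sum (g j) B"
            using L(1)[of j] cInf_lower[of "sum (g j) B" "sum (g j) ` orthonormal_sets k"] B(1) False
              bounded_sum_orthonormal[OF bdd(1)[of j], of k, THEN bounded_imp_bdd_below]
            by (auto simp: extremum_def)
          also have "\<dots> \<le> (\<Sum>\<xi>\<in>B. G \<xi> + e / (real k + 1))"
            using elim by (intro sum_mono) auto
          also have "\<dots> = z + real k * (e / (real k + 1))"
            using B by (simp add: sum.distrib orthonormal_sets_def)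
          also have "\<dots> \<le> z + e"
            using e by (simp add: field_simps)
          finally show ?case .
        qed
        then show ?thesis
          by (rule tendsto_upperbound[OF L(2)]) simp
      qed
      then show ?thesis
        by (rule field_le_epsilon)
    qed
    then show ?thesis
      using False ne by (auto simp: extremum_def intro!: cInf_greatest)
  next
    case True
    have "\<exists>B\<in>orthonormal_sets k. L j - inverse (real (Suc j)) < sum (g j) B" for j
    proof -
      have "L j - inverse (real (Suc j)) < L j"
        by simp
      also have "\<dots> \<le> Sup (sum (g j) ` orthonormal_sets k)"
        using L(1)[of j] True by (simp add: extremum_def)
      finally show ?thesis
        using less_cSupE[of _ "sum (g j) ` orthonormal_sets k"] ne by blast
    qed
    then obtain B where B: "\<And>j. B j \<in> orthonormal_sets k"
      and LB: "\<And>j. L j - inverse (real (Suc j)) < sum (g j) (B j)"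
      by metis
    have "\<exists>v. B j = v ` {..<k} \<and> inj_on v {..<k} \<and>
        (\<forall>i<k. \<forall>i'<k. v i \<bullet> v i' = (if i = i' then 1 else 0))" for j
      using orthonormal_sets_enum[OF B] by metis
    then obtain v where v: "\<And>j. B j = v j ` {..<k}" "\<And>j. inj_on (v j) {..<k}"
      and orth: "\<And>j i i'. i < k \<Longrightarrow> i' < k \<Longrightarrow> v j i \<bullet> v j i' = (if i = i' then 1 else 0)"
      by metis
    have norm_v: "norm (v j i) = 1" if "i < k" for i j
      using orth[OF that that] by (simp add: norm_eq_1)
    have "bounded (range (\<lambda>j. v j i))" if "i < k" for i
      using norm_v[OF that] by (auto simp: bounded_iff intro!: exI[of _ 1])
    then obtain r l where r: "strict_mono (r :: nat \<Rightarrow> nat)"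
      and l: "\<And>i. i < k \<Longrightarrow> (\<lambda>j. v (r j) i) \<longlonglongrightarrow> l i"
      using convergent_subsequence_finite_family by blast
    have "l i \<bullet> l i' = (if i = i' then 1 else 0)" if "i < k" "i' < k" for i i'
      using tendsto_inner[OF l[OF that(1)] l[OF that(2)]] orth[OF that] LIMSEQ_unique
      by (auto simp: tendsto_const_iff)
    note Bl = orthonormal_sets_image[OF this, of k]
    have "L0 \<le> sum G (l ` {..<k}) + e" if e: "0 < e" for e
    proof -
      \<comment> \<open>Almost optimal frames move with \<open>j\<close>; this is why the hypothesis
        \<open>lim\<close> admits varying directions along a subsequence.\<close>
      have "\<forall>\<^sub>F j in sequentially. \<forall>i\<in>{..<k}. g (r j) (v (r j) i) \<le> G (l i) + e / (real k + 1)"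
      proof (rule eventually_ball_finite)
        show "\<forall>i\<in>{..<k}. \<forall>\<^sub>F j in sequentially. g (r j) (v (r j) i) \<le> G (l i) + e / (real k + 1)"
          using lim[OF r norm_v l] e by auto
      qed auto
      then have "\<forall>\<^sub>F j in sequentially. L (r j) - inverse (real (Suc (r j))) \<le> sum G (l ` {..<k}) + e"
      proof eventually_elim
        case (elim j)
        have "L (r j) - inverse (real (Suc (r j))) \<le> sum (g (r j)) (B (r j))"
          using LB less_imp_le by blast
        also have "\<dots> = (\<Sum>i<k. g (r j) (v (r j) i))"
          using v by (simp add: sum.reindex)
        also have "\<dots> \<le> (\<Sum>i<k. G (l i) + e / (real k + 1))"
          using elim by (intro sum_mono) auto
        also have "\<dots> = sum G (l ` {..<k}) + real k * (e / (real k + 1))"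
          using Bl by (simp add: sum.distrib sum.reindex)
        also have "\<dots> \<le> sum G (l ` {..<k}) + e"
          using e by (simp add: field_simps)
        finally show ?case .
      qed
      moreover have "(\<lambda>j. L (r j) - inverse (real (Suc (r j)))) \<longlonglongrightarrow> L0 - 0"
        using LIMSEQ_subseq_LIMSEQ[OF L(2) r] LIMSEQ_subseq_LIMSEQ[OF LIMSEQ_inverse_real_of_nat r]
        by (intro tendsto_diff) (auto simp: comp_def)
      ultimately have "L0 - 0 \<le> sum G (l ` {..<k}) + e"
        using tendsto_upperbound by (metis sequentially_bot)
      then show ?thesis by simp
    qed
    then have "L0 \<le> sum G (l ` {..<k})"
      by (rule field_le_epsilon)
    also have "\<dots> \<le> Sup (sum G ` orthonormal_sets k)"
      using Bl bounded_sum_orthonormal[OF bdd(2)] by (intro cSup_upper bounded_imp_bdd_above) auto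
    finally show ?thesis
      using True by (simp add: extremum_def)
  qed
qed

section \<open>Paraboloid subsolutions and comparison\<close>

text \<open>\<open>2 * c * \<tau>\<^sup>2\<close> is the second difference, in a unit direction and
  with step \<open>\<tau>\<close>, of any paraboloid with opening \<open>c\<close>, whatever its
  slope. So this is the directional integral in which \<open>u\<close> is replaced by a touching
  paraboloid at steps below \<open>\<rho>\<close>.\<close>

definition trunc_op :: "real \<Rightarrow> real \<Rightarrow> real \<Rightarrow> ('a::euclidean_space \<Rightarrow> real) \<Rightarrow> 'a \<Rightarrow> 'a \<Rightarrow> real" where
  "trunc_op s c \<rho> u x \<xi> =
     (\<integral>\<tau>. (if \<tau> < \<rho> then 2 * c * \<tau>\<^sup>2 else second_diff u x (\<tau> *\<^sub>R \<xi>)) \<partial>levy_measure s)"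

text \<open>The right-hand side \<open>F\<close> stands for \<open>f\<close> divided by the normalizing constant. Supersolutions
  \<open>v\<close> are treated as subsolutions \<open>- v\<close> for the dual extremum and \<open>- F\<close>.\<close>

definition quad_subsolution ::
  "real \<Rightarrow> nat \<Rightarrow> 'a::euclidean_space set \<Rightarrow> bool \<Rightarrow> ('a \<Rightarrow> real) \<Rightarrow> ('a \<Rightarrow> real) \<Rightarrow> bool" where
  "quad_subsolution s k \<Omega> upper F u \<longleftrightarrow>
     (\<forall>x\<in>\<Omega>. \<forall>p c r \<rho>. 0 \<le> c \<and> 0 < \<rho> \<and> \<rho> < r \<and>
        (\<forall>y\<in>ball x r. u y \<le> u x + p \<bullet> (y - x) + c * (norm (y - x))\<^sup>2) \<longrightarrow>
        F x \<le> extremum upper k (trunc_op s c \<rho> u x))"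

lemma quad_subsolutionD:
  assumes "quad_subsolution s k \<Omega> upper F u" "x \<in> \<Omega>" "0 \<le> c" "0 < \<rho>" "\<rho> < r"
    and "\<And>y. y \<in> ball x r \<Longrightarrow> u y \<le> u x + p \<bullet> (y - x) + c * (norm (y - x))\<^sup>2"
  shows "F x \<le> extremum upper k (trunc_op s c \<rho> u x)"
  using assms unfolding quad_subsolution_def by blast

lemma abs_second_diff_le:
  assumes "\<And>z. \<bar>u z\<bar> \<le> M"
  shows "\<bar>second_diff u x y\<bar> \<le> 4 * M"
  using assms[of x] assms[of "x + y"] assms[of "x - y"] by (simp add: second_diff_def)

lemma second_diff_minus: "second_diff (\<lambda>z. - u z) x y = - second_diff u x y"
  by (simp add: second_diff_def)

lemma borel_measurable_second_diff:
  assumes [measurable]: "u \<in> borel_measurable (borel :: 'a::euclidean_space measure)"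
  shows "(\<lambda>\<tau>. second_diff u x (\<tau> *\<^sub>R \<xi>)) \<in> borel_measurable (borel :: real measure)"
  unfolding second_diff_def by measurable

lemma integrable_trunc_op:
  fixes u :: "'a::euclidean_space \<Rightarrow> real"
  assumes "0 < s" "s < 1" "0 < \<rho>" and u: "u \<in> borel_measurable borel" "\<And>z. \<bar>u z\<bar> \<le> M"
  shows "integrable (levy_measure s)
    (\<lambda>\<tau>. if \<tau> < \<rho> then 2 * c * \<tau>\<^sup>2 else second_diff u x (\<tau> *\<^sub>R \<xi>))"
proof -
  note [measurable] = borel_measurable_second_diff[OF u(1)]
  show ?thesis
    using assms(1-3) abs_second_diff_le[of u M x, OF u(2)]
    by (intro integrable_levy_split[where \<rho> = \<rho> and a = "2 * \<bar>c\<bar>" and b = "4 * M"])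
      (auto simp: abs_mult)
qed

lemma bounded_integral_levy:
  assumes "0 < s" "s < 1" "0 < \<rho>"
    and "\<And>\<xi>. \<xi> \<in> S \<Longrightarrow> integrable (levy_measure s) (g \<xi>)"
    and le: "\<And>\<xi> \<tau>. \<xi> \<in> S \<Longrightarrow> 0 < \<tau> \<Longrightarrow> \<bar>g \<xi> \<tau> :: real\<bar> \<le> (if \<tau> < \<rho> then a * \<tau>\<^sup>2 else b)"
  shows "bounded ((\<lambda>\<xi>. \<integral>\<tau>. g \<xi> \<tau> \<partial>levy_measure s) ` S)"
proof -
  define C where "C = a * (\<rho> powr (2 - 2 * s) / (2 - 2 * s)) + b * (\<rho> powr (- 2 * s) / (2 * s))"
  have "\<bar>\<integral>\<tau>. g \<xi> \<tau> \<partial>levy_measure s\<bar> \<le> C" if "\<xi> \<in> S" for \<xi>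
  proof -
    have "\<bar>\<integral>\<tau>. g \<xi> \<tau> \<partial>levy_measure s\<bar> \<le> (\<integral>\<tau>. \<bar>g \<xi> \<tau>\<bar> \<partial>levy_measure s)"
      by (rule integral_abs_bound)
    also have "\<dots> \<le> C"
      unfolding C_def by (rule integral_levy_split_bound) (use assms that in auto)
    finally show ?thesis .
  qed
  then show ?thesis
    by (auto simp: bounded_iff)
qed

lemma bounded_trunc_op:
  fixes u :: "'a::euclidean_space \<Rightarrow> real"
  assumes "0 < s" "s < 1" "0 < \<rho>" and u: "u \<in> borel_measurable borel" "\<And>z. \<bar>u z\<bar> \<le> M"
  shows "bounded (trunc_op s c \<rho> u x ` sphere 0 1)"
  unfolding trunc_op_def using assms(1-3) abs_second_diff_le[of u M x, OF u(2)]
  by (intro bounded_integral_levy[where \<rho> = \<rho> and a = "2 * \<bar>c\<bar>" and b = "4 * M"]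
      integrable_trunc_op[OF assms]) (auto simp: abs_mult)

section \<open>Upper semicontinuous functions and the comparison principle\<close>

lemma usc_onD: "usc_on UNIV u \<Longrightarrow> open {x. u x < c}"
  by (simp add: usc_on_def)

lemma usc_on_borel_measurable:
  fixes u :: "'a::euclidean_space \<Rightarrow> real"
  assumes "usc_on UNIV u"
  shows "u \<in> borel_measurable borel"
  using usc_onD[OF assms] by (intro borel_measurableI_less) auto

lemma usc_on_eventually_less:
  assumes "usc_on UNIV u" "X \<longlonglongrightarrow> x" "u x < c"
  shows "\<forall>\<^sub>F j in sequentially. u (X j) < c"
  using topological_tendstoD[OF assms(2) usc_onD[OF assms(1), of c]] assms(3) by simp

lemma usc_on_add:
  fixes u v :: "'a::topological_space \<Rightarrow> real"
  assumes "usc_on UNIV u" "usc_on UNIV v"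
  shows "usc_on UNIV (\<lambda>x. u x + v x)"
proof -
  have "{x. u x + v x < c} = (\<Union>q. {x. u x < q} \<inter> {x. v x < c - q})" for c
  proof safe
    fix x assume "u x + v x < c"
    then show "x \<in> (\<Union>q. {x. u x < q} \<inter> {x. v x < c - q})"
      by (intro UN_I[of "u x + (c - u x - v x) / 2"]) (auto simp: field_simps)
  qed simp
  then show ?thesis
    using assms by (auto simp: usc_on_def intro!: open_UN open_Int)
qed

lemma usc_on_compose:
  assumes "usc_on UNIV u" "continuous_on UNIV g"
  shows "usc_on UNIV (\<lambda>x. u (g x))"
  using open_vimage[OF usc_onD[OF assms(1)] assms(2)] by (simp add: usc_on_def vimage_def)

lemma continuous_on_imp_usc_on:
  fixes u :: "'a::topological_space \<Rightarrow> real"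
  assumes "continuous_on UNIV u"
  shows "usc_on UNIV u"
  using open_Collect_less[OF assms continuous_on_const] by (simp add: usc_on_def)

lemma usc_on_attains_max:
  fixes u :: "'a::topological_space \<Rightarrow> real"
  assumes "usc_on UNIV u" "compact K" "K \<noteq> {}"
  obtains x where "x \<in> K" "\<And>y. y \<in> K \<Longrightarrow> u y \<le> u x"
proof (rule ccontr)
  assume "\<not> thesis"
  then have "\<forall>x\<in>K. \<exists>y\<in>K. u x < u y"
    using that by (meson not_le)
  then have "K \<subseteq> (\<Union>y\<in>K. {x. u x < u y})"
    by auto
  then obtain C where C: "C \<subseteq> K" "finite C" "K \<subseteq> (\<Union>y\<in>C. {x. u x < u y})"
    using compactE_image[OF assms(2), of K "\<lambda>y. {x. u x < u y}"] usc_onD[OF assms(1)] by metis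
  with assms(3) have "C \<noteq> {}" by auto
  then have "Max (u ` C) \<in> u ` C"
    using C(2) by simp
  then obtain y where y: "y \<in> C" "u y = Max (u ` C)" by auto
  then obtain z where z: "z \<in> C" "u y < u z"
    using C by auto
  from z(1) have "u z \<le> Max (u ` C)"
    using C(2) by simp
  then show False
    using z(2) y(2) by simp
qed

text \<open>The translation inequality at a doubled maximum orders the second differences for every
  step, and by at least twice the maximum for steps longer than the diameter.\<close>

lemma doubled_maximum_estimate:
  fixes u v :: "'a::euclidean_space \<Rightarrow> real"
  assumes s: "0 < s" "s < 1" and k: "k \<le> DIM('a)"
    and u: "u \<in> borel_measurable borel" "\<And>z. \<bar>u z\<bar> \<le> M" "\<And>z. L < norm z \<Longrightarrow> u z \<le> 0"
      "quad_subsolution s k \<Omega> upper F u"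
    and v: "v \<in> borel_measurable borel" "\<And>z. \<bar>v z\<bar> \<le> M" "\<And>z. L < norm z \<Longrightarrow> v z \<le> 0"
      "quad_subsolution s k \<Omega> (\<not> upper) (\<lambda>x. - F x) v"
    and xy: "x \<in> \<Omega>" "y \<in> \<Omega>" "norm x \<le> L" "norm y \<le> L" and c: "0 \<le> c"
    and m: "m \<le> u x + v y"
    and max: "\<And>x' y'. u x' + v y' - c * (norm (x' - y'))\<^sup>2 \<le> u x + v y - c * (norm (x - y))\<^sup>2"
  shows "F x - F y \<le> real k * ((- 2 * m) * ((2 * L + 1) powr (- 2 * s) / (2 * s)))"
proof -
  \<comment> \<open>A step of length at least \<open>D\<close> from a point of norm at most
    \<open>L\<close> ends at norm greater than \<open>L\<close>, in both orientations; the summand 1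
    gives the strict inequality.\<close>
  define D where "D = 2 * L + 1"
  have D: "1 \<le> D" using xy(3) norm_ge_zero[of x] unfolding D_def by linarith
  define e where "e \<rho> = 4 * c * (\<rho> powr (2 - 2 * s) / (2 - 2 * s)) + (- 2 * m) * (D powr (- 2 * s) / (2 * s))"
    for \<rho>
  have F_le: "F x - F y \<le> real k * e \<rho>" if \<rho>: "0 < \<rho>" "\<rho> < 1" for \<rho>
  proof -
    \<comment> \<open>Fixing one variable of the doubled maximum and expanding the penalty around
      the other gives contact with a paraboloid of opening \<open>c\<close>. The contact is global,
      so the radius 1 serves for every \<open>\<rho> < 1\<close>.\<close>
    have sq: "(norm (z - y))\<^sup>2 = (norm (z - x))\<^sup>2 + 2 * ((x - y) \<bullet> (z - x)) + (norm (x - y))\<^sup>2"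
      "(norm (x - z))\<^sup>2 = (norm (z - y))\<^sup>2 + 2 * ((y - x) \<bullet> (z - y)) + (norm (x - y))\<^sup>2" for z
      unfolding power2_norm_eq_inner by (auto simp: inner_diff inner_commute algebra_simps)
    have "F x \<le> extremum upper k (trunc_op s c \<rho> u x)"
    proof (rule quad_subsolutionD[OF u(4) xy(1) c \<rho>])
      fix z
      show "u z \<le> u x + ((2 * c) *\<^sub>R (x - y)) \<bullet> (z - x) + c * (norm (z - x))\<^sup>2"
        using max[of z y] unfolding sq(1)[of z] by (simp add: algebra_simps)
    qed
    moreover have "- F y \<le> extremum (\<not> upper) k (trunc_op s c \<rho> v y)"
    proof (rule quad_subsolutionD[OF v(4) xy(2) c \<rho>])
      fix z
      show "v z \<le> v y + ((2 * c) *\<^sub>R (y - x)) \<bullet> (z - y) + c * (norm (z - y))\<^sup>2"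
        using max[of x z] unfolding sq(2)[of z] by (simp add: algebra_simps)
    qed
    moreover have "extremum upper k (trunc_op s c \<rho> u x) + extremum (\<not> upper) k (trunc_op s c \<rho> v y)
        \<le> real k * e \<rho>"
    proof (rule extremum_dual_le[OF k])
      show "bounded (trunc_op s c \<rho> u x ` sphere 0 1)" "bounded (trunc_op s c \<rho> v y ` sphere 0 1)"
        using bounded_trunc_op[OF s \<rho>(1) u(1,2)] bounded_trunc_op[OF s \<rho>(1) v(1,2)] by auto
      fix \<xi> :: 'a assume \<xi>: "norm \<xi> = 1"
      let ?gu = "\<lambda>\<tau>. if \<tau> < \<rho> then 2 * c * \<tau>\<^sup>2 else second_diff u x (\<tau> *\<^sub>R \<xi>)"
      let ?gv = "\<lambda>\<tau>. if \<tau> < \<rho> then 2 * c * \<tau>\<^sup>2 else second_diff v y (\<tau> *\<^sub>R \<xi>)"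
      let ?h = "\<lambda>\<tau>. (if \<tau> < \<rho> then 4 * c * \<tau>\<^sup>2 else 0) + (if \<tau> < D then 0 * \<tau>\<^sup>2 else - 2 * m)"
      have int: "integrable (levy_measure s) ?gu" "integrable (levy_measure s) ?gv"
        using integrable_trunc_op[OF s \<rho>(1) u(1,2)] integrable_trunc_op[OF s \<rho>(1) v(1,2)] by auto
      have h: "has_bochner_integral (levy_measure s) ?h
          (4 * c * (\<rho> powr (2 - 2 * s) / (2 - 2 * s)) + 0 * (\<rho> powr (- 2 * s) / (2 * s)) +
          (0 * (D powr (2 - 2 * s) / (2 - 2 * s)) + (- 2 * m) * (D powr (- 2 * s) / (2 * s))))"
        using D \<rho> s by (intro has_bochner_integral_add has_integral_levy_split) auto
      have "trunc_op s c \<rho> u x \<xi> + trunc_op s c \<rho> v y \<xi> = (\<integral>\<tau>. ?gu \<tau> + ?gv \<tau> \<partial>levy_measure s)"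
        unfolding trunc_op_def using int by (rule Bochner_Integration.integral_add[symmetric])
      also have "\<dots> \<le> integral\<^sup>L (levy_measure s) ?h"
      proof (rule integral_levy_mono)
        show "integrable (levy_measure s) ?h"
          using h by (rule integrable.intros)
        fix \<tau> :: real assume \<tau>: "0 < \<tau>"
        have shift: "u (x + z) + v (y + z) \<le> u x + v y" for z
          using max[of "x + z" "y + z"] by simp
        have le0: "second_diff u x (\<tau> *\<^sub>R \<xi>) + second_diff v y (\<tau> *\<^sub>R \<xi>) \<le> 0"
          using shift[of "\<tau> *\<^sub>R \<xi>"] shift[of "- (\<tau> *\<^sub>R \<xi>)"] by (simp add: second_diff_def)
        have far: "second_diff u x (\<tau> *\<^sub>R \<xi>) + second_diff v y (\<tau> *\<^sub>R \<xi>) \<le> - 2 * m" if "D \<le> \<tau>"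
        proof -
          have n: "L < norm (z + \<tau> *\<^sub>R \<xi>)" "L < norm (z - \<tau> *\<^sub>R \<xi>)" if "norm z \<le> L" for z
            using norm_triangle_ineq2[of "\<tau> *\<^sub>R \<xi>" "- z"] norm_triangle_ineq2[of "\<tau> *\<^sub>R \<xi>" z]
              that \<xi> \<open>D \<le> \<tau>\<close> \<tau> unfolding D_def by (auto simp: norm_minus_commute add.commute)
          show ?thesis
            using u(3)[OF n(1)] u(3)[OF n(2)] v(3)[OF n(1)] v(3)[OF n(2)] xy(3,4) m
            by (auto simp: second_diff_def) (smt (verit))
        qed
        show "?gu \<tau> + ?gv \<tau> \<le> ?h \<tau>"
          using le0 far \<rho> D by (auto split: if_splits)
      qed (use int in auto)
      also have "\<dots> = e \<rho>"
        using h by (auto simp: has_bochner_integral_iff e_def)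
      finally show "trunc_op s c \<rho> u x \<xi> + trunc_op s c \<rho> v y \<xi> \<le> e \<rho>" .
    qed
    ultimately show ?thesis by linarith
  qed
  \<comment> \<open>The points \<open>x\<close>, \<open>y\<close> and the opening \<open>c\<close>
    stay fixed while \<open>\<rho>\<close> tends to 0, so the contribution of the paraboloids
    disappears and only that of the long jumps remains.\<close>
  have "((\<lambda>\<rho>. real k * e \<rho>) \<longlongrightarrow> real k * (4 * c * (0 / (2 - 2 * s)) + (- 2 * m) * (D powr (- 2 * s) / (2 * s))))
      (at_right 0)"
    unfolding e_def using s
    by (intro tendsto_intros tendsto_zero_powrI[where b = "2 - 2 * s"] eventually_at_right_less[THEN eventually_mono]) auto
  moreover have "\<forall>\<^sub>F \<rho> in at_right 0. F x - F y \<le> real k * e \<rho>"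
    using F_le by (auto simp: eventually_at_right[of 0 1] intro!: exI[of _ 1])
  ultimately have "F x - F y \<le> real k * (4 * c * (0 / (2 - 2 * s)) + (- 2 * m) * (D powr (- 2 * s) / (2 * s)))"
    by (intro tendsto_lowerbound) auto
  then show ?thesis
    by (simp add: D_def)
qed

text \<open>If \<open>u + v\<close> had a positive value \<open>m\<close>, the doubled maxima for
  growing penalties would accumulate at a diagonal point where \<open>u + v \<ge> m\<close>, hence
  inside \<open>\<Omega>\<close>. The preceding estimate bounds \<open>F (X n) - F (Y n)\<close>
  above by a negative constant that does not depend on the penalty, whereas continuity of
  \<open>F\<close> sends this difference to 0.\<close>

theorem quad_comparison:
  fixes u v :: "'a::euclidean_space \<Rightarrow> real"
  assumes s: "0 < s" "s < 1" and k: "1 \<le> k" "k \<le> DIM('a)"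
    and \<Omega>: "open \<Omega>" "bounded \<Omega>" and F: "continuous_on \<Omega> F"
    and u: "usc_on UNIV u" "bounded (range u)" "\<And>z. z \<notin> \<Omega> \<Longrightarrow> u z \<le> 0"
      "quad_subsolution s k \<Omega> upper F u"
    and v: "usc_on UNIV v" "bounded (range v)" "\<And>z. z \<notin> \<Omega> \<Longrightarrow> v z \<le> 0"
      "quad_subsolution s k \<Omega> (\<not> upper) (\<lambda>x. - F x) v"
  shows "u x + v x \<le> 0"
proof (rule ccontr)
  assume neg: "\<not> u x + v x \<le> 0"
  define m where "m = u x + v x"
  have m: "0 < m"
    using neg unfolding m_def by linarith
  then have x: "x \<in> \<Omega>"
    using u(3)[of x] v(3)[of x] by (force simp: m_def)
  obtain M1 where M1: "\<And>z. \<bar>u z\<bar> \<le> M1" using u(2) by (auto simp: bounded_iff)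
  obtain M2 where M2: "\<And>z. \<bar>v z\<bar> \<le> M2" using v(2) by (auto simp: bounded_iff)
  define M where "M = max M1 M2"
  have M: "\<bar>u z\<bar> \<le> M" "\<bar>v z\<bar> \<le> M" for z
    using M1[of z] M2[of z] by (auto simp: M_def)
  have M0: "0 \<le> M" using M(1)[of x] by linarith
  obtain L0 where L0: "\<And>z. z \<in> \<Omega> \<Longrightarrow> norm z \<le> L0" using \<Omega>(2) by (auto simp: bounded_iff)
  define L where "L = L0 + 1"
  have L: "norm z \<le> L" if "z \<in> \<Omega>" for z using L0[OF that] by (simp add: L_def)
  define K where "K = cball (0::'a) L \<times> cball (0::'a) L"
  \<comment> \<open>The offset \<open>M + 1\<close> makes a maximum over the compact set
    \<open>K\<close> a maximum over the whole space, as translation arguments need. Outside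
    \<open>K\<close>, a pair with one entry in \<open>\<Omega>\<close> has its entries at distance
    at least 1, and then the penalty exceeds \<open>M\<close>, a bound for \<open>u + v\<close>
    since one of the two summands is nonpositive there; without an entry in \<open>\<Omega>\<close>
    both are.\<close>
  define \<Phi> where "\<Phi> n z = u (fst z) + v (snd z) + - (M + 1 + real n) * (norm (fst z - snd z))\<^sup>2"
    for n :: nat and z
  have \<Phi>_eq: "\<Phi> n z = u (fst z) + v (snd z) - (M + 1 + real n) * (norm (fst z - snd z))\<^sup>2" for n z
    by (simp only: \<Phi>_def mult_minus_left diff_conv_add_uminus)
  have "\<exists>z\<in>K. \<forall>z'\<in>K. \<Phi> n z' \<le> \<Phi> n z" for n
  proof (rule usc_on_attains_max[of "\<Phi> n" K])
    show "usc_on UNIV (\<Phi> n)"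
      unfolding \<Phi>_def
      by (intro usc_on_add usc_on_compose[OF u(1)] usc_on_compose[OF v(1)] continuous_on_imp_usc_on continuous_intros)
    show "compact K" unfolding K_def by (intro compact_Times compact_cball)
    have "(x, x) \<in> K" using L[OF x] by (simp add: K_def)
    then show "K \<noteq> {}" by blast
  qed blast
  then obtain Z where Z: "\<And>n. Z n \<in> K" "\<And>n z. z \<in> K \<Longrightarrow> \<Phi> n z \<le> \<Phi> n (Z n)"
    by metis
  define X Y where "X n = fst (Z n)" and "Y n = snd (Z n)" for n
  have XY: "norm (X n) \<le> L" "norm (Y n) \<le> L" for n
    using Z(1)[of n] by (auto simp: K_def X_def Y_def mem_Times_iff)
  have \<Phi>_ge: "m \<le> \<Phi> n (Z n)" for n
    using Z(2)[of "(x, x)" n] L[OF x] by (simp add: K_def \<Phi>_def m_def)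
  have \<Phi>_max: "\<Phi> n z \<le> \<Phi> n (Z n)" for n z
  proof (cases "z \<in> K")
    case False
    define q where "q = (M + 1 + real n) * (norm (fst z - snd z))\<^sup>2"
    have \<Phi>: "\<Phi> n z = u (fst z) + v (snd z) - q" "0 \<le> q"
      using M0 by (simp_all add: \<Phi>_eq q_def)
    have "\<Phi> n z \<le> 0"
    proof (cases "fst z \<in> \<Omega> \<or> snd z \<in> \<Omega>")
      case True
      have far: "1 \<le> norm (a - b)" "1 \<le> norm (b - a)" "b \<notin> \<Omega>" if "a \<in> \<Omega>" "L < norm b" for a b
        using that L0[of a] L[of b] norm_triangle_ineq2[of b a] by (auto simp: L_def norm_minus_commute)
      have "1 \<le> norm (fst z - snd z)" and le: "u (fst z) \<le> 0 \<or> v (snd z) \<le> 0"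
        using far[of "fst z" "snd z"] far[of "snd z" "fst z"] True False L[of "fst z"] L[of "snd z"]
          u(3)[of "fst z"] v(3)[of "snd z"]
        by (auto simp: K_def mem_Times_iff not_le)
      have "(M + 1 + real n) * 1 \<le> q"
        using M0 \<open>1 \<le> norm (fst z - snd z)\<close> unfolding q_def by (intro mult_left_mono) auto
      moreover have "u (fst z) + v (snd z) \<le> M"
        using M(1)[of "fst z"] M(2)[of "snd z"] le by auto
      ultimately show ?thesis
        using \<Phi> by simp
    next
      case False
      then show ?thesis using u(3)[of "fst z"] v(3)[of "snd z"] \<Phi> by simp
    qed
    then show ?thesis using \<Phi>_ge[of n] m by linarith
  qed (use Z in auto)
  have uv_ge: "m + (M + 1 + real n) * (norm (X n - Y n))\<^sup>2 \<le> u (X n) + v (Y n)" for n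
    using \<Phi>_ge[of n] unfolding \<Phi>_eq X_def Y_def by linarith
  have "bounded (range X)"
    using XY by (auto simp: bounded_iff)
  then obtain r z where r: "strict_mono (r :: nat \<Rightarrow> nat)" and Xz: "(X \<circ> r) \<longlonglongrightarrow> z"
    using bounded_imp_convergent_subsequence by blast
  have XY_le: "(norm (X n - Y n))\<^sup>2 \<le> 2 * M * inverse (real (Suc n))" for n
  proof -
    have "real (Suc n) * (norm (X n - Y n))\<^sup>2 \<le> (M + 1 + real n) * (norm (X n - Y n))\<^sup>2"
      using M0 by (intro mult_right_mono) auto
    also have "\<dots> \<le> 2 * M"
      using uv_ge[of n] M(1)[of "X n"] M(2)[of "Y n"] m by linarith
    finally have "(norm (X n - Y n))\<^sup>2 \<le> 2 * M / real (Suc n)"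
      by (subst pos_le_divide_eq) (simp_all only: mult.commute of_nat_0_less_iff zero_less_Suc)
    then show ?thesis by (simp only: divide_inverse)
  qed
  have "(\<lambda>n. 2 * M * inverse (real (Suc n))) \<longlonglongrightarrow> 2 * M * 0"
    by (intro tendsto_mult_left LIMSEQ_inverse_real_of_nat)
  then have "(\<lambda>n. 2 * M * inverse (real (Suc n))) \<longlonglongrightarrow> 0"
    by (simp only: mult_zero_right)
  then have "(\<lambda>n. (norm (X n - Y n))\<^sup>2) \<longlonglongrightarrow> 0"
    by (rule tendsto_sandwich[OF _ _ tendsto_const, rotated 2])
      (rule always_eventually allI zero_le_power2 XY_le)+
  then have "(\<lambda>n. sqrt ((norm (X n - Y n))\<^sup>2)) \<longlonglongrightarrow> sqrt 0"
    by (rule tendsto_real_sqrt)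
  then have "(\<lambda>n. X n - Y n) \<longlonglongrightarrow> 0"
    by (simp add: tendsto_norm_zero_iff)
  from tendsto_diff[OF Xz LIMSEQ_subseq_LIMSEQ[OF this r]]
  have Yz: "(Y \<circ> r) \<longlonglongrightarrow> z"
    by (simp add: comp_def)
  have "m \<le> u z + v z + e" if e: "0 < e" for e
  proof -
    have "\<forall>\<^sub>F j in sequentially. u ((X \<circ> r) j) < u z + e / 2" "\<forall>\<^sub>F j in sequentially. v ((Y \<circ> r) j) < v z + e / 2"
      using e usc_on_eventually_less[OF u(1) Xz, of "u z + e / 2"]
        usc_on_eventually_less[OF v(1) Yz, of "v z + e / 2"] by simp_all
    then have "\<forall>\<^sub>F j in sequentially. m \<le> u z + v z + e"
    proof eventually_elim
      case (elim j)
      have "0 \<le> (M + 1 + real (r j)) * (norm (X (r j) - Y (r j)))\<^sup>2"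
        using M0 by simp
      then show ?case using uv_ge[of "r j"] elim by simp
    qed
    then show ?thesis by simp
  qed
  then have "m \<le> u z + v z"
    by (rule field_le_epsilon)
  then have z: "z \<in> \<Omega>"
    using m u(3)[of z] v(3)[of z] by force
  have F_le: "F (X n) - F (Y n) \<le> real k * ((- 2 * m) * ((2 * L + 1) powr (- 2 * s) / (2 * s)))"
    if "X n \<in> \<Omega>" "Y n \<in> \<Omega>" for n
  proof (rule doubled_maximum_estimate[where M = M and c = "M + 1 + real n" and u = u and v = v and \<Omega> = \<Omega>])
    show "u y \<le> 0" "v y \<le> 0" if "L < norm y" for y
      using L[of y] that u(3)[of y] v(3)[of y] by auto
    show "m \<le> u (X n) + v (Y n)"
    proof -
      have "0 \<le> (M + 1 + real n) * (norm (X n - Y n))\<^sup>2"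
        using M0 by simp
      then show ?thesis using uv_ge[of n] by linarith
    qed
    show "u x' + v y' - (M + 1 + real n) * (norm (x' - y'))\<^sup>2
        \<le> u (X n) + v (Y n) - (M + 1 + real n) * (norm (X n - Y n))\<^sup>2" for x' y'
      using \<Phi>_max[of n "(x', y')"] by (simp add: \<Phi>_eq X_def Y_def)
  qed (use s k u v M M0 XY that usc_on_borel_measurable in auto)
  have "\<forall>\<^sub>F j in sequentially. (X \<circ> r) j \<in> \<Omega>" "\<forall>\<^sub>F j in sequentially. (Y \<circ> r) j \<in> \<Omega>"
    using topological_tendstoD[OF Xz \<Omega>(1) z] topological_tendstoD[OF Yz \<Omega>(1) z] by auto
  then have "\<forall>\<^sub>F j in sequentially. F ((X \<circ> r) j) - F ((Y \<circ> r) j)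
      \<le> real k * ((- 2 * m) * ((2 * L + 1) powr (- 2 * s) / (2 * s)))"
    by eventually_elim (use F_le in auto)
  moreover have "isCont F z"
    using F \<Omega>(1) z by (simp add: continuous_on_eq_continuous_at)
  then have "(\<lambda>j. F ((X \<circ> r) j) - F ((Y \<circ> r) j)) \<longlonglongrightarrow> F z - F z"
    by (intro tendsto_diff isCont_tendsto_compose[OF _ Xz] isCont_tendsto_compose[OF _ Yz])
  ultimately have "F z - F z \<le> real k * ((- 2 * m) * ((2 * L + 1) powr (- 2 * s) / (2 * s)))"
    by (intro tendsto_upperbound) auto
  moreover have "0 \<le> L"
    using XY(1)[of 0] norm_ge_zero order_trans by blast
  then have "0 < real k * (2 * m * ((2 * L + 1) powr (- 2 * s) / (2 * s)))"
    using k m s by simp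
  ultimately show False by simp
qed

section \<open>Barrier\<close>

text \<open>The steps are rounded up to multiples of \<open>h\<close>, so that the integrand is measurable for an
  arbitrary function \<open>u\<close>.\<close>

definition step_op :: "real \<Rightarrow> real \<Rightarrow> ('a::euclidean_space \<Rightarrow> real) \<Rightarrow> 'a \<Rightarrow> 'a \<Rightarrow> real" where
  "step_op s h u x \<xi> =
     (\<integral>\<tau>. (if \<tau> < h then 0 else second_diff u x ((h * real_of_int \<lceil>\<tau> / h\<rceil>) *\<^sub>R \<xi>)) \<partial>levy_measure s)"

lemma borel_measurable_step:
  "(\<lambda>\<tau>. if \<tau> < h then 0 else second_diff u x ((h * real_of_int \<lceil>\<tau> / h\<rceil>) *\<^sub>R \<xi>))
    \<in> borel_measurable (borel :: real measure)"
proof -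
  have "(\<lambda>\<tau>. second_diff u x ((h * real_of_int \<lceil>\<tau> / h\<rceil>) *\<^sub>R \<xi>)) \<in> borel_measurable (borel :: real measure)"
    \<comment> \<open>The rounded step factors through the integers as a discrete space, from which
      every function is measurable.\<close>
    by (rule measurable_compose[where N = "count_space UNIV" and f = "\<lambda>\<tau>. \<lceil>\<tau> / h\<rceil>"]) measurable
  then show ?thesis by measurable
qed

lemma
  fixes u :: "'a::euclidean_space \<Rightarrow> real"
  assumes "0 < s" "s < 1" "0 < h" and u: "\<And>z. \<bar>u z\<bar> \<le> M"
  shows integrable_step_op: "integrable (levy_measure s)
      (\<lambda>\<tau>. if \<tau> < h then 0 else second_diff u x ((h * real_of_int \<lceil>\<tau> / h\<rceil>) *\<^sub>R \<xi>))"
    and bounded_step_op: "bounded (step_op s h u x ` S)"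
proof -
  have le: "\<bar>if \<tau> < h then 0 else second_diff u x ((h * real_of_int \<lceil>\<tau> / h\<rceil>) *\<^sub>R \<xi>)\<bar>
      \<le> (if \<tau> < h then 0 * \<tau>\<^sup>2 else 4 * M)" for \<tau> :: real and \<xi>
    using abs_second_diff_le[of u M, OF u] by simp
  show int: "integrable (levy_measure s)
      (\<lambda>\<tau>. if \<tau> < h then 0 else second_diff u x ((h * real_of_int \<lceil>\<tau> / h\<rceil>) *\<^sub>R \<xi>))" for \<xi>
    using assms(1-3) borel_measurable_step le by (rule integrable_levy_split)
  show "bounded (step_op s h u x ` S)"
    unfolding step_op_def using assms(1-3) int le by (rule bounded_integral_levy)
qed

lemma step_op_minus: "step_op s h (\<lambda>z. - u z) x \<xi> = - step_op s h u x \<xi>"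
proof -
  have "step_op s h (\<lambda>z. - u z) x \<xi> =
    (\<integral>\<tau>. - (if \<tau> < h then 0 else second_diff u x ((h * real_of_int \<lceil>\<tau> / h\<rceil>) *\<^sub>R \<xi>)) \<partial>levy_measure s)"
    unfolding step_op_def second_diff_minus by (intro Bochner_Integration.integral_cong) auto
  then show ?thesis
    by (simp add: step_op_def)
qed

lemma step_op_cmult: "step_op s h (\<lambda>z. a * u z) x \<xi> = a * step_op s h u x \<xi>"
proof -
  have "step_op s h (\<lambda>z. a * u z) x \<xi> =
    (\<integral>\<tau>. a * (if \<tau> < h then 0 else second_diff u x ((h * real_of_int \<lceil>\<tau> / h\<rceil>) *\<^sub>R \<xi>)) \<partial>levy_measure s)"
    unfolding step_op_def by (intro Bochner_Integration.integral_cong) (auto simp: second_diff_def algebra_simps)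
  then show ?thesis
    by (simp add: step_op_def)
qed

text \<open>Only the centre value enters with a negative sign, with coefficient -2, and the steps
  beyond \<open>h\<close> have mass \<open>h powr (- 2 * s) / (2 * s)\<close>. The bound has two
  uses: monotonicity of the scheme, and the passage to an infimum of barriers, where
  \<open>\<eta>\<close> is the defect of a near minimizer.\<close>

lemma step_op_le_shift:
  fixes u v :: "'a::euclidean_space \<Rightarrow> real"
  assumes s: "0 < s" "s < 1" and h: "0 < h"
    and M: "\<And>z. \<bar>u z\<bar> \<le> M" "\<And>z. \<bar>v z\<bar> \<le> M"
    and le: "\<And>z. u z \<le> v z" "v x \<le> u x + \<eta>"
  shows "step_op s h u x \<xi> \<le> step_op s h v x \<xi> + \<eta> * (h powr (- 2 * s) / s)"
proof -
  let ?g = "\<lambda>u \<tau>. if \<tau> < h then 0 else second_diff u x ((h * real_of_int \<lceil>\<tau> / h\<rceil>) *\<^sub>R \<xi>)"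
  have int: "integrable (levy_measure s) (?g u)" "integrable (levy_measure s) (?g v)"
    using integrable_step_op[OF s h] M by blast+
  have "step_op s h u x \<xi> - step_op s h v x \<xi> = (\<integral>\<tau>. ?g u \<tau> - ?g v \<tau> \<partial>levy_measure s)"
    unfolding step_op_def using int by (rule Bochner_Integration.integral_diff[symmetric])
  also have "\<dots> \<le> 0 * (h powr (2 - 2 * s) / (2 - 2 * s)) + (2 * \<eta>) * (h powr (- 2 * s) / (2 * s))"
  proof (rule integral_levy_split_bound[OF s h])
    show "?g u \<tau> - ?g v \<tau> \<le> (if \<tau> < h then 0 * \<tau>\<^sup>2 else 2 * \<eta>)" for \<tau>
      using le(1)[of "x + (h * real_of_int \<lceil>\<tau> / h\<rceil>) *\<^sub>R \<xi>"]
        le(1)[of "x - (h * real_of_int \<lceil>\<tau> / h\<rceil>) *\<^sub>R \<xi>"] le(2)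
      by (auto simp: second_diff_def)
  qed (use int in auto)
  finally show ?thesis by simp
qed

lemma ceiling_step_bounds:
  assumes "0 < h" "h \<le> \<tau>"
  shows "\<tau> \<le> h * real_of_int \<lceil>\<tau> / h\<rceil>" "h * real_of_int \<lceil>\<tau> / h\<rceil> < \<tau> + h"
proof -
  have "h * (\<tau> / h) \<le> h * real_of_int \<lceil>\<tau> / h\<rceil>" "h * real_of_int \<lceil>\<tau> / h\<rceil> < h * (\<tau> / h + 1)"
    using assms(1) by (intro mult_left_mono mult_strict_left_mono; linarith)+
  with assms(1) show "\<tau> \<le> h * real_of_int \<lceil>\<tau> / h\<rceil>" "h * real_of_int \<lceil>\<tau> / h\<rceil> < \<tau> + h"
    by (simp_all add: distrib_left)
qed

section \<open>Concavity estimates for powers with exponent between 0 and 1\<close>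

lemma powr_tangent_bound:
  assumes "0 < p" "0 < m" "0 < \<beta>" "\<beta> < (1::real)"
  shows "p powr \<beta> \<le> m powr \<beta> * (1 + \<beta> * (p / m - 1))"
proof -
  \<comment> \<open>The tangent line at \<open>m\<close> is the weighted mean inequality for
    \<open>p / m\<close> and 1 with weights \<open>\<beta>\<close> and
    \<open>1 - \<beta>\<close>.\<close>
  have "(p / m) powr \<beta> * 1 powr (1 - \<beta>) \<le> \<beta> * (p / m) + (1 - \<beta>) * 1"
    using assms by (intro Youngs_inequality_0) auto
  then have "p powr \<beta> \<le> m powr \<beta> * (\<beta> * (p / m) + (1 - \<beta>))"
    using assms by (simp add: powr_divide divide_le_eq mult.commute)
  then show ?thesis by (simp add: algebra_simps)
qed

text \<open>Subadditivity of the power: the fractions \<open>b / a\<close> and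
  \<open>(a - b) / a\<close> add up to 1, and each is at most its own power with exponent
  \<open>\<beta>\<close>.\<close>

lemma powr_diff_le:
  assumes "0 \<le> b" "b \<le> a" "0 < \<beta>" "\<beta> < (1::real)"
  shows "a powr \<beta> - b powr \<beta> \<le> (a - b) powr \<beta>"
proof (cases "a = 0")
  case False
  then have a: "0 < a" using assms by simp
  have le: "z \<le> z powr \<beta>" if "0 \<le> z" "z \<le> 1" for z :: real
    using powr_mono'[of \<beta> 1 z] that assms by (cases "z = 0") auto
  have "b / a + (a - b) / a \<le> (b / a) powr \<beta> + ((a - b) / a) powr \<beta>"
    using a assms by (intro add_mono le) (auto simp: field_simps)
  then have "1 \<le> (b powr \<beta> + (a - b) powr \<beta>) / a powr \<beta>"
    using a assms by (simp add: powr_divide add_divide_distrib[symmetric])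
  then show ?thesis
    using a by (simp add: field_simps)
qed (use assms in auto)

text \<open>As the exponent tends to 0, the barrier tends to the indicator function of the ball, whose
  second differences at large steps equal \<open>-2\<close>; hence a small exponent works.\<close>

lemma barrier_exponent:
  assumes "0 < (s::real)" "s < 1"
  obtains \<beta> where "0 < \<beta>" "\<beta> < s" "3 powr \<beta> \<le> 2" "3 powr \<beta> / (2 * s - \<beta>) < 1 / s"
proof -
  have "((\<lambda>\<beta>. 3 powr \<beta> / (2 * s - \<beta>)) \<longlongrightarrow> 3 powr 0 / (2 * s - 0)) (at_right 0)"
    using assms by (intro tendsto_intros) auto
  moreover have "3 powr 0 / (2 * s - 0) < 1 / s"
    using assms by (simp add: field_simps)
  ultimately have 1: "\<forall>\<^sub>F \<beta> in at_right 0. 3 powr \<beta> / (2 * s - \<beta>) < 1 / s"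
    by (rule order_tendstoD)
  have "((\<lambda>\<beta>::real. 3 powr \<beta> :: real) \<longlongrightarrow> 3 powr 0) (at_right 0)"
    by (intro tendsto_intros) auto
  then have 2: "\<forall>\<^sub>F \<beta> in at_right (0::real). 3 powr \<beta> < (2::real)"
    by (rule order_tendstoD) simp
  have 3: "\<forall>\<^sub>F \<beta> in at_right 0. \<beta> \<in> {0<..<s}"
    using assms(1) by (rule eventually_at_right_real)
  from eventually_happens'[OF _ eventually_conj[OF 1 eventually_conj[OF 2 3]]]
  show thesis using that by (auto simp: less_imp_le)
qed

text \<open>Here \<open>d\<close> is the positive root of \<open>m - 2 * a * t - t\<^sup>2\<close>,
  the distance along the line to the nearer exit from the ball. Before it both arguments are
  positive, so the tangent at \<open>m\<close> bounds both powers; the linear terms cancel and the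
  quadratic ones have the good sign.\<close>

lemma powr_second_diff_near:
  assumes "0 \<le> a" "0 < m" "0 < d" "d\<^sup>2 + 2 * a * d = m" "0 < t" "t < d" "0 < \<beta>" "\<beta> < (1::real)"
  shows "max 0 (m - 2 * a * t - t\<^sup>2) powr \<beta> + max 0 (m + 2 * a * t - t\<^sup>2) powr \<beta> - 2 * m powr \<beta> \<le> 0"
proof -
  have at: "a * t \<le> a * d" "0 \<le> a * t" using assms by (auto intro: mult_left_mono)
  have "t\<^sup>2 < d\<^sup>2" using assms by (intro power_strict_mono) auto
  then have q: "0 < m - 2 * a * t - t\<^sup>2" using at assms(4) by linarith
  then have p: "0 < m + 2 * a * t - t\<^sup>2" using at by linarith
  have "(m - 2 * a * t - t\<^sup>2) powr \<beta> + (m + 2 * a * t - t\<^sup>2) powr \<beta>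
      \<le> m powr \<beta> * (1 + \<beta> * ((m - 2 * a * t - t\<^sup>2) / m - 1)) + m powr \<beta> * (1 + \<beta> * ((m + 2 * a * t - t\<^sup>2) / m - 1))"
    using p q assms by (intro add_mono powr_tangent_bound)
  also have "\<dots> = m powr \<beta> * (2 - 2 * \<beta> * t\<^sup>2 / m)"
    using assms(2) by (simp add: field_simps)
  also have "\<dots> \<le> m powr \<beta> * 2"
    using assms by (intro mult_left_mono) auto
  finally show ?thesis using p q by simp
qed

text \<open>Past the nearer exit one of the two shifted values is 0. The other is controlled by
  \<open>m / d = d + 2 * a\<close>, which bounds the growth \<open>2 * a * t\<close> by
  \<open>m * (t / d)\<close> and leaves no dependence on \<open>a\<close>.\<close>

lemma powr_second_diff_far:
  assumes "0 \<le> a" "0 < m" "0 < d" "d\<^sup>2 + 2 * a * d = m" "d \<le> t" "0 < \<beta>" "\<beta> < (1::real)"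
  shows "max 0 (m - 2 * a * t - t\<^sup>2) powr \<beta> + max 0 (m + 2 * a * t - t\<^sup>2) powr \<beta> - 2 * m powr \<beta>
    \<le> m powr \<beta> * ((1 + t / d) powr \<beta> - 2)"
proof -
  have at: "a * d \<le> a * t" using assms by (intro mult_left_mono)
  have "d\<^sup>2 \<le> t\<^sup>2" using assms by (intro power_mono) auto
  then have q: "m - 2 * a * t - t\<^sup>2 \<le> 0" using at assms(4) by linarith
  have "m * (t / d) = (d + 2 * a) * t"
    using assms(3) by (simp add: assms(4)[symmetric] field_simps power2_eq_square)
  moreover have "0 \<le> d * t" using assms by simp
  moreover have "0 \<le> m * (t / d)" using assms by simp
  ultimately have "max 0 (m + 2 * a * t - t\<^sup>2) \<le> m * (1 + t / d)"
    using assms(2) zero_le_power2[of t] by (simp add: algebra_simps)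
  then have "max 0 (m + 2 * a * t - t\<^sup>2) powr \<beta> \<le> (m * (1 + t / d)) powr \<beta>"
    using assms by (intro powr_mono2) auto
  also have "\<dots> = m powr \<beta> * (1 + t / d) powr \<beta>"
    by (rule powr_mult)
  finally show ?thesis
    using q assms by (simp add: right_diff_distrib)
qed

section \<open>Barriers for a ball and for the domain\<close>

definition ball_barrier :: "real \<Rightarrow> real \<Rightarrow> 'a::euclidean_space \<Rightarrow> 'a \<Rightarrow> real" where
  "ball_barrier \<beta> R y x = max 0 (R\<^sup>2 - (norm (x - y))\<^sup>2) powr \<beta>"

text \<open>Steps shorter than the exit distance \<open>d\<close> contribute nothing positive. For
  longer ones rounding gives \<open>t < \<tau> + h \<le> 2 * \<tau>\<close>, hence
  \<open>1 + t / d \<le> 3 * \<tau> / d\<close>; this is the origin of the 3 in the conditions on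
  \<open>\<beta>\<close>. Integration leaves \<open>m powr \<beta> * d powr (- 2 * s)\<close> times
  a negative constant. From \<open>d\<^sup>2 \<le> m\<close>, \<open>d \<le> R\<close> and
  \<open>\<beta> < s\<close> this factor is at least \<open>R powr (2 * \<beta> - 2 * s)\<close>, so
  the bound depends neither on the point nor on \<open>h\<close>.\<close>

lemma step_op_ball_barrier:
  fixes x y :: "'a::euclidean_space"
  assumes s: "0 < s" "s < 1" and \<beta>: "0 < \<beta>" "\<beta> < s" "3 powr \<beta> \<le> 2" "3 powr \<beta> / (2 * s - \<beta>) < 1 / s"
    and h: "0 < h" "ball x h \<subseteq> ball y R" and \<xi>: "norm \<xi> = 1"
  shows "step_op s h (ball_barrier \<beta> R y) x \<xi> \<le> R powr (2 * \<beta> - 2 * s) * (3 powr \<beta> / (2 * s - \<beta>) - 1 / s)"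
proof -
  define m where "m = R\<^sup>2 - (norm (x - y))\<^sup>2"
  define b where "b = (x - y) \<bullet> \<xi>"
  have "x \<in> ball y R" using h centre_in_ball[of x h] by blast
  then have R: "norm (x - y) < R" "0 < R"
    using norm_ge_zero[of "x - y"] unfolding mem_ball dist_norm norm_minus_commute[of y] by linarith+
  then have m: "0 < m" "m \<le> R\<^sup>2" unfolding m_def by (auto intro: power_strict_mono)
  define d where "d = sqrt (b\<^sup>2 + m) - \<bar>b\<bar>"
  have "sqrt (b\<^sup>2) < sqrt (b\<^sup>2 + m)" using m by (intro real_sqrt_less_mono) auto
  then have d0: "0 < d" by (simp add: d_def)
  have "(d + \<bar>b\<bar>)\<^sup>2 = b\<^sup>2 + m" using m by (simp add: d_def)
  then have d: "d\<^sup>2 + 2 * \<bar>b\<bar> * d = m" by (simp add: power2_sum mult_ac)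
  have line: "R\<^sup>2 - (norm (x + t *\<^sub>R \<xi> - y))\<^sup>2 = m - 2 * b * t - t\<^sup>2"
    "R\<^sup>2 - (norm (x - t *\<^sub>R \<xi> - y))\<^sup>2 = m + 2 * b * t - t\<^sup>2" for t
  proof -
    have "\<xi> \<bullet> \<xi> = 1" using \<xi> by (simp add: norm_eq_1)
    then show "R\<^sup>2 - (norm (x + t *\<^sub>R \<xi> - y))\<^sup>2 = m - 2 * b * t - t\<^sup>2"
      "R\<^sup>2 - (norm (x - t *\<^sub>R \<xi> - y))\<^sup>2 = m + 2 * b * t - t\<^sup>2"
      unfolding m_def b_def power2_norm_eq_inner
      by (auto simp: algebra_simps inner_diff inner_add inner_commute power2_eq_square)
  qed
  \<comment> \<open>One of the points at distance \<open>d\<close> from \<open>x\<close> in the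
    directions \<open>\<xi>\<close> and \<open>- \<xi>\<close> lies on the sphere of radius
    \<open>R\<close> around \<open>y\<close>; the open ball of radius \<open>h\<close> around
    \<open>x\<close> cannot contain it.\<close>
  have hd: "h \<le> d"
  proof (rule ccontr)
    assume "\<not> h \<le> d"
    then have "x + d *\<^sub>R \<xi> \<in> ball y R" "x - d *\<^sub>R \<xi> \<in> ball y R"
      using h d0 \<xi> by (auto simp: subset_iff dist_norm)
    then have "norm (x + d *\<^sub>R \<xi> - y) < R" "norm (x - d *\<^sub>R \<xi> - y) < R"
      by (auto simp: dist_norm norm_minus_commute)
    then have "(norm (x + d *\<^sub>R \<xi> - y))\<^sup>2 < R\<^sup>2" "(norm (x - d *\<^sub>R \<xi> - y))\<^sup>2 < R\<^sup>2"
      by (auto intro!: power_strict_mono)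
    then have "0 < m - 2 * b * d - d\<^sup>2" "0 < m + 2 * b * d - d\<^sup>2"
      using line[of d] by auto
    with d show False by (cases "0 \<le> b") auto
  qed
  have sd: "second_diff (ball_barrier \<beta> R y) x (t *\<^sub>R \<xi>) =
      max 0 (m - 2 * \<bar>b\<bar> * t - t\<^sup>2) powr \<beta> + max 0 (m + 2 * \<bar>b\<bar> * t - t\<^sup>2) powr \<beta> - 2 * m powr \<beta>" for t
    using m unfolding second_diff_def ball_barrier_def line m_def[symmetric] by (cases "0 \<le> b") auto
  let ?g = "\<lambda>\<tau>. if \<tau> < h then 0 else second_diff (ball_barrier \<beta> R y) x ((h * real_of_int \<lceil>\<tau> / h\<rceil>) *\<^sub>R \<xi>)"
  let ?G = "\<lambda>\<tau>. m powr \<beta> * (3 / d) powr \<beta> * (if \<tau> < d then 0 else \<tau> powr \<beta>) +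
      - (2 * m powr \<beta>) * (if \<tau> < d then 0 else \<tau> powr 0)"
  have bb: "\<bar>ball_barrier \<beta> R y z\<bar> \<le> (R\<^sup>2) powr \<beta>" for z
    unfolding ball_barrier_def using \<beta> R by (auto intro!: powr_mono2)
  have G: "has_bochner_integral (levy_measure s) ?G
      (m powr \<beta> * (3 / d) powr \<beta> * (d powr (\<beta> - 2 * s) / (2 * s - \<beta>)) +
      - (2 * m powr \<beta>) * (d powr (0 - 2 * s) / (2 * s - 0)))"
    using d0 s \<beta>
    by (intro has_bochner_integral_add has_bochner_integral_mult_right has_integral_levy_above_powr) auto
  have "step_op s h (ball_barrier \<beta> R y) x \<xi> \<le> integral\<^sup>L (levy_measure s) ?G"
    unfolding step_op_def
  proof (rule integral_levy_mono)
    show "integrable (levy_measure s) ?g"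
      using integrable_step_op[OF s h(1) bb] .
    show "integrable (levy_measure s) ?G"
      using G by (rule integrable.intros)
    fix \<tau> :: real assume \<tau>: "0 < \<tau>"
    define t where "t = h * real_of_int \<lceil>\<tau> / h\<rceil>"
    have g: "?g \<tau> = (if \<tau> < h then 0 else second_diff (ball_barrier \<beta> R y) x (t *\<^sub>R \<xi>))"
      by (simp add: t_def)
    have t: "\<tau> \<le> t" "t < \<tau> + h" if "h \<le> \<tau>"
      using ceiling_step_bounds[OF h(1) that] by (auto simp: t_def)
    have far: "second_diff (ball_barrier \<beta> R y) x (t *\<^sub>R \<xi>) \<le> m powr \<beta> * ((1 + t / d) powr \<beta> - 2)" if "d \<le> t"
      unfolding sd using powr_second_diff_far[OF _ m(1) d0 d that \<beta>(1)] \<beta> s by auto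
    \<comment> \<open>The third case arises from rounding: \<open>\<tau>\<close> is still inside but
      \<open>t\<close> is past the exit. There \<open>t < 2 * d\<close>, and
      \<open>3 powr \<beta> \<le> 2\<close> keeps the second difference nonpositive.\<close>
    consider "\<tau> < h" | "h \<le> \<tau>" "\<tau> < d" "t < d" | "h \<le> \<tau>" "\<tau> < d" "d \<le> t" | "d \<le> \<tau>"
      using hd by linarith
    then show "?g \<tau> \<le> ?G \<tau>"
    proof cases
      case 1
      then show ?thesis using hd by simp
    next
      case 2
      have "second_diff (ball_barrier \<beta> R y) x (t *\<^sub>R \<xi>) \<le> 0"
        unfolding sd using powr_second_diff_near[OF _ m(1) d0 d _ 2(3) \<beta>(1)] \<beta> s t[OF 2(1)] \<tau> by auto
      with 2 g show ?thesis by simp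
    next
      case 3
      have "1 + t / d \<le> 3"
        using t[OF 3(1)] 3 hd d0 by (simp add: field_simps)
      then have "(1 + t / d) powr \<beta> \<le> 3 powr \<beta>"
        using 3 d0 \<beta> by (intro powr_mono2) auto
      then have "m powr \<beta> * ((1 + t / d) powr \<beta> - 2) \<le> 0"
        using \<beta>(3) by (intro mult_nonneg_nonpos) auto
      with far[OF 3(3)] 3 g show ?thesis by simp
    next
      case 4
      have "h \<le> \<tau>" using 4 hd by linarith
      then have dt: "d \<le> t" "d + t \<le> 3 * \<tau>"
        using t 4 hd by linarith+
      have "1 + t / d \<le> 3 / d * \<tau>"
        using divide_right_mono[OF dt(2), of d] d0 by (simp add: add_divide_distrib)
      then have "(1 + t / d) powr \<beta> \<le> (3 / d * \<tau>) powr \<beta>"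
        using d0 dt(1) \<beta> by (intro powr_mono2) auto
      then have "m powr \<beta> * ((1 + t / d) powr \<beta> - 2) \<le> m powr \<beta> * ((3 / d * \<tau>) powr \<beta> - 2)"
        by (intro mult_left_mono) auto
      moreover have "(3 / d * \<tau>) powr \<beta> = (3 / d) powr \<beta> * \<tau> powr \<beta>"
        by (rule powr_mult)
      ultimately show ?thesis
        using far[OF dt(1)] 4 g \<open>h \<le> \<tau>\<close> \<tau> by (simp add: algebra_simps)
    qed
  qed
  also have "\<dots> = m powr \<beta> * d powr (- 2 * s) * (3 powr \<beta> / (2 * s - \<beta>) - 1 / s)"
  proof -
    have "(3 / d) powr \<beta> * d powr (\<beta> - 2 * s) = 3 powr \<beta> * d powr (- 2 * s)"
    proof -
      have "d powr (\<beta> - 2 * s) = d powr \<beta> * d powr (- 2 * s)"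
        by (simp only: powr_add[symmetric]) simp
      then show ?thesis using d0 by (simp add: powr_divide)
    qed
    then have "m powr \<beta> * (3 / d) powr \<beta> * (d powr (\<beta> - 2 * s) / (2 * s - \<beta>)) =
        m powr \<beta> * (3 powr \<beta> * d powr (- 2 * s)) / (2 * s - \<beta>)"
      by (metis mult.assoc times_divide_eq_right)
    then show ?thesis
      using G s by (simp add: has_bochner_integral_iff algebra_simps)
  qed
  also have "\<dots> \<le> R powr (2 * \<beta> - 2 * s) * (3 powr \<beta> / (2 * s - \<beta>) - 1 / s)"
  proof (rule mult_right_mono_neg)
    have "0 \<le> \<bar>b\<bar> * d" using d0 by simp
    then have dm: "d\<^sup>2 \<le> m" using d by linarith
    then have "d\<^sup>2 \<le> R\<^sup>2" using m by linarith
    then have "d \<le> R" by (rule power2_le_imp_le) (use R in simp)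
    then have "R powr (2 * \<beta> - 2 * s) \<le> d powr (2 * \<beta> - 2 * s)"
      using d0 \<beta> by (intro powr_mono2') auto
    also have "\<dots> = (d\<^sup>2) powr \<beta> * d powr (- 2 * s)"
    proof -
      have "(d\<^sup>2) powr \<beta> = d powr (2 * \<beta>)"
        using d0 powr_powr[of d 2 \<beta>] by simp
      then show ?thesis by (simp add: powr_add[symmetric])
    qed
    also have "\<dots> \<le> m powr \<beta> * d powr (- 2 * s)"
      using dm \<beta> by (intro mult_right_mono powr_mono2) auto
    finally show "R powr (2 * \<beta> - 2 * s) \<le> m powr \<beta> * d powr (- 2 * s)" .
  qed (use \<beta> in auto)
  finally show ?thesis .
qed

text \<open>Clipping the distance to \<open>y\<close> at \<open>R\<close> shows that the base of the
  power is Lipschitz with constant \<open>2 * R\<close>. The resulting Hoelder modulus is the same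
  for all centres, so an infimum over centres inherits it.\<close>

lemma ball_barrier_diff:
  fixes x x' y :: "'a::euclidean_space"
  assumes "0 < \<beta>" "\<beta> < 1" "0 < R"
  shows "ball_barrier \<beta> R y x - ball_barrier \<beta> R y x' \<le> (2 * R * norm (x - x')) powr \<beta>"
proof -
  define g where "g z = max 0 (R\<^sup>2 - (norm (z - y))\<^sup>2)" for z
  have g: "g z = R\<^sup>2 - (min R (norm (z - y)))\<^sup>2" for z
  proof (cases "norm (z - y) \<le> R")
    case True
    then have "(norm (z - y))\<^sup>2 \<le> R\<^sup>2" by (intro power_mono) auto
    with True show ?thesis by (simp add: g_def)
  next
    case False
    then have "R\<^sup>2 \<le> (norm (z - y))\<^sup>2" using assms by (intro power_mono) auto
    with False show ?thesis by (simp add: g_def)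
  qed
  have "g x - g x' = (min R (norm (x' - y)) - min R (norm (x - y))) * (min R (norm (x' - y)) + min R (norm (x - y)))"
    unfolding g by (simp add: algebra_simps power2_eq_square)
  also have "\<dots> \<le> norm (x - x') * (2 * R)"
  proof (rule mult_mono)
    have "norm (x' - y) - norm (x - y) \<le> norm (x - x')"
      using norm_triangle_ineq2[of "x' - y" "x - y"] by (simp add: norm_minus_commute)
    then show "min R (norm (x' - y)) - min R (norm (x - y)) \<le> norm (x - x')"
      using norm_ge_zero[of "x - x'"] by linarith
  qed (use assms in auto)
  finally have le: "g x - g x' \<le> 2 * R * norm (x - x')"
    by (simp add: mult.commute)
  have g0: "0 \<le> g z" for z
    by (simp add: g_def)
  show ?thesis
  proof (cases "g x' \<le> g x")
    case True
    have "g x powr \<beta> - g x' powr \<beta> \<le> (g x - g x') powr \<beta>"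
      using True assms by (intro powr_diff_le) (auto simp: g_def)
    also have "\<dots> \<le> (2 * R * norm (x - x')) powr \<beta>"
      using le True assms by (intro powr_mono2) auto
    finally show ?thesis by (simp add: ball_barrier_def g_def)
  next
    case False
    then have "g x powr \<beta> \<le> g x' powr \<beta>"
      using assms g0 by (intro powr_mono2) auto
    then show ?thesis
      using powr_ge_zero[of "2 * R * norm (x - x')" \<beta>] unfolding ball_barrier_def g_def by linarith
  qed
qed

text \<open>At a given point the infimum is compared with the barrier of a ball that attains it up
  to \<open>\<eta>\<close> there and dominates it everywhere. The price is
  \<open>\<eta> * (h powr (- 2 * s) / s)\<close>, which vanishes with \<open>\<eta>\<close> at fixed
  \<open>h\<close>, and the ball estimate has the same constant for all centres. Continuity comes
  from the common Hoelder modulus.\<close>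

lemma uniformly_convex_barrier:
  fixes \<Omega> :: "'a::euclidean_space set"
  assumes s: "0 < s" "s < 1" and "uniformly_convex_domain \<Omega>"
  obtains W c where "continuous_on UNIV W" "bounded (range W)" "\<And>x. 0 \<le> W x" "\<And>x. x \<notin> \<Omega> \<Longrightarrow> W x = 0" "0 < c"
    "\<And>x h \<xi>. 0 < h \<Longrightarrow> ball x h \<subseteq> \<Omega> \<Longrightarrow> norm \<xi> = 1 \<Longrightarrow> step_op s h W x \<xi> \<le> - c"
proof -
  obtain R Y where R: "0 < R" and \<Omega>: "\<Omega> = (\<Inter>y\<in>Y. ball y R)" and bdd: "bounded \<Omega>"
    using assms(3) by (auto simp: uniformly_convex_domain_def)
  have Y: "Y \<noteq> {}"
    using bdd \<Omega> not_bounded_UNIV[where 'a = 'a] by auto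
  obtain \<beta> where \<beta>: "0 < \<beta>" "\<beta> < s" "3 powr \<beta> \<le> 2" "3 powr \<beta> / (2 * s - \<beta>) < 1 / s"
    using barrier_exponent[OF s] by blast
  define c where "c = R powr (2 * \<beta> - 2 * s) * (1 / s - 3 powr \<beta> / (2 * s - \<beta>))"
  define W where "W x = (INF y\<in>Y. ball_barrier \<beta> R y x)" for x
  have bb: "0 \<le> ball_barrier \<beta> R y x" "ball_barrier \<beta> R y x \<le> (R\<^sup>2) powr \<beta>" for x y :: 'a
    unfolding ball_barrier_def using \<beta> R by (auto intro!: powr_mono2)
  have bdd_below: "bdd_below ((\<lambda>y. ball_barrier \<beta> R y x) ` Y)" for x
    using bb by (auto simp: bdd_below_def)
  have W_le: "W x \<le> ball_barrier \<beta> R y x" if "y \<in> Y" for x y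
    unfolding W_def using bdd_below that by (rule cINF_lower)
  have W0: "0 \<le> W x" for x
    unfolding W_def using Y bb by (intro cINF_greatest) auto
  have Wb: "W x \<le> (R\<^sup>2) powr \<beta>" for x
    using Y W_le bb(2) order_trans by blast
  have diff: "W x - W x' \<le> (2 * R * norm (x - x')) powr \<beta>" for x x'
  proof -
    have "W x - (2 * R * norm (x - x')) powr \<beta> \<le> W x'"
      unfolding W_def[of x']
    proof (rule cINF_greatest[OF Y])
      fix y assume "y \<in> Y"
      show "W x - (2 * R * norm (x - x')) powr \<beta> \<le> ball_barrier \<beta> R y x'"
        using W_le[OF \<open>y \<in> Y\<close>, of x] ball_barrier_diff[of \<beta> R y x x'] \<beta> R s by linarith
    qed
    then show ?thesis by simp
  qed
  have "isCont W x" for x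
  proof -
    have "((\<lambda>x'. (2 * R * norm (x' - x)) powr \<beta>) \<longlongrightarrow> 0) (at x)"
      using R \<beta> by (intro tendsto_zero_powrI[where b = \<beta>] tendsto_eq_intros) auto
    moreover have "\<bar>W x' - W x\<bar> \<le> (2 * R * norm (x' - x)) powr \<beta>" for x'
      using diff[of x x'] diff[of x' x] by (auto simp: norm_minus_commute)
    ultimately have "((\<lambda>x'. W x' - W x) \<longlongrightarrow> 0) (at x)"
      by (intro Lim_null_comparison[of "\<lambda>x'. W x' - W x"]) auto
    then show ?thesis
      by (simp add: isCont_def LIM_zero_iff)
  qed
  moreover have "bounded (range W)"
    using W0 Wb by (auto simp: bounded_iff intro!: exI[of _ "(R\<^sup>2) powr \<beta>"])
  moreover have "W x = 0" if x: "x \<notin> \<Omega>" for x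
  proof -
    obtain y where "y \<in> Y" "x \<notin> ball y R"
      using x \<Omega> by blast
    then have y: "y \<in> Y" "R \<le> norm (x - y)"
      by (auto simp: dist_norm norm_minus_commute)
    then have "R\<^sup>2 \<le> (norm (x - y))\<^sup>2"
      using R by (intro power_mono) auto
    then show ?thesis
      using W_le[OF y(1), of x] W0[of x] by (simp add: ball_barrier_def)
  qed
  moreover have "0 < c"
    using R \<beta> by (simp add: c_def)
  moreover have "step_op s h W x \<xi> \<le> - c" if h: "0 < h" "ball x h \<subseteq> \<Omega>" and \<xi>: "norm \<xi> = 1" for x h \<xi>
  proof -
    have "step_op s h W x \<xi> \<le> - c + \<eta> * (h powr (- 2 * s) / s)" if \<eta>: "0 < \<eta>" for \<eta>
    proof -
      obtain y where y: "y \<in> Y" "ball_barrier \<beta> R y x < W x + \<eta>"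
        using \<eta> cInf_lessD[of "(\<lambda>y. ball_barrier \<beta> R y x) ` Y" "W x + \<eta>"] Y by (auto simp: W_def)
      have "step_op s h W x \<xi> \<le> step_op s h (ball_barrier \<beta> R y) x \<xi> + \<eta> * (h powr (- 2 * s) / s)"
        using W0 Wb bb W_le[OF y(1)] y(2)
        by (intro step_op_le_shift[OF s h(1), where M = "(R\<^sup>2) powr \<beta>"]) (auto simp: less_imp_le)
      also have "step_op s h (ball_barrier \<beta> R y) x \<xi> \<le> - c"
      proof -
        have "ball x h \<subseteq> ball y R" using h(2) \<Omega> y(1) by blast
        from step_op_ball_barrier[OF s \<beta> h(1) this \<xi>] show ?thesis
          by (simp add: c_def algebra_simps)
      qed
      finally show ?thesis by simp
    qed
    note * = this
    show ?thesis
    proof (rule field_le_epsilon)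
      fix e :: real assume "0 < e"
      then show "step_op s h W x \<xi> \<le> - c + e"
        using *[of "e / (h powr (- 2 * s) / s)"] h(1) s by simp
    qed
  qed
  ultimately show thesis
    using that[of W c] W0 by (simp add: continuous_on_eq_continuous_at)
qed

section \<open>Solutions of the scheme and half-relaxed limits\<close>

text \<open>Real-valued functions are only conditionally complete, so the supremum is restricted to
  the functions between \<open>lo\<close> and \<open>hi\<close> that lie below their image. The map
  need be monotone only in that range.\<close>

lemma monotone_fixpoint_between:
  fixes T :: "('a \<Rightarrow> real) \<Rightarrow> 'a \<Rightarrow> real"
  assumes lohi: "lo \<le> hi" and lo: "lo \<le> T lo" and hi: "T hi \<le> hi"
    and mono: "\<And>u v. lo \<le> u \<Longrightarrow> u \<le> v \<Longrightarrow> v \<le> hi \<Longrightarrow> T u \<le> T v"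
  obtains u where "lo \<le> u" "u \<le> hi" "T u = u"
proof -
  define S where "S = {w. lo \<le> w \<and> w \<le> hi \<and> w \<le> T w}"
  define u where "u x = (SUP w\<in>S. w x)" for x
  have loS: "lo \<in> S" using lohi lo by (simp add: S_def)
  have bdd: "bdd_above ((\<lambda>w. w x) ` S)" for x
    by (auto simp: bdd_above_def S_def le_fun_def)
  have upper: "w \<le> u" if "w \<in> S" for w
    unfolding le_fun_def u_def using bdd that by (auto intro: cSUP_upper)
  have least: "u \<le> g" if "\<And>w. w \<in> S \<Longrightarrow> w \<le> g" for g
    unfolding le_fun_def u_def using loS that by (auto intro!: cSUP_least simp: le_fun_def)
  have u: "lo \<le> u" "u \<le> hi"
    using upper[OF loS] least[of hi] by (auto simp: S_def)
  have 1: "u \<le> T u"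
  proof (rule least)
    fix w assume w: "w \<in> S"
    then have "w \<le> T w" by (simp add: S_def)
    also have "T w \<le> T u" using mono[OF _ upper[OF w] u(2)] w by (simp add: S_def)
    finally show "w \<le> T u" .
  qed
  have "T u \<in> S"
    using u 1 order_trans[OF lo mono[OF order_refl u]] order_trans[OF mono[OF u order_refl] hi]
      mono[OF u(1) 1 order_trans[OF mono[OF u order_refl] hi]] by (simp add: S_def)
  then have "T u = u"
    using upper 1 by (intro antisym) auto
  with u that show thesis by blast
qed

lemma step_scheme_solvable:
  fixes W :: "'a::euclidean_space \<Rightarrow> real"
  assumes s: "0 < s" "s < 1" and k: "1 \<le> k" "k \<le> DIM('a)" and h: "0 < h"
    and W: "bounded (range W)" "\<And>x. 0 \<le> W x"
    and barrier: "\<And>x \<xi>. ball x h \<subseteq> \<Omega> \<Longrightarrow> norm \<xi> = 1 \<Longrightarrow> step_op s h W x \<xi> \<le> - c"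
    and F: "\<And>x. x \<in> \<Omega> \<Longrightarrow> \<bar>F x\<bar> \<le> real k * c"
  obtains u where "\<And>x. \<bar>u x\<bar> \<le> W x"
    "\<And>x. ball x h \<subseteq> \<Omega> \<Longrightarrow> extremum upper k (step_op s h u x) = F x"
proof -
  \<comment> \<open>In each of the \<open>k\<close> directions the centre value enters the operator
    with total weight \<open>- (h powr (- 2 * s) / s)\<close>. This relaxation factor makes the loss
    at most cancel the term \<open>w x\<close> in \<open>T\<close>, so that \<open>T\<close> is
    monotone.\<close>
  define \<theta> where "\<theta> = 1 / (real k * (h powr (- 2 * s) / s))"
  have \<theta>: "0 < \<theta>" "\<theta> * (real k * (h powr (- 2 * s) / s)) = 1"
    using k h s by (auto simp: \<theta>_def)
  \<comment> \<open>Where the ball is not inside \<open>\<Omega>\<close> no equation is imposed, and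
    only the bounds \<open>- W\<close> and \<open>W\<close> restrict the fixed point. Each point of
    \<open>\<Omega>\<close> receives its equation once \<open>h\<close> is small, and outside
    \<open>\<Omega>\<close> the barrier pins the value to 0 whenever \<open>W\<close> vanishes
    there.\<close>
  define T where "T w x = (if ball x h \<subseteq> \<Omega> then w x + \<theta> * (extremum upper k (step_op s h w x) - F x) else w x)"
    for w x
  obtain M where M: "\<And>x. W x \<le> M"
    using W by (auto simp: bounded_iff abs_le_iff)
  have bd: "\<bar>w x\<bar> \<le> M" if "(\<lambda>x. - W x) \<le> w" "w \<le> W" for w x
    using le_funD[OF that(1), of x] le_funD[OF that(2), of x] M[of x] by linarith
  have bdd: "bounded (step_op s h w x ` sphere 0 1)" if "(\<lambda>x. - W x) \<le> w" "w \<le> W" for w x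
    using bounded_step_op[OF s h] bd[OF that] by blast
  have W': "(\<lambda>x. - W x) \<le> W"
    using W(2) by (auto simp: le_fun_def intro: order_trans[of _ 0])
  have zero: "bounded ((\<lambda>_. 0 :: real) ` sphere (0 :: 'a) 1)" by (auto simp: bounded_iff)
  have le_F: "extremum upper k (step_op s h W x) \<le> F x" "F x \<le> extremum upper k (step_op s h (\<lambda>x. - W x) x)"
    if x: "ball x h \<subseteq> \<Omega>" for x
  proof -
    have "x \<in> \<Omega>" using x centre_in_ball[of x h] h by blast
    note Fx = F[OF this]
    have "extremum upper k (step_op s h W x) \<le> extremum upper k (\<lambda>_ :: 'a. 0) + real k * (- c)"
      using barrier[OF x] by (intro extremum_mono[OF k(2) bdd[OF W' order_refl] zero]) auto
    then show "extremum upper k (step_op s h W x) \<le> F x"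
      using Fx by (simp add: extremum_const[OF k(2)] abs_le_iff)
    have "extremum upper k (\<lambda>_ :: 'a. 0) \<le> extremum upper k (step_op s h (\<lambda>x. - W x) x) + real k * (- c)"
    proof (rule extremum_mono[OF k(2) zero bdd[OF order_refl W']])
      show "0 \<le> step_op s h (\<lambda>x. - W x) x \<xi> + - c" if "norm \<xi> = 1" for \<xi>
        using barrier[OF x that] by (simp add: step_op_minus)
    qed
    then show "F x \<le> extremum upper k (step_op s h (\<lambda>x. - W x) x)"
      using Fx by (simp add: extremum_const[OF k(2)] abs_le_iff)
  qed
  obtain u where u: "(\<lambda>x. - W x) \<le> u" "u \<le> W" "T u = u"
  proof (rule monotone_fixpoint_between[of "\<lambda>x. - W x" W T])
    show "(\<lambda>x. - W x) \<le> T (\<lambda>x. - W x)"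
      using le_F(2) \<theta>(1) by (auto simp: T_def le_fun_def)
    show "T W \<le> W"
      using le_F(1) \<theta>(1) by (auto simp: T_def le_fun_def mult_le_0_iff)
    show "T u \<le> T v" if uv: "(\<lambda>x. - W x) \<le> u" "u \<le> v" "v \<le> W" for u v
    proof (rule le_funI)
      fix x
      have r: "(\<lambda>x. - W x) \<le> v" "u \<le> W" using uv by (auto intro: order_trans)
      show "T u x \<le> T v x"
      proof (cases "ball x h \<subseteq> \<Omega>")
        case True
        have "extremum upper k (step_op s h u x) \<le> extremum upper k (step_op s h v x)
            + real k * ((v x - u x) * (h powr (- 2 * s) / s))"
          using uv(2) bd[OF uv(1) r(2)] bd[OF r(1) uv(3)]
          by (intro extremum_mono[OF k(2) bdd[OF uv(1) r(2)] bdd[OF r(1) uv(3)]]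
              step_op_le_shift[OF s h, where M = M]) (auto simp: le_fun_def)
        then have "\<theta> * extremum upper k (step_op s h u x) \<le> \<theta> * (extremum upper k (step_op s h v x)
            + real k * ((v x - u x) * (h powr (- 2 * s) / s)))"
          using \<theta>(1) by (intro mult_left_mono) auto
        also have "\<dots> = \<theta> * extremum upper k (step_op s h v x) + (\<theta> * (real k * (h powr (- 2 * s) / s))) * (v x - u x)"
          by (simp add: algebra_simps)
        finally show ?thesis
          using True unfolding \<theta>(2) by (simp add: T_def algebra_simps)
      next
        case False
        then show ?thesis using uv(2) by (auto simp: T_def le_fun_def)
      qed
    qed
  qed (use W' in auto)
  show thesis
  proof (rule that)
    show "\<bar>u x\<bar> \<le> W x" for x
      using le_funD[OF u(1), of x] le_funD[OF u(2), of x] by linarith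
    show "extremum upper k (step_op s h u x) = F x" if "ball x h \<subseteq> \<Omega>" for x
      using fun_cong[OF u(3), of x] \<theta>(1) that by (simp add: T_def)
  qed
qed

text \<open>The half-relaxed upper limit, that is, the upper limit over indices tending to infinity
  and points tending to \<open>x\<close> at the same time, written as the infimum of the bounds that
  hold eventually and locally.\<close>

definition upper_limit :: "(nat \<Rightarrow> 'a::euclidean_space \<Rightarrow> real) \<Rightarrow> 'a \<Rightarrow> real" where
  "upper_limit u x = Inf {c. \<exists>N. \<exists>d>0. \<forall>n\<ge>N. \<forall>y\<in>ball x d. u n y \<le> c}"

context
  fixes u :: "nat \<Rightarrow> 'a::euclidean_space \<Rightarrow> real" and M :: real
  assumes M: "\<And>n y. \<bar>u n y\<bar> \<le> M"
begin

lemma upper_limit_le: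
  assumes "0 < d" "\<And>n y. N \<le> n \<Longrightarrow> y \<in> ball x d \<Longrightarrow> u n y \<le> c"
  shows "upper_limit u x \<le> c"
  unfolding upper_limit_def
proof (rule cInf_lower)
  show "c \<in> {c. \<exists>N. \<exists>d>0. \<forall>n\<ge>N. \<forall>y\<in>ball x d. u n y \<le> c}"
    using assms by blast
  have "- M \<le> c" if "\<forall>n\<ge>N. \<forall>y\<in>ball x d. u n y \<le> c" "0 < d" for N d c
    using that(1)[rule_format, of N x] that(2) M[of N x] by auto
  then show "bdd_below {c. \<exists>N. \<exists>d>0. \<forall>n\<ge>N. \<forall>y\<in>ball x d. u n y \<le> c}"
    unfolding bdd_below_def by blast
qed

lemma upper_limit_lessD:
  assumes "upper_limit u x < c"
  obtains N d c' where "0 < d" "c' < c" "\<And>n y. N \<le> n \<Longrightarrow> y \<in> ball x d \<Longrightarrow> u n y \<le> c'"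
proof -
  have "M \<in> {c. \<exists>N. \<exists>d>0. \<forall>n\<ge>N. \<forall>y\<in>ball x d. u n y \<le> c}"
    using M by (auto simp: abs_le_iff intro!: exI[of _ 1])
  then obtain c' where "c' \<in> {c. \<exists>N. \<exists>d>0. \<forall>n\<ge>N. \<forall>y\<in>ball x d. u n y \<le> c}" "c' < c"
    using cInf_lessD[OF _ assms[unfolded upper_limit_def]] by blast
  then show thesis using that by blast
qed

lemma usc_on_upper_limit: "usc_on UNIV (upper_limit u)"
proof -
  have "open {x. upper_limit u x < c}" for c
  proof (subst open_contains_ball, safe)
    fix x assume "upper_limit u x < c"
    then obtain N d c' where d: "0 < d" "c' < c" "\<And>n y. N \<le> n \<Longrightarrow> y \<in> ball x d \<Longrightarrow> u n y \<le> c'"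
      by (rule upper_limit_lessD) blast
    have "upper_limit u z < c" if "z \<in> ball x d" for z
    proof -
      have "ball z (d - dist x z) \<subseteq> ball x d"
      proof
        fix y assume "y \<in> ball z (d - dist x z)"
        then show "y \<in> ball x d" using dist_triangle[of x y z] by simp
      qed
      then have "upper_limit u z \<le> c'"
        using that by (intro upper_limit_le[of "d - dist x z" N]) (auto intro!: d(3))
      with d(2) show ?thesis by simp
    qed
    with d(1) show "\<exists>e>0. ball x e \<subseteq> {x. upper_limit u x < c}" by blast
  qed
  then show ?thesis by (simp add: usc_on_def)
qed

lemma abs_upper_limit_le: "\<bar>upper_limit u x\<bar> \<le> M"
proof -
  have "upper_limit u x \<le> M"
    using M by (intro upper_limit_le[of 1 0]) (auto simp: abs_le_iff)
  moreover have "- M \<le> upper_limit u x"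
  proof (rule ccontr)
    assume "\<not> ?thesis"
    then obtain N d c' where d: "0 < d" "c' < - M" "\<And>n y. N \<le> n \<Longrightarrow> y \<in> ball x d \<Longrightarrow> u n y \<le> c'"
      by (meson not_le upper_limit_lessD)
    then have "u N x \<le> c'" by simp
    then show False using d(2) M[of N x] by linarith
  qed
  ultimately show ?thesis by linarith
qed

text \<open>Applied with a barrier that vanishes outside the domain, this fixes the exterior and
  boundary values of both half-relaxed limits, so no boundary layer can form.\<close>

lemma upper_limit_le_continuous:
  assumes "continuous_on UNIV W" "\<And>n y. u n y \<le> W y"
  shows "upper_limit u x \<le> W x"
proof (rule field_le_epsilon)
  fix e :: real assume e: "0 < e"
  then obtain d where d: "0 < d" "\<And>y. dist y x < d \<Longrightarrow> dist (W y) (W x) < e"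
    using assms(1) unfolding continuous_on_iff by (metis UNIV_I)
  show "upper_limit u x \<le> W x + e"
  proof (rule upper_limit_le[of d 0])
    fix n y assume "y \<in> ball x d"
    then show "u n y \<le> W x + e"
      using d(2)[of y] assms(2)[of n y] by (auto simp: dist_commute dist_real_def)
  qed (use d in auto)
qed

lemma upper_limit_eventually_less:
  assumes "\<And>j. j \<le> n j" "X \<longlonglongrightarrow> x" "upper_limit u x < c"
  shows "\<forall>\<^sub>F j in sequentially. u (n j) (X j) < c"
proof -
  obtain N d c' where d: "0 < d" "c' < c" "\<And>n y. N \<le> n \<Longrightarrow> y \<in> ball x d \<Longrightarrow> u n y \<le> c'"
    using assms(3) by (rule upper_limit_lessD) blast
  have "\<forall>\<^sub>F j in sequentially. X j \<in> ball x d"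
    using topological_tendstoD[OF assms(2), of "ball x d"] d(1) by simp
  then show ?thesis
    using eventually_ge_at_top[of N]
  proof eventually_elim
    case (elim j)
    then show ?case using d(3)[of "n j" "X j"] d(2) assms(1)[of j] by linarith
  qed
qed

lemma upper_limit_approx:
  "\<exists>n\<ge>j. \<exists>y\<in>ball x (inverse (real (Suc j))). upper_limit u x - inverse (real (Suc j)) < u n y"
proof (rule ccontr)
  assume "\<not> ?thesis"
  then have "u n y \<le> upper_limit u x - inverse (real (Suc j))"
    if "j \<le> n" "y \<in> ball x (inverse (real (Suc j)))" for n y
    using that by (meson not_le)
  then have "upper_limit u x \<le> upper_limit u x - inverse (real (Suc j))"
    by (intro upper_limit_le[of "inverse (real (Suc j))" j]) auto
  then show False by simp
qed

end

lemma upper_limit_dual: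
  assumes M: "\<And>n y. \<bar>u n y\<bar> \<le> M"
  shows "0 \<le> upper_limit u x + upper_limit (\<lambda>n y. - u n y) x"
proof (rule ccontr)
  assume neg: "\<not> ?thesis"
  have M': "\<bar>- u n y\<bar> \<le> M" for n y using M by simp
  define e where "e = - (upper_limit u x + upper_limit (\<lambda>n y. - u n y) x) / 2"
  have e: "0 < e" using neg by (simp add: e_def)
  have "\<forall>\<^sub>F j in sequentially. u j x < upper_limit u x + e"
    using e by (intro upper_limit_eventually_less[OF M, of "\<lambda>j. j" "\<lambda>_. x"]) auto
  moreover have "\<forall>\<^sub>F j in sequentially. - u j x < upper_limit (\<lambda>n y. - u n y) x + e"
    using e by (intro upper_limit_eventually_less[OF M', of "\<lambda>j. j" "\<lambda>_. x"]) auto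
  ultimately have "\<forall>\<^sub>F j :: nat in sequentially. False"
    by eventually_elim (simp add: e_def field_simps)
  then show False by simp
qed

section \<open>Stability\<close>

text \<open>The parallelogram law. The centre \<open>z\<close> may differ from the vertex
  \<open>x\<close>, which matters because near-maxima only converge to the contact point.\<close>

lemma second_diff_quadratic:
  fixes x y z p :: "'a::euclidean_space"
  shows "second_diff (\<lambda>y. p \<bullet> (y - x) + c * (norm (y - x))\<^sup>2) z y = 2 * c * (norm y)\<^sup>2"
proof -
  define w where "w = z - x"
  have eq: "z + y - x = w + y" "z - y - x = w - y" "z - x = w"
    by (simp_all add: w_def)
  have "(norm (w + y))\<^sup>2 + (norm (w - y))\<^sup>2 = 2 * (norm w)\<^sup>2 + 2 * (norm y)\<^sup>2"
    unfolding power2_norm_eq_inner by (simp add: inner_add inner_diff inner_commute[of y w])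
  then have "c * (norm (w + y))\<^sup>2 + c * (norm (w - y))\<^sup>2 = c * (2 * (norm w)\<^sup>2 + 2 * (norm y)\<^sup>2)"
    by (simp only: distrib_left[symmetric])
  then show ?thesis
    unfolding second_diff_def eq inner_add_right inner_diff_right by (simp add: distrib_left)
qed

lemma ceiling_step_tendsto:
  assumes "\<And>j. 0 < h j" "h \<longlonglongrightarrow> (0::real)" "0 < \<tau>"
  shows "(\<lambda>j. h j * real_of_int \<lceil>\<tau> / h j\<rceil>) \<longlonglongrightarrow> \<tau>"
proof (rule tendsto_sandwich)
  have "\<forall>\<^sub>F j in sequentially. h j < \<tau>"
    using order_tendstoD(2)[OF assms(2,3)] .
  then show "\<forall>\<^sub>F j in sequentially. \<tau> \<le> h j * real_of_int \<lceil>\<tau> / h j\<rceil>"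
    "\<forall>\<^sub>F j in sequentially. h j * real_of_int \<lceil>\<tau> / h j\<rceil> \<le> \<tau> + h j"
    using ceiling_step_bounds[OF assms(1)] by (auto elim!: eventually_mono simp: less_imp_le)
  show "(\<lambda>j. \<tau> + h j) \<longlonglongrightarrow> \<tau>"
    using tendsto_add[OF tendsto_const assms(2), of \<tau>] by simp
qed auto

text \<open>Reverse Fatou: the maximum of the integrands with the limiting one converges dominatedly.\<close>

lemma step_op_limsup:
  fixes v :: "nat \<Rightarrow> 'a::euclidean_space \<Rightarrow> real" and U :: "'a \<Rightarrow> real"
  assumes s: "0 < s" "s < 1" and \<rho>: "0 < \<rho>" "\<rho> < \<rho>'" and c: "0 \<le> c"
    and h: "\<And>j. 0 < h j" "h \<longlonglongrightarrow> 0"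
    and v: "\<And>j y. \<bar>v j y\<bar> \<le> M"
    and U: "U \<in> borel_measurable borel" "\<And>y. \<bar>U y\<bar> \<le> M"
    and near: "\<forall>\<^sub>F j in sequentially. \<forall>t. 0 < t \<and> t \<le> \<rho>' \<longrightarrow>
        second_diff (v j) (z j) (t *\<^sub>R \<xi> j) \<le> 2 * c * t\<^sup>2 + 2 * (h j)\<^sup>2"
    and far: "\<And>\<tau> t e. 0 < \<tau> \<Longrightarrow> t \<longlonglongrightarrow> \<tau> \<Longrightarrow> 0 < e \<Longrightarrow>
        \<forall>\<^sub>F j in sequentially. second_diff (v j) (z j) (t j *\<^sub>R \<xi> j) < second_diff U x (\<tau> *\<^sub>R \<zeta>) + e"
    and e: "0 < e"
  shows "\<forall>\<^sub>F j in sequentially. step_op s (h j) (v j) (z j) (\<xi> j) \<le> trunc_op s c \<rho> U x \<zeta> + e"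
proof -
  define st where "st j \<tau> = h j * real_of_int \<lceil>\<tau> / h j\<rceil>" for j and \<tau> :: real
  define g where "g j \<tau> = (if \<tau> < h j then 0 else second_diff (v j) (z j) (st j \<tau> *\<^sub>R \<xi> j))" for j \<tau>
  define G where "G \<tau> = (if \<tau> < \<rho> then 2 * c * \<tau>\<^sup>2 else second_diff U x (\<tau> *\<^sub>R \<zeta>))" for \<tau>
  \<comment> \<open>For \<open>h j \<le> \<tau>\<close> the rounded step is below
    \<open>2 * \<tau>\<close>, which turns \<open>2 * c\<close> into \<open>8 * c\<close>, and the
    error \<open>2 * (h j)\<^sup>2\<close> is at most \<open>2 * \<tau>\<^sup>2\<close>. Below
    \<open>h j\<close> the integrand is 0.\<close>
  define w where "w \<tau> = (if \<tau> < \<rho> then (8 * c + 2) * \<tau>\<^sup>2 else 4 * M)" for \<tau>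
  have g_meas [measurable]: "g j \<in> borel_measurable borel" for j
    unfolding g_def[abs_def] st_def by (rule borel_measurable_step)
  have g_int: "integrable (levy_measure s) (g j)" for j
    unfolding g_def[abs_def] st_def using integrable_step_op[OF s h(1) v] .
  have G_int: "integrable (levy_measure s) G"
    unfolding G_def[abs_def] using integrable_trunc_op[OF s \<rho>(1) U] .
  then have [measurable]: "G \<in> borel_measurable borel"
    by (auto dest: borel_measurable_integrable)
  have w_int: "integrable (levy_measure s) w"
    unfolding w_def[abs_def] using has_integral_levy_split[OF s \<rho>(1)] by (rule integrable.intros)
  \<comment> \<open>Rounding up a step shorter than \<open>\<rho>\<close> must not leave the range
    up to \<open>\<rho>'\<close> in which the bound \<open>near\<close> holds.\<close>
  have "\<forall>\<^sub>F j in sequentially. h j < \<rho>' - \<rho>"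
    using order_tendstoD(2)[OF h(2)] \<rho> by simp
  from eventually_conj[OF near this] obtain J where
    near': "\<And>j t. J \<le> j \<Longrightarrow> 0 < t \<Longrightarrow> t \<le> \<rho>' \<Longrightarrow>
        second_diff (v j) (z j) (t *\<^sub>R \<xi> j) \<le> 2 * c * t\<^sup>2 + 2 * (h j)\<^sup>2"
    and hJ: "\<And>j. J \<le> j \<Longrightarrow> h j < \<rho>' - \<rho>"
    unfolding eventually_sequentially by blast
  have st: "\<tau> \<le> st j \<tau>" "st j \<tau> < \<tau> + h j" if "h j \<le> \<tau>" for j \<tau>
    using ceiling_step_bounds[OF h(1) that] by (auto simp: st_def)
  have g_near: "g j \<tau> \<le> 2 * c * (st j \<tau>)\<^sup>2 + 2 * (h j)\<^sup>2" if "J \<le> j" "0 < \<tau>" "\<tau> < \<rho>" for j \<tau>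
  proof (cases "\<tau> < h j")
    case False
    then show ?thesis
      using near'[OF that(1), of "st j \<tau>"] st[of j \<tau>] hJ[OF that(1)] that by (simp add: g_def)
  qed (use c in \<open>simp add: g_def\<close>)
  have sd: "\<bar>second_diff (v j) a b\<bar> \<le> 4 * M" "\<bar>second_diff U a b\<bar> \<le> 4 * M" for j a b
    using abs_second_diff_le v U(2) by blast+
  have dom: "norm (max (g j \<tau>) (G \<tau>)) \<le> w \<tau>" if j: "J \<le> j" and \<tau>: "0 < \<tau>" for j \<tau>
  proof (cases "\<tau> < \<rho>")
    case True
    have "g j \<tau> \<le> (8 * c + 2) * \<tau>\<^sup>2"
    proof (cases "\<tau> < h j")
      case False
      have "(st j \<tau>)\<^sup>2 \<le> (2 * \<tau>)\<^sup>2" "(h j)\<^sup>2 \<le> \<tau>\<^sup>2"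
        by (rule power_mono; use st[of j \<tau>] False \<tau> h(1)[of j] in linarith)+
      then have "c * (st j \<tau>)\<^sup>2 \<le> c * (4 * \<tau>\<^sup>2)" "(h j)\<^sup>2 \<le> \<tau>\<^sup>2"
        using c by (auto intro!: mult_left_mono simp: power_mult_distrib)
      then show ?thesis
        using g_near[OF j \<tau> True] by (simp add: algebra_simps)
    qed (use c in \<open>simp add: g_def\<close>)
    moreover have "0 \<le> G \<tau>" "G \<tau> \<le> (8 * c + 2) * \<tau>\<^sup>2"
      using True c by (auto simp: G_def intro!: mult_right_mono)
    ultimately show ?thesis
      using True by (auto simp: w_def)
  next
    case False
    then show ?thesis
      using sd(1)[of j "z j" "st j \<tau> *\<^sub>R \<xi> j"] sd(2)[of x "\<tau> *\<^sub>R \<zeta>"]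
      by (auto simp: w_def g_def G_def abs_le_iff max_def)
  qed
  have lim: "(\<lambda>j. max (g j \<tau>) (G \<tau>)) \<longlonglongrightarrow> G \<tau>" if \<tau>: "0 < \<tau>" for \<tau>
  proof (rule tendstoI)
    fix e' :: real assume e': "0 < e'"
    have st_lim: "(\<lambda>j. st j \<tau>) \<longlonglongrightarrow> \<tau>"
      unfolding st_def using ceiling_step_tendsto[OF h \<tau>] .
    have "\<forall>\<^sub>F j in sequentially. g j \<tau> < G \<tau> + e'"
    proof (cases "\<tau> < \<rho>")
      case True
      have "(\<lambda>j. 2 * c * (st j \<tau>)\<^sup>2 + 2 * (h j)\<^sup>2) \<longlonglongrightarrow> 2 * c * \<tau>\<^sup>2 + 2 * 0\<^sup>2"
        by (intro tendsto_intros st_lim h)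
      then have "\<forall>\<^sub>F j in sequentially. 2 * c * (st j \<tau>)\<^sup>2 + 2 * (h j)\<^sup>2 < G \<tau> + e'"
        using True e' by (intro order_tendstoD(2)) (auto simp: G_def)
      then show ?thesis
        using eventually_ge_at_top[of J]
        by eventually_elim (use g_near[OF _ \<tau> True] in \<open>force intro: le_less_trans\<close>)
    next
      case False
      have "\<forall>\<^sub>F j in sequentially. h j < \<tau>"
        using order_tendstoD(2)[OF h(2) \<tau>] .
      then show ?thesis
        using far[OF \<tau> st_lim e']
        by eventually_elim (use False in \<open>simp add: g_def G_def\<close>)
    qed
    then show "\<forall>\<^sub>F j in sequentially. dist (max (g j \<tau>) (G \<tau>)) (G \<tau>) < e'"
      by eventually_elim (use e' in \<open>auto simp: dist_real_def max_def\<close>)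
  qed
  have "(\<lambda>j. \<integral>\<tau>. max (g (j + J) \<tau>) (G \<tau>) \<partial>levy_measure s) \<longlonglongrightarrow> integral\<^sup>L (levy_measure s) G"
  proof (rule integral_dominated_convergence[OF _ _ w_int])
    show "AE \<tau> in levy_measure s. (\<lambda>j. max (g (j + J) \<tau>) (G \<tau>)) \<longlonglongrightarrow> G \<tau>"
      using AE_levy_measure_pos
      by eventually_elim (use LIMSEQ_ignore_initial_segment[OF lim] in blast)
    show "AE \<tau> in levy_measure s. norm (max (g (j + J) \<tau>) (G \<tau>)) \<le> w \<tau>" for j
      using AE_levy_measure_pos by eventually_elim (rule dom; simp)
  qed measurable
  then have "(\<lambda>j. \<integral>\<tau>. max (g j \<tau>) (G \<tau>) \<partial>levy_measure s) \<longlonglongrightarrow> integral\<^sup>L (levy_measure s) G"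
    by (rule LIMSEQ_offset)
  then have "\<forall>\<^sub>F j in sequentially. (\<integral>\<tau>. max (g j \<tau>) (G \<tau>) \<partial>levy_measure s) < integral\<^sup>L (levy_measure s) G + e"
    using e by (intro order_tendstoD(2)) auto
  then show ?thesis
  proof eventually_elim
    case (elim j)
    have "step_op s (h j) (v j) (z j) (\<xi> j) = integral\<^sup>L (levy_measure s) (g j)"
      unfolding step_op_def g_def[abs_def] st_def ..
    also have "\<dots> \<le> (\<integral>\<tau>. max (g j \<tau>) (G \<tau>) \<partial>levy_measure s)"
      using g_int G_int by (intro integral_mono integrable_max) auto
    also have "\<dots> \<le> trunc_op s c \<rho> U x \<zeta> + e"
      using elim unfolding trunc_op_def G_def[abs_def] by simp
    finally show ?case .
  qed
qed

text \<open>Solutions of the scheme carry no semicontinuity, so a maximum over a ball need not be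
  attained and is replaced by an approximate one.\<close>

lemma near_maximum_exists:
  fixes a :: "'a \<Rightarrow> real"
  assumes "K \<noteq> {}" "bdd_above (a ` K)" "0 < e"
  shows "\<exists>z\<in>K. \<forall>y\<in>K. a y \<le> a z + e"
proof -
  have "\<exists>z\<in>K. Sup (a ` K) - e < a z"
    using less_cSupD[of "a ` K" "Sup (a ` K) - e"] assms by auto
  then obtain z where "z \<in> K" "Sup (a ` K) - e < a z" by blast
  moreover have "a y \<le> Sup (a ` K)" if "y \<in> K" for y
    using assms(2) that by (intro cSup_upper) auto
  ultimately show ?thesis by (intro bexI[of _ z]) force+
qed

text \<open>The near-maxima are optimal up to \<open>(h j)\<^sup>2\<close> since the mass of the steps
  beyond \<open>h j\<close> is of the smaller order \<open>(h j) powr (- 2 * s)\<close>.\<close>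

lemma near_maxima_sequence:
  fixes u :: "nat \<Rightarrow> 'a::euclidean_space \<Rightarrow> real" and P :: "'a \<Rightarrow> real"
  assumes M: "\<And>n y. \<bar>u n y\<bar> \<le> M" and r: "0 < r" and P: "continuous_on UNIV P"
    and strict: "\<And>y. y \<in> cball x r \<Longrightarrow> y \<noteq> x \<Longrightarrow> upper_limit u y - P y < upper_limit u x - P x"
  obtains n :: "nat \<Rightarrow> nat" and z where "\<And>j. j \<le> n j" "z \<longlonglongrightarrow> x"
    "(\<lambda>j. u (n j) (z j)) \<longlonglongrightarrow> upper_limit u x"
    "\<And>j y. y \<in> cball x r \<Longrightarrow> u (n j) y - P y \<le> u (n j) (z j) - P (z j) + (inverse (real (Suc (n j))))\<^sup>2"
proof -
  have "compact (P ` cball x r)"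
    by (rule compact_continuous_image[OF continuous_on_subset[OF P] compact_cball]) auto
  then obtain B where B: "\<And>y. y \<in> cball x r \<Longrightarrow> \<bar>P y\<bar> \<le> B"
    using compact_imp_bounded by (force simp: bounded_iff)
  have "\<forall>m. \<exists>z. z \<in> cball x r \<and> (\<forall>y\<in>cball x r. u m y - P y \<le> u m z - P z + (inverse (real (Suc m)))\<^sup>2)"
    unfolding Bex_def[symmetric]
  proof (intro allI near_maximum_exists)
    fix m
    show "bdd_above ((\<lambda>y. u m y - P y) ` cball x r)"
      unfolding bdd_above_def
    proof (intro exI[of _ "M + B"] ballI)
      fix t assume "t \<in> (\<lambda>y. u m y - P y) ` cball x r"
      then obtain y where y: "y \<in> cball x r" "t = u m y - P y" by blast
      show "t \<le> M + B" using M[of m y] B[OF y(1)] y(2) by linarith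
    qed
  qed (use r in auto)
  from choice[OF this] obtain \<zeta> where \<zeta>: "\<And>m. \<zeta> m \<in> cball x r"
    "\<And>m y. y \<in> cball x r \<Longrightarrow> u m y - P y \<le> u m (\<zeta> m) - P (\<zeta> m) + (inverse (real (Suc m)))\<^sup>2"
    by blast
  have "\<forall>j. \<exists>n y. j \<le> n \<and> y \<in> ball x (inverse (real (Suc j))) \<and> upper_limit u x - inverse (real (Suc j)) < u n y"
    using upper_limit_approx[where u = u, OF M, of _ x] by blast
  from choice[OF this] obtain n0 where "\<forall>j. \<exists>y. j \<le> n0 j \<and> y \<in> ball x (inverse (real (Suc j))) \<and>
      upper_limit u x - inverse (real (Suc j)) < u (n0 j) y"
    by blast
  from choice[OF this] obtain y0 where n0: "\<And>j. j \<le> n0 j"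
    and y0: "\<And>j. y0 j \<in> ball x (inverse (real (Suc j)))"
      "\<And>j. upper_limit u x - inverse (real (Suc j)) < u (n0 j) (y0 j)"
    by blast
  have "\<forall>j. \<zeta> (n0 j) \<in> cball x r" using \<zeta>(1) by blast
  then obtain z0 q where z0: "z0 \<in> cball x r" and q: "strict_mono (q :: nat \<Rightarrow> nat)"
    and lim: "((\<lambda>j. \<zeta> (n0 j)) \<circ> q) \<longlonglongrightarrow> z0"
    using compact_imp_seq_compact[OF compact_cball] by (metis seq_compactE)
  define n where "n j = n0 (q j)" for j
  define z where "z j = \<zeta> (n j)" for j
  define y where "y j = y0 (q j)" for j
  have jn: "j \<le> n j" for j
    using seq_suble[OF q, of j] n0[of "q j"] by (simp add: n_def)
  have zlim: "z \<longlonglongrightarrow> z0"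
    using lim by (simp add: comp_def z_def[abs_def] n_def)
  have inv0: "(\<lambda>j. inverse (real (Suc (q j)))) \<longlonglongrightarrow> 0"
    using LIMSEQ_subseq_LIMSEQ[OF LIMSEQ_inverse_real_of_nat q] by (simp add: comp_def)
  have ylim: "y \<longlonglongrightarrow> x"
  proof (rule metric_tendsto_imp_tendsto[OF inv0])
    show "\<forall>\<^sub>F j in sequentially. dist (y j) x \<le> dist (inverse (real (Suc (q j)))) 0"
      using y0(1) by (auto simp: y_def dist_commute less_imp_le intro!: always_eventually)
  qed
  have ninv: "(\<lambda>j. (inverse (real (Suc (n j))))\<^sup>2) \<longlonglongrightarrow> 0\<^sup>2"
  proof (rule tendsto_power)
    show "(\<lambda>j. inverse (real (Suc (n j)))) \<longlonglongrightarrow> 0"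
      by (rule tendsto_sandwich[OF _ _ tendsto_const LIMSEQ_inverse_real_of_nat])
        (simp_all add: jn)
  qed
  have Plim: "(\<lambda>j. P (y j)) \<longlonglongrightarrow> P x" "(\<lambda>j. P (z j)) \<longlonglongrightarrow> P z0"
    using P by (auto intro: isCont_tendsto_compose[OF _ ylim] isCont_tendsto_compose[OF _ zlim]
        simp: continuous_on_eq_continuous_at)
  have ycball: "\<forall>\<^sub>F j in sequentially. y j \<in> cball x r"
    using topological_tendstoD[OF ylim, of "ball x r"] r by (auto elim: eventually_mono simp: less_imp_le)
  \<comment> \<open>Near-maximality is tested against the points \<open>y j\<close>, which tend to
    \<open>x\<close> and realize the upper limit there. In the limit \<open>z0\<close> is at least
    as good as \<open>x\<close> for \<open>upper_limit u - P\<close>, so strictness gives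
    \<open>z0 = x\<close>; the same bound yields convergence of the values.\<close>
  define lower where "lower j = upper_limit u x - inverse (real (Suc (q j))) - P (y j) + P (z j)
      - (inverse (real (Suc (n j))))\<^sup>2" for j
  have lower: "\<forall>\<^sub>F j in sequentially. lower j \<le> u (n j) (z j)"
    using ycball
  proof eventually_elim
    case (elim j)
    show ?case
      using \<zeta>(2)[OF elim, of "n j"] y0(2)[of "q j"] unfolding lower_def z_def y_def n_def by linarith
  qed
  have "lower \<longlonglongrightarrow> upper_limit u x - 0 - P x + P z0 - 0\<^sup>2"
    unfolding lower_def[abs_def] by (intro tendsto_intros inv0 ninv Plim)
  then have lower_lim: "lower \<longlonglongrightarrow> upper_limit u x - P x + P z0" by simp
  have "upper_limit u x - P x + P z0 \<le> upper_limit u z0 + e" if "0 < e" for e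
  proof -
    have "\<forall>\<^sub>F j in sequentially. u (n j) (z j) < upper_limit u z0 + e"
      using upper_limit_eventually_less[where u = u, OF M jn zlim] that by simp
    with lower have "\<forall>\<^sub>F j in sequentially. lower j \<le> upper_limit u z0 + e"
      by eventually_elim simp
    then show ?thesis
      by (rule tendsto_upperbound[OF lower_lim]) simp
  qed
  then have "upper_limit u x - P x + P z0 \<le> upper_limit u z0"
    by (rule field_le_epsilon)
  then have z0x: "z0 = x"
    using strict[OF z0] by force
  show thesis
  proof (rule that[OF jn])
    show "z \<longlonglongrightarrow> x" using zlim z0x by simp
    show "(\<lambda>j. u (n j) (z j)) \<longlonglongrightarrow> upper_limit u x"
    proof (rule order_tendstoI)
      fix a assume "a < upper_limit u x"
      then have "\<forall>\<^sub>F j in sequentially. a < lower j"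
        using order_tendstoD(1)[OF lower_lim] z0x by simp
      with lower show "\<forall>\<^sub>F j in sequentially. a < u (n j) (z j)"
        by eventually_elim simp
    next
      fix a assume "upper_limit u x < a"
      then show "\<forall>\<^sub>F j in sequentially. u (n j) (z j) < a"
        using upper_limit_eventually_less[where u = u, OF M jn zlim] z0x by simp
    qed
    show "u (n j) y - P y \<le> u (n j) (z j) - P (z j) + (inverse (real (Suc (n j))))\<^sup>2"
      if "y \<in> cball x r" for j y
      using \<zeta>(2)[OF that] by (simp add: z_def)
  qed
qed

lemma trunc_op_shift:
  fixes u :: "'a::euclidean_space \<Rightarrow> real"
  assumes s: "0 < s" "s < 1" and \<rho>: "0 < \<rho>" and u: "u \<in> borel_measurable borel" "\<And>z. \<bar>u z\<bar> \<le> M"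
  shows "trunc_op s (c + \<eta>) \<rho> u x \<xi> \<le> trunc_op s c \<rho> u x \<xi> + 2 * \<eta> * (\<rho> powr (2 - 2 * s) / (2 - 2 * s))"
proof -
  let ?g = "\<lambda>c \<tau>. if \<tau> < \<rho> then 2 * c * \<tau>\<^sup>2 else second_diff u x (\<tau> *\<^sub>R \<xi>)"
  have int: "integrable (levy_measure s) (?g c)" for c
    using integrable_trunc_op[OF s \<rho> u] .
  have "trunc_op s (c + \<eta>) \<rho> u x \<xi> - trunc_op s c \<rho> u x \<xi> = (\<integral>\<tau>. ?g (c + \<eta>) \<tau> - ?g c \<tau> \<partial>levy_measure s)"
    unfolding trunc_op_def using int int by (rule Bochner_Integration.integral_diff[symmetric])
  also have "\<dots> \<le> 2 * \<eta> * (\<rho> powr (2 - 2 * s) / (2 - 2 * s)) + 0 * (\<rho> powr (- 2 * s) / (2 * s))"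
  proof (rule integral_levy_split_bound[OF s \<rho>])
    show "integrable (levy_measure s) (\<lambda>\<tau>. ?g (c + \<eta>) \<tau> - ?g c \<tau>)"
      using int int by (rule Bochner_Integration.integrable_diff)
  qed (simp add: algebra_simps)
  finally show ?thesis by simp
qed

text \<open>Raising the opening to \<open>c + \<eta>\<close> makes the contact strict, so
  near-maxima of the scheme converge to the contact point and satisfy the equation there. The
  near-contact bounds short steps, the half-relaxed limit bounds the others, and compactness of
  frames carries the extremum to the limit; finally \<open>\<eta>\<close> tends to 0.\<close>

theorem upper_limit_quad_subsolution:
  fixes u :: "nat \<Rightarrow> 'a::euclidean_space \<Rightarrow> real"
  assumes s: "0 < s" "s < 1" and k: "k \<le> DIM('a)" and \<Omega>: "open \<Omega>" and F: "continuous_on \<Omega> F"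
    and M: "\<And>n y. \<bar>u n y\<bar> \<le> M"
    and eq: "\<And>n x. ball x (inverse (real (Suc n))) \<subseteq> \<Omega> \<Longrightarrow>
      F x \<le> extremum upper k (step_op s (inverse (real (Suc n))) (u n) x)"
  shows "quad_subsolution s k \<Omega> upper F (upper_limit u)"
  unfolding quad_subsolution_def
proof (intro ballI allI impI, elim conjE)
  fix x p c r \<rho>
  assume x: "x \<in> \<Omega>" and c: "0 \<le> c" and \<rho>: "0 < \<rho>" "\<rho> < r"
    and touch: "\<forall>y\<in>ball x r. upper_limit u y \<le> upper_limit u x + p \<bullet> (y - x) + c * (norm (y - x))\<^sup>2"
  define U where "U = upper_limit u"
  have U: "U \<in> borel_measurable borel" "\<And>y. \<bar>U y\<bar> \<le> M"
    unfolding U_def using usc_on_borel_measurable[OF usc_on_upper_limit[where u = u, OF M]] abs_upper_limit_le[where u = u, OF M] by auto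
  have strict: "F x \<le> extremum upper k (trunc_op s (c + \<eta>) \<rho> U x)" if \<eta>: "0 < \<eta>" for \<eta>
  proof -
    define P where "P y = p \<bullet> (y - x) + (c + \<eta>) * (norm (y - x))\<^sup>2" for y
    \<comment> \<open>The gap between \<open>\<rho>\<close> and \<open>r\<close> is used twice:
      \<open>\<rho>' - \<rho>\<close> absorbs the rounding of steps, and \<open>R - \<rho>'\<close>
      the distance of the near-maxima from \<open>x\<close>.\<close>
    define R \<rho>' where "R = (\<rho> + r) / 2" and "\<rho>' = (\<rho> + R) / 2"
    have R: "\<rho> < \<rho>'" "\<rho>' < R" "R < r" "0 < R" using \<rho> by (auto simp: R_def \<rho>'_def)
    have cont: "continuous_on UNIV P"
      unfolding P_def by (intro continuous_intros)
    have P_strict: "U y - P y < U x - P x" if y: "y \<in> cball x R" "y \<noteq> x" for y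
    proof -
      have "0 < \<eta> * (norm (y - x))\<^sup>2" using \<eta> y by simp
      then show ?thesis
        using touch[rule_format, of y] y R(3) by (simp add: P_def U_def algebra_simps)
    qed
    obtain n :: "nat \<Rightarrow> nat" and z where n: "\<And>j. j \<le> n j" and z: "z \<longlonglongrightarrow> x"
      and uz: "(\<lambda>j. u (n j) (z j)) \<longlonglongrightarrow> U x"
      and max: "\<And>j y. y \<in> cball x R \<Longrightarrow> u (n j) y - P y \<le> u (n j) (z j) - P (z j) + (inverse (real (Suc (n j))))\<^sup>2"
      by (rule near_maxima_sequence[where u = u, folded U_def, OF M R(4) cont P_strict])
        (assumption | rule that | blast)+
    define h where "h j = inverse (real (Suc (n j)))" for j
    have h: "0 < h j" for j by (simp add: h_def)
    have h0: "h \<longlonglongrightarrow> 0"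
      unfolding h_def
      by (rule tendsto_sandwich[OF _ _ tendsto_const LIMSEQ_inverse_real_of_nat])
        (simp_all add: n)
    define g where "g j = step_op s (h j) (u (n j)) (z j)" for j
    \<comment> \<open>The second branch is a filler that makes
      \<open>L j \<le> extremum upper k (g j)\<close> hold for all \<open>j\<close>; eventually only
      the first branch occurs.\<close>
    define L where "L j = (if ball (z j) (h j) \<subseteq> \<Omega> then F (z j) else extremum upper k (g j))" for j
    have "L \<longlonglongrightarrow> F x"
    proof (rule Lim_transform_eventually)
      show "(\<lambda>j. F (z j)) \<longlonglongrightarrow> F x"
        using F \<Omega> x by (intro isCont_tendsto_compose[OF _ z]) (simp add: continuous_on_eq_continuous_at)
      obtain d where d: "0 < d" "ball x d \<subseteq> \<Omega>" using \<Omega> x open_contains_ball by blast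
      have "\<forall>\<^sub>F j in sequentially. dist (z j) x < d / 2" "\<forall>\<^sub>F j in sequentially. h j < d / 2"
        using tendstoD[OF z, of "d / 2"] order_tendstoD(2)[OF h0, of "d / 2"] d by simp_all
      then show "\<forall>\<^sub>F j in sequentially. F (z j) = L j"
      proof eventually_elim
        case (elim j)
        have "ball (z j) (h j) \<subseteq> ball x d"
        proof
          fix y assume "y \<in> ball (z j) (h j)"
          then show "y \<in> ball x d"
            using dist_triangle[of x y "z j"] elim by (simp add: dist_commute)
        qed
        then have "ball (z j) (h j) \<subseteq> \<Omega>" using d(2) by (rule order_trans)
        then show ?case by (simp add: L_def)
      qed
    qed
    show ?thesis
    proof (rule extremum_limsup[OF k, of g _ L])
      show "bounded (g j ` sphere 0 1)" for j
        unfolding g_def using bounded_step_op[OF s h M] .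
      show "bounded (trunc_op s (c + \<eta>) \<rho> U x ` sphere 0 1)"
        using bounded_trunc_op[OF s \<rho>(1) U] .
      show "L j \<le> extremum upper k (g j)" for j
        using eq[of "z j" "n j"] by (simp add: L_def g_def h_def)
      show "L \<longlonglongrightarrow> F x" by fact
      fix q :: "nat \<Rightarrow> nat" and \<xi> :: "nat \<Rightarrow> 'a" and l and e :: real
      assume q: "strict_mono q" and \<xi>: "\<And>j. norm (\<xi> j) = 1" "\<xi> \<longlonglongrightarrow> l" and e: "0 < e"
      have jq: "j \<le> n (q j)" for j
        using seq_suble[OF q, of j] n[of "q j"] by simp
      have zq: "(\<lambda>j. z (q j)) \<longlonglongrightarrow> x" and hq: "(\<lambda>j. h (q j)) \<longlonglongrightarrow> 0"
        and uq: "(\<lambda>j. u (n (q j)) (z (q j))) \<longlonglongrightarrow> U x"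
        using LIMSEQ_subseq_LIMSEQ[OF z q] LIMSEQ_subseq_LIMSEQ[OF h0 q] LIMSEQ_subseq_LIMSEQ[OF uz q]
        by (simp_all add: comp_def)
      show "\<forall>\<^sub>F j in sequentially. g (q j) (\<xi> j) \<le> trunc_op s (c + \<eta>) \<rho> U x l + e"
        unfolding g_def
      proof (rule step_op_limsup[OF s \<rho>(1) R(1) _ h hq M U])
        show "0 \<le> c + \<eta>" using c \<eta> by simp
        show "0 < e" by fact
        have "\<forall>\<^sub>F j in sequentially. dist (z (q j)) x < R - \<rho>'"
          using tendstoD[OF zq] R by simp
        then show "\<forall>\<^sub>F j in sequentially. \<forall>t. 0 < t \<and> t \<le> \<rho>' \<longrightarrow>
            second_diff (u (n (q j))) (z (q j)) (t *\<^sub>R \<xi> j) \<le> 2 * (c + \<eta>) * t\<^sup>2 + 2 * (h (q j))\<^sup>2"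
        proof (eventually_elim, intro allI impI)
          fix j t assume d: "dist (z (q j)) x < R - \<rho>'" and t: "0 < t \<and> t \<le> \<rho>'"
          let ?z = "z (q j)" and ?y = "t *\<^sub>R \<xi> j"
          have ny: "norm ?y = t" using \<xi>(1) t by simp
          have mem: "w \<in> cball x R \<longleftrightarrow> norm (w - x) \<le> R" for w
            by (simp add: dist_norm norm_minus_commute)
          have "norm (?z + ?y - x) = norm ((?z - x) + ?y)" "norm (?z - ?y - x) = norm ((?z - x) - ?y)"
            by (rule arg_cong[of _ _ norm]; simp)+
          moreover have "norm (?z - x) < R - \<rho>'" using d by (simp add: dist_norm)
          ultimately have ins: "?z + ?y \<in> cball x R" "?z - ?y \<in> cball x R"
            using conjunct2[OF t] ny norm_triangle_ineq[of "?z - x" "?y"] norm_triangle_ineq4[of "?z - x" "?y"]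
            unfolding mem by linarith+
          have "u (n (q j)) (?z + ?y) - P (?z + ?y) \<le> u (n (q j)) ?z - P ?z + (h (q j))\<^sup>2"
            "u (n (q j)) (?z - ?y) - P (?z - ?y) \<le> u (n (q j)) ?z - P ?z + (h (q j))\<^sup>2"
            unfolding h_def by (rule max[OF ins(1)] max[OF ins(2)])+
          moreover have "second_diff P ?z ?y = 2 * (c + \<eta>) * t\<^sup>2"
            unfolding P_def second_diff_quadratic ny ..
          ultimately show "second_diff (u (n (q j))) ?z ?y \<le> 2 * (c + \<eta>) * t\<^sup>2 + 2 * (h (q j))\<^sup>2"
            unfolding second_diff_def by linarith
        qed
        fix \<tau> e' :: real and t :: "nat \<Rightarrow> real" assume \<tau>: "0 < \<tau>" "t \<longlonglongrightarrow> \<tau>" and e': "0 < e'"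
        have "(\<lambda>j. z (q j) + t j *\<^sub>R \<xi> j) \<longlonglongrightarrow> x + \<tau> *\<^sub>R l" "(\<lambda>j. z (q j) - t j *\<^sub>R \<xi> j) \<longlonglongrightarrow> x - \<tau> *\<^sub>R l"
          by (intro tendsto_intros zq \<tau> \<xi>)+
        then have "\<forall>\<^sub>F j in sequentially. u (n (q j)) (z (q j) + t j *\<^sub>R \<xi> j) < U (x + \<tau> *\<^sub>R l) + e' / 4"
          "\<forall>\<^sub>F j in sequentially. u (n (q j)) (z (q j) - t j *\<^sub>R \<xi> j) < U (x - \<tau> *\<^sub>R l) + e' / 4"
          using upper_limit_eventually_less[where u = u, OF M jq] e' unfolding U_def by simp_all
        moreover have "\<forall>\<^sub>F j in sequentially. U x - e' / 4 < u (n (q j)) (z (q j))"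
          using order_tendstoD(1)[OF uq] e' by simp
        ultimately show "\<forall>\<^sub>F j in sequentially.
            second_diff (u (n (q j))) (z (q j)) (t j *\<^sub>R \<xi> j) < second_diff U x (\<tau> *\<^sub>R l) + e'"
          by eventually_elim (simp add: second_diff_def)
      qed
    qed
  qed
  define C where "C = \<rho> powr (2 - 2 * s) / (2 - 2 * s)"
  have C: "0 < C" using \<rho> s by (simp add: C_def)
  have shift: "trunc_op s (c + \<eta>) \<rho> U x \<xi> \<le> trunc_op s c \<rho> U x \<xi> + 2 * \<eta> * C" for \<eta> \<xi>
    unfolding C_def using trunc_op_shift[OF s \<rho>(1) U] .
  show "F x \<le> extremum upper k (trunc_op s c \<rho> (upper_limit u) x)"
    unfolding U_def[symmetric]
  proof (rule field_le_epsilon)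
    fix e :: real assume e: "0 < e"
    \<comment> \<open>The cost of the increase is \<open>real k * (2 * \<eta> * C)\<close>, which
      this choice keeps at most \<open>e\<close>.\<close>
    define \<eta> where "\<eta> = e / (real k + 1) / (2 * C)"
    have \<eta>: "0 < \<eta>" using e C by (simp add: \<eta>_def)
    have "F x \<le> extremum upper k (trunc_op s (c + \<eta>) \<rho> U x)"
      by (rule strict[OF \<eta>])
    also have "\<dots> \<le> extremum upper k (trunc_op s c \<rho> U x) + real k * (2 * \<eta> * C)"
      by (rule extremum_mono[OF k]) (use bounded_trunc_op[OF s \<rho>(1) U] shift in auto)
    also have "real k * (2 * \<eta> * C) = real k * (e / (real k + 1))"
      using C by (simp add: \<eta>_def)
    also have "\<dots> \<le> e"
      using e by (simp add: field_simps)
    finally show "F x \<le> extremum upper k (trunc_op s c \<rho> U x) + e" by simp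
  qed
qed

section \<open>Test values\<close>

lemma ext_integral_mono:
  assumes "\<And>t. t \<in> A \<Longrightarrow> g t \<le> g' t"
  shows "ext_integral A g \<le> ext_integral A g'"
  unfolding ext_integral_def
  by (intro ereal_minus_mono less_eq_ennreal.rep_eq[THEN iffD1] nn_integral_mono)
    (auto simp: indicator_def assms intro!: ennreal_leI)

lemma ext_integral_levy:
  assumes A: "A \<in> sets borel" "A \<subseteq> {0<..}" and [measurable]: "G \<in> borel_measurable borel"
    and int: "integrable (levy_measure s) (\<lambda>\<tau>. indicator A \<tau> * G \<tau>)"
  shows "ext_integral A (\<lambda>\<tau>. G \<tau> / \<tau> powr (1 + 2 * s)) = ereal (\<integral>\<tau>. indicator A \<tau> * G \<tau> \<partial>levy_measure s)"
proof -
  note [measurable] = A(1)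
  define f where "f \<tau> = indicator A \<tau> * (G \<tau> / \<tau> powr (1 + 2 * s))" for \<tau> :: real
  have f_eq: "f = (\<lambda>\<tau>. (indicator {0<..} \<tau> / \<tau> powr (1 + 2 * s)) * (indicator A \<tau> * G \<tau>))"
    using A(2) by (auto simp: f_def indicator_def fun_eq_iff)
  have meas: "(\<lambda>\<tau>. indicator A \<tau> * G \<tau>) \<in> borel_measurable lborel"
    "(\<lambda>\<tau>. indicator {0<..} \<tau> / \<tau> powr (1 + 2 * s) :: real) \<in> borel_measurable lborel"
    by measurable
  have nonneg: "AE \<tau> in lborel. 0 \<le> (indicator {0<..} \<tau> / \<tau> powr (1 + 2 * s) :: real)"
    by auto
  have f_int: "integrable lborel f"
    using int unfolding levy_measure_def f_eq by (simp add: integrable_density[OF meas nonneg])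
  have val: "integral\<^sup>L lborel f = (\<integral>\<tau>. indicator A \<tau> * G \<tau> \<partial>levy_measure s)"
    unfolding levy_measure_def f_eq by (simp add: integral_density[OF meas nonneg])
  have fin: "(\<integral>\<^sup>+\<tau>. ennreal (f \<tau>) \<partial>lborel) \<noteq> \<infinity>" "(\<integral>\<^sup>+\<tau>. ennreal (- f \<tau>) \<partial>lborel) \<noteq> \<infinity>"
    using f_int by (auto simp: real_integrable_def)
  have set_eq: "(\<integral>\<^sup>+\<tau>\<in>A. ennreal (G \<tau> / \<tau> powr (1 + 2 * s)) \<partial>lborel) = (\<integral>\<^sup>+\<tau>. ennreal (f \<tau>) \<partial>lborel)"
    "(\<integral>\<^sup>+\<tau>\<in>A. ennreal (- (G \<tau> / \<tau> powr (1 + 2 * s))) \<partial>lborel) = (\<integral>\<^sup>+\<tau>. ennreal (- f \<tau>) \<partial>lborel)"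
    by (intro nn_integral_cong; simp add: f_def indicator_def)+
  have real: "enn2ereal a = ereal (enn2real a)" if "a \<noteq> \<infinity>" for a
    using that by (cases a rule: ennreal_cases) (auto simp: enn2ereal_ennreal)
  show ?thesis
    unfolding ext_integral_def set_eq real[OF fin(1)] real[OF fin(2)] val[symmetric]
    by (simp add: real_lebesgue_integral_def[OF f_int])
qed

lemma ereal_extremum:
  fixes g :: "'a::euclidean_space \<Rightarrow> real"
  assumes "k \<le> DIM('a)" "bounded (g ` sphere 0 1)"
  shows "(if upper then Sup else Inf) ((\<lambda>B. ereal (sum g B)) ` orthonormal_sets k) = ereal (extremum upper k g)"
proof -
  obtain K where K: "\<forall>B\<in>orthonormal_sets k. \<bar>sum g B\<bar> \<le> K"
    using bounded_sum_orthonormal[OF assms(2), of k] by (auto simp: bounded_iff)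
  then have "\<forall>B\<in>orthonormal_sets k. ereal (- K) \<le> ereal (sum g B) \<and> ereal (sum g B) \<le> ereal K"
    by (auto simp: abs_le_iff minus_le_iff)
  then have "\<bar>SUP B\<in>orthonormal_sets k. ereal (sum g B)\<bar> \<noteq> \<infinity>" "\<bar>INF B\<in>orthonormal_sets k. ereal (sum g B)\<bar> \<noteq> \<infinity>"
    using orthonormal_sets_nonempty[OF assms(1)]
    by (intro ereal_SUP_not_infty[of _ "ereal (- K)" "ereal K"] ereal_INF_not_infty[of _ "ereal (- K)" "ereal K"]; simp)+
  then show ?thesis
    by (simp add: extremum_def ereal_SUP ereal_INF)
qed

lemma extremum_ereal_mono:
  assumes "\<And>B. B \<in> S \<Longrightarrow> (a B :: ereal) \<le> b B"
  shows "(if upper then Sup else Inf) (a ` S) \<le> (if upper then Sup else Inf) (b ` S)"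
  using assms by (auto intro!: SUP_mono INF_mono)

text \<open>The test function may have an infinite integral near the sphere, so it is never
  integrated directly. Monotonicity in the extended reals compares it with an integrand made of a
  paraboloid below \<open>\<rho>'\<close> and \<open>u\<close> from there on, whose integral is
  finite.\<close>

lemma
  fixes u \<phi> :: "'a::euclidean_space \<Rightarrow> real" and upper :: bool and c :: real and x :: 'a
  assumes s: "0 < s" "s < 1" and k: "k \<le> DIM('a)" and \<rho>: "0 < \<rho>'" "\<rho>' \<le> \<rho>"
    and u: "u \<in> borel_measurable borel" "\<And>z. \<bar>u z\<bar> \<le> M"
  defines "T \<equiv> ereal (frac_const s * extremum upper k (trunc_op s c \<rho>' u x))"
  shows test_value_lower:
      "(\<And>\<tau> \<xi>. norm \<xi> = 1 \<Longrightarrow> 0 < \<tau> \<Longrightarrow> \<tau> < \<rho> \<Longrightarrow>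
         (if \<tau> < \<rho>' then 2 * c * \<tau>\<^sup>2 else second_diff u x (\<tau> *\<^sub>R \<xi>)) \<le> second_diff \<phi> x (\<tau> *\<^sub>R \<xi>)) \<Longrightarrow>
       T \<le> test_value (if upper then Sup else Inf) s k u \<phi> \<rho> x"
    and test_value_upper:
      "(\<And>\<tau> \<xi>. norm \<xi> = 1 \<Longrightarrow> 0 < \<tau> \<Longrightarrow> \<tau> < \<rho> \<Longrightarrow>
         second_diff \<phi> x (\<tau> *\<^sub>R \<xi>) \<le> (if \<tau> < \<rho>' then 2 * c * \<tau>\<^sup>2 else second_diff u x (\<tau> *\<^sub>R \<xi>))) \<Longrightarrow>
       test_value (if upper then Sup else Inf) s k u \<phi> \<rho> x \<le> T"
proof -
  define G where "G \<xi> \<tau> = (if \<tau> < \<rho>' then 2 * c * \<tau>\<^sup>2 else second_diff u x (\<tau> *\<^sub>R \<xi>))" for \<xi> \<tau>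
  have G_int: "integrable (levy_measure s) (G \<xi>)" for \<xi>
    unfolding G_def[abs_def] using integrable_trunc_op[OF s \<rho>(1) u] .
  have G_meas: "G \<xi> \<in> borel_measurable borel" for \<xi>
    using borel_measurable_integrable[OF G_int] by (simp cong: measurable_cong_sets)
  have int: "integrable (levy_measure s) (\<lambda>\<tau>. indicator A \<tau> * G \<xi> \<tau>)" if "A \<in> sets borel" for A \<xi>
    using integrable_mult_indicator[OF _ G_int, of A \<xi>] that by simp
  define w where "w \<tau> = \<tau> powr (1 + 2 * s)" for \<tau> :: real
  have w: "0 \<le> w \<tau>" for \<tau> by (simp add: w_def)
  \<comment> \<open>The two open ranges omit the single step \<open>\<rho>\<close>, which has
    measure 0.\<close>
  have split: "ext_integral {0<..<\<rho>} (\<lambda>\<tau>. G \<xi> \<tau> / w \<tau>) + ext_integral {\<rho><..} (\<lambda>\<tau>. G \<xi> \<tau> / w \<tau>)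
      = ereal (trunc_op s c \<rho>' u x \<xi>)" for \<xi>
  proof -
    have "(\<integral>\<tau>. indicator {0<..<\<rho>} \<tau> * G \<xi> \<tau> \<partial>levy_measure s) + (\<integral>\<tau>. indicator {\<rho><..} \<tau> * G \<xi> \<tau> \<partial>levy_measure s)
        = (\<integral>\<tau>. indicator {0<..<\<rho>} \<tau> * G \<xi> \<tau> + indicator {\<rho><..} \<tau> * G \<xi> \<tau> \<partial>levy_measure s)"
      using int by (intro Bochner_Integration.integral_add[symmetric]) auto
    also have "\<dots> = integral\<^sup>L (levy_measure s) (G \<xi>)"
    proof (rule integral_cong_AE)
      show "AE \<tau> in levy_measure s. indicator {0<..<\<rho>} \<tau> * G \<xi> \<tau> + indicator {\<rho><..} \<tau> * G \<xi> \<tau> = G \<xi> \<tau>"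
        using AE_levy_measure_pos AE_levy_measure_neq[where a = \<rho>]
        by eventually_elim (auto simp: indicator_def)
      show "(\<lambda>\<tau>. indicator {0<..<\<rho>} \<tau> * G \<xi> \<tau> + indicator {\<rho><..} \<tau> * G \<xi> \<tau>) \<in> borel_measurable (levy_measure s)"
        using int by (intro borel_measurable_add borel_measurable_integrable) auto
    qed (use G_int in auto)
    finally have sum: "(\<integral>\<tau>. indicator {0<..<\<rho>} \<tau> * G \<xi> \<tau> \<partial>levy_measure s)
        + (\<integral>\<tau>. indicator {\<rho><..} \<tau> * G \<xi> \<tau> \<partial>levy_measure s) = trunc_op s c \<rho>' u x \<xi>"
      by (simp add: trunc_op_def G_def[abs_def])
    show ?thesis
      unfolding w_def
      by (subst (1 2) ext_integral_levy) (use \<rho> int G_meas sum in auto)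
  qed
  have outer: "ext_integral {\<rho><..} (\<lambda>\<tau>. second_diff u x (\<tau> *\<^sub>R \<xi>) / w \<tau>) = ext_integral {\<rho><..} (\<lambda>\<tau>. G \<xi> \<tau> / w \<tau>)" for \<xi>
    using \<rho> by (intro antisym ext_integral_mono) (auto simp: G_def)
  define E where "E B = (\<Sum>\<xi>\<in>B. ext_integral {0<..<\<rho>} (\<lambda>\<tau>. second_diff \<phi> x (\<tau> *\<^sub>R \<xi>) / w \<tau>)
      + ext_integral {\<rho><..} (\<lambda>\<tau>. second_diff u x (\<tau> *\<^sub>R \<xi>) / w \<tau>))" for B
  have tv: "test_value (if upper then Sup else Inf) s k u \<phi> \<rho> x =
      ereal (frac_const s) * (if upper then Sup else Inf) (E ` orthonormal_sets k)"
    unfolding test_value_def E_def w_def by simp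
  have C: "0 \<le> ereal (frac_const s)"
    using frac_const_pos[OF s] by simp
  have T: "T = ereal (frac_const s) * (if upper then Sup else Inf) ((\<lambda>B. ereal (sum (trunc_op s c \<rho>' u x) B)) ` orthonormal_sets k)"
    unfolding T_def ereal_extremum[OF k bounded_trunc_op[OF s \<rho>(1) u]] by simp
  have sum_eq: "ereal (sum (trunc_op s c \<rho>' u x) B) = (\<Sum>\<xi>\<in>B. ext_integral {0<..<\<rho>} (\<lambda>\<tau>. G \<xi> \<tau> / w \<tau>)
      + ext_integral {\<rho><..} (\<lambda>\<tau>. G \<xi> \<tau> / w \<tau>))" for B
    unfolding split by simp
  {
    assume le: "\<And>\<tau> \<xi>. norm \<xi> = 1 \<Longrightarrow> 0 < \<tau> \<Longrightarrow> \<tau> < \<rho> \<Longrightarrow>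
         (if \<tau> < \<rho>' then 2 * c * \<tau>\<^sup>2 else second_diff u x (\<tau> *\<^sub>R \<xi>)) \<le> second_diff \<phi> x (\<tau> *\<^sub>R \<xi>)"
    have "ereal (sum (trunc_op s c \<rho>' u x) B) \<le> E B" if "B \<in> orthonormal_sets k" for B
      unfolding sum_eq E_def outer
      by (intro sum_mono add_mono order_refl ext_integral_mono divide_right_mono w)
        (use le that in \<open>auto simp: G_def orthonormal_sets_def\<close>)
    then show "T \<le> test_value (if upper then Sup else Inf) s k u \<phi> \<rho> x"
      unfolding T tv by (intro ereal_mult_left_mono extremum_ereal_mono C)
  next
    assume le: "\<And>\<tau> \<xi>. norm \<xi> = 1 \<Longrightarrow> 0 < \<tau> \<Longrightarrow> \<tau> < \<rho> \<Longrightarrow>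
         second_diff \<phi> x (\<tau> *\<^sub>R \<xi>) \<le> (if \<tau> < \<rho>' then 2 * c * \<tau>\<^sup>2 else second_diff u x (\<tau> *\<^sub>R \<xi>))"
    have "E B \<le> ereal (sum (trunc_op s c \<rho>' u x) B)" if "B \<in> orthonormal_sets k" for B
      unfolding sum_eq E_def outer
      by (intro sum_mono add_mono order_refl ext_integral_mono divide_right_mono w)
        (use le that in \<open>auto simp: G_def orthonormal_sets_def\<close>)
    then show "test_value (if upper then Sup else Inf) s k u \<phi> \<rho> x \<le> T"
      unfolding T tv by (intro ereal_mult_left_mono extremum_ereal_mono C)
  }
qed

lemma trunc_op_minus: "trunc_op s c \<rho> (\<lambda>z. - u z) x \<xi> = - trunc_op s (- c) \<rho> u x \<xi>"
proof -
  have "trunc_op s c \<rho> (\<lambda>z. - u z) x \<xi> =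
    (\<integral>\<tau>. - (if \<tau> < \<rho> then 2 * (- c) * \<tau>\<^sup>2 else second_diff u x (\<tau> *\<^sub>R \<xi>)) \<partial>levy_measure s)"
    unfolding trunc_op_def second_diff_minus by (intro Bochner_Integration.integral_cong) auto
  then show ?thesis
    by (simp add: trunc_op_def)
qed

lemma test_value_quadratic:
  fixes u :: "'a::euclidean_space \<Rightarrow> real" and upper :: bool
  assumes "0 < s" "s < 1" "k \<le> DIM('a)" "0 < \<rho>"
    and "u \<in> borel_measurable borel" "\<And>z. \<bar>u z\<bar> \<le> M"
  shows "test_value (if upper then Sup else Inf) s k u (\<lambda>y. p \<bullet> (y - x) + c * (norm (y - x))\<^sup>2) \<rho> x
    = ereal (frac_const s * extremum upper k (trunc_op s c \<rho> u x))"
  by (rule antisym; rule test_value_upper test_value_lower)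
    (use assms in \<open>auto simp: second_diff_quadratic\<close>)

section \<open>Paraboloids as test functions and as bounds for test functions\<close>

lemma C2_on_quadratic:
  fixes x p :: "'a::euclidean_space"
  shows "C2_on S (\<lambda>y. p \<bullet> (y - x) + c * (norm (y - x))\<^sup>2)"
proof -
  define D where "D y = blinfun_inner_right (p + (2 * c) *\<^sub>R (y - x))" for y
  have lin: "bounded_linear (\<lambda>v :: 'a. blinfun_inner_right ((2 * c) *\<^sub>R v))"
    by (rule bounded_linear_compose[OF bounded_linear_blinfun_inner_right bounded_linear_scaleR_right])
  have "((\<lambda>y. p \<bullet> (y - x) + c * (norm (y - x))\<^sup>2) has_derivative blinfun_apply (D y)) (at y)" for y
    unfolding D_def power2_norm_eq_inner
    by (auto intro!: derivative_eq_intros simp: fun_eq_iff inner_add_left inner_diff inner_commute algebra_simps)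
  moreover have "(D has_derivative blinfun_apply (Blinfun (\<lambda>v. blinfun_inner_right ((2 * c) *\<^sub>R v)))) (at y)" for y
    unfolding D_def bounded_linear_Blinfun_apply[OF lin]
    by (rule bounded_linear.has_derivative[OF bounded_linear_blinfun_inner_right])
      (auto intro!: derivative_eq_intros simp: scaleR_diff_right)
  ultimately show ?thesis
    unfolding C2_on_def
    by (intro exI[of _ D] exI[of _ "\<lambda>_. Blinfun (\<lambda>v. blinfun_inner_right ((2 * c) *\<^sub>R v))"]
        conjI ballI continuous_on_const)
qed

text \<open>Differentiability of \<open>D\<close> at \<open>x\<close> bounds
  \<open>D y - D x\<close> by a multiple of the distance; the mean value inequality along the
  segment from \<open>x\<close> to \<open>y\<close>, applied after removal of the linear part,
  supplies the second factor.\<close>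

lemma C2_on_quadratic_bound:
  fixes \<phi> :: "'a::euclidean_space \<Rightarrow> real"
  assumes "C2_on (ball x \<rho>) \<phi>" "0 < \<rho>"
  obtains p c r where "0 \<le> c" "0 < r" "r \<le> \<rho>"
    "\<And>y. y \<in> ball x r \<Longrightarrow> \<bar>\<phi> y - \<phi> x - p \<bullet> (y - x)\<bar> \<le> c * (norm (y - x))\<^sup>2"
proof -
  obtain D :: "'a \<Rightarrow> 'a \<Rightarrow>\<^sub>L real" and H :: "'a \<Rightarrow> 'a \<Rightarrow>\<^sub>L 'a \<Rightarrow>\<^sub>L real" where
    D: "\<And>y. y \<in> ball x \<rho> \<Longrightarrow> (\<phi> has_derivative blinfun_apply (D y)) (at y)"
    and H: "\<And>y. y \<in> ball x \<rho> \<Longrightarrow> (D has_derivative blinfun_apply (H y)) (at y)"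
    using assms(1) unfolding C2_on_def by blast
  \<comment> \<open>The summand 1 is the tolerance used in the differentiability of \<open>D\<close>
    at \<open>x\<close>.\<close>
  define c where "c = norm (H x) + 1"
  have "\<exists>d>0. \<forall>y. norm (y - x) < d \<longrightarrow> norm (D y - D x - H x (y - x)) \<le> 1 * norm (y - x)"
    using H[of x] assms(2) unfolding has_derivative_at_alt by (metis centre_in_ball zero_less_one)
  then obtain d where d: "0 < d"
    "\<And>y. norm (y - x) < d \<Longrightarrow> norm (D y - D x - H x (y - x)) \<le> norm (y - x)" by auto
  define r where "r = min d \<rho>"
  have lip: "norm (D y - D x) \<le> c * norm (y - x)" if "norm (y - x) < d" for y
  proof -
    have "norm (D y - D x) \<le> norm (D y - D x - H x (y - x)) + norm (H x (y - x))"
      using norm_triangle_ineq[of "D y - D x - H x (y - x)" "H x (y - x)"] by simp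
    also have "\<dots> \<le> norm (y - x) + norm (H x) * norm (y - x)"
      using d(2)[OF that] norm_blinfun[of "H x" "y - x"] by linarith
    finally show ?thesis by (simp add: c_def algebra_simps)
  qed
  have bound: "\<bar>\<phi> y - \<phi> x - D x (y - x)\<bar> \<le> c * (norm (y - x))\<^sup>2" if y: "y \<in> ball x r" for y
  proof -
    define g where "g z = \<phi> z - D x (z - x)" for z
    have seg: "norm (z - x) \<le> norm (y - x)" if "z \<in> closed_segment x y" for z
      using segment_bound1[OF that] .
    have ny: "norm (y - x) < d" "norm (y - x) < \<rho>"
      using y by (auto simp: r_def dist_norm norm_minus_commute)
    have "norm (g y - g x) \<le> (c * norm (y - x)) * norm (y - x)"
    proof (rule differentiable_bound[where S = "closed_segment x y" and f' = "\<lambda>z. blinfun_apply (D z - D x)"])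
      fix z assume z: "z \<in> closed_segment x y"
      have "z \<in> ball x \<rho>"
        using seg[OF z] ny by (simp add: dist_norm norm_minus_commute)
      then have "(g has_derivative (\<lambda>v. D z v - D x v)) (at z)"
        unfolding g_def
        by (auto intro!: derivative_eq_intros D)
      then have "(g has_derivative blinfun_apply (D z - D x)) (at z)"
        by (simp add: blinfun.diff_left[abs_def])
      then show "(g has_derivative blinfun_apply (D z - D x)) (at z within closed_segment x y)"
        by (rule has_derivative_at_withinI)
      have "norm (D z - D x) \<le> c * norm (z - x)"
        using lip seg[OF z] ny by simp
      also have "\<dots> \<le> c * norm (y - x)"
        using seg[OF z] by (intro mult_left_mono) (auto simp: c_def)
      finally show "onorm (blinfun_apply (D z - D x)) \<le> c * norm (y - x)"
        by (simp add: norm_blinfun.rep_eq)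
    qed auto
    then show ?thesis
      by (simp add: g_def power2_eq_square algebra_simps blinfun.zero_right)
  qed
  \<comment> \<open>The vector that represents the functional \<open>D x\<close> through the inner
    product.\<close>
  define p where "p = adjoint (blinfun_apply (D x)) 1"
  have p: "D x v = p \<bullet> v" for v
    using adjoint_works[of "blinfun_apply (D x)" v 1]
    by (simp add: p_def inner_commute bounded_linear.linear[OF blinfun.bounded_linear_right])
  show thesis
    by (rule that[of c r p]) (use bound p d(1) assms(2) in \<open>auto simp: c_def r_def\<close>)
qed

section \<open>The Dirichlet problem\<close>

text \<open>A paraboloid is itself an admissible test function, and its test value is finite and
  equals the extremum of \<open>trunc_op\<close> up to the normalizing constant.\<close>

lemma visc_subsolution_imp_quad:
  fixes u :: "'a::euclidean_space \<Rightarrow> real"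
  assumes s: "0 < s" "s < 1" and k: "k \<le> DIM('a)"
    and u: "visc_subsolution (if upper then Sup else Inf) s k \<Omega> f u"
  shows "quad_subsolution s k \<Omega> upper (\<lambda>x. f x / frac_const s) u"
  unfolding quad_subsolution_def
proof (intro ballI allI impI, elim conjE)
  fix x p c r \<rho>
  assume x: "x \<in> \<Omega>" and \<rho>: "0 < \<rho>" "\<rho> < r"
    and touch: "\<forall>y\<in>ball x r. u y \<le> u x + p \<bullet> (y - x) + c * (norm (y - x))\<^sup>2"
  obtain M where M: "\<And>z. \<bar>u z\<bar> \<le> M" and meas: "u \<in> borel_measurable borel"
    using u by (auto simp: visc_subsolution_def bounded_measurable_def bounded_iff)
  define \<phi> where "\<phi> y = p \<bullet> (y - x) + c * (norm (y - x))\<^sup>2" for y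
  have "C2_on (ball x \<rho>) \<phi>"
    unfolding \<phi>_def by (rule C2_on_quadratic)
  moreover have "\<forall>y\<in>ball x \<rho>. u y - \<phi> y \<le> u x - \<phi> x"
  proof
    fix y assume "y \<in> ball x \<rho>"
    then have "y \<in> ball x r" using \<rho> by auto
    then show "u y - \<phi> y \<le> u x - \<phi> x" using touch[rule_format, of y] by (simp add: \<phi>_def)
  qed
  ultimately have "ereal (f x) \<le> test_value (if upper then Sup else Inf) s k u \<phi> \<rho> x"
    using u x \<rho>(1) unfolding visc_subsolution_def by blast
  then have "f x \<le> frac_const s * extremum upper k (trunc_op s c \<rho> u x)"
    unfolding \<phi>_def[abs_def] test_value_quadratic[OF s k \<rho>(1) meas M] by simp
  then show "f x / frac_const s \<le> extremum upper k (trunc_op s c \<rho> u x)"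
    using frac_const_pos[OF s] by (simp add: divide_le_eq mult.commute)
qed

lemma visc_supersolution_imp_quad:
  fixes u :: "'a::euclidean_space \<Rightarrow> real"
  assumes s: "0 < s" "s < 1" and k: "k \<le> DIM('a)"
    and u: "visc_supersolution (if upper then Sup else Inf) s k \<Omega> f u"
  shows "quad_subsolution s k \<Omega> (\<not> upper) (\<lambda>x. - (f x / frac_const s)) (\<lambda>x. - u x)"
  unfolding quad_subsolution_def
proof (intro ballI allI impI, elim conjE)
  fix x p c r \<rho>
  assume x: "x \<in> \<Omega>" and \<rho>: "0 < \<rho>" "\<rho> < r"
    and touch: "\<forall>y\<in>ball x r. - u y \<le> - u x + p \<bullet> (y - x) + c * (norm (y - x))\<^sup>2"
  obtain M where M: "\<And>z. \<bar>u z\<bar> \<le> M" and meas: "u \<in> borel_measurable borel"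
    using u by (auto simp: visc_supersolution_def bounded_measurable_def bounded_iff)
  define \<phi> where "\<phi> y = (- p) \<bullet> (y - x) + (- c) * (norm (y - x))\<^sup>2" for y
  have "C2_on (ball x \<rho>) \<phi>"
    unfolding \<phi>_def by (rule C2_on_quadratic)
  moreover have "\<forall>y\<in>ball x \<rho>. u x - \<phi> x \<le> u y - \<phi> y"
  proof
    fix y assume "y \<in> ball x \<rho>"
    then have "y \<in> ball x r" using \<rho> by auto
    then show "u x - \<phi> x \<le> u y - \<phi> y" using touch[rule_format, of y] by (simp add: \<phi>_def)
  qed
  ultimately have "test_value (if upper then Sup else Inf) s k u \<phi> \<rho> x \<le> ereal (f x)"
    using u x \<rho>(1) unfolding visc_supersolution_def by blast
  then have "frac_const s * extremum upper k (trunc_op s (- c) \<rho> u x) \<le> f x"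
    unfolding \<phi>_def[abs_def] test_value_quadratic[OF s k \<rho>(1) meas M] by simp
  then have "extremum upper k (trunc_op s (- c) \<rho> u x) \<le> f x / frac_const s"
    using frac_const_pos[OF s] by (simp add: le_divide_eq mult.commute)
  moreover have "trunc_op s c \<rho> (\<lambda>x. - u x) x = (\<lambda>\<xi>. - trunc_op s (- c) \<rho> u x \<xi>)"
    by (simp add: fun_eq_iff trunc_op_minus)
  ultimately show "- (f x / frac_const s) \<le> extremum (\<not> upper) k (trunc_op s c \<rho> (\<lambda>x. - u x) x)"
    by (simp add: extremum_neg)
qed

text \<open>A contact paraboloid has opening \<open>c\<close>, while the test function is bounded on
  the other side only by the opening \<open>- c\<close>. Exchanging the two costs an amount that
  vanishes as \<open>\<rho>\<close> tends to 0.\<close>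

lemma extremum_trunc_op_shift:
  fixes u :: "'a::euclidean_space \<Rightarrow> real"
  assumes s: "0 < s" "s < 1" and k: "k \<le> DIM('a)" and \<rho>: "0 < \<rho>"
    and u: "u \<in> borel_measurable borel" "\<And>z. \<bar>u z\<bar> \<le> M"
  shows "extremum upper k (trunc_op s c \<rho> u x)
    \<le> extremum upper k (trunc_op s (- c) \<rho> u x) + real k * (4 * c * (\<rho> powr (2 - 2 * s) / (2 - 2 * s)))"
proof (rule extremum_mono[OF k bounded_trunc_op[OF s \<rho> u] bounded_trunc_op[OF s \<rho> u]])
  show "trunc_op s c \<rho> u x \<xi> \<le> trunc_op s (- c) \<rho> u x \<xi> + 4 * c * (\<rho> powr (2 - 2 * s) / (2 - 2 * s))" for \<xi>
    using trunc_op_shift[OF s \<rho> u, of "- c" "2 * c" x \<xi>] by simp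
qed

lemma powr_error_tendsto:
  assumes "0 < s" "s < (1::real)"
  shows "((\<lambda>\<rho>. a + b * (real k * (4 * c * (\<rho> powr (2 - 2 * s) / (2 - 2 * s))))) \<longlongrightarrow> a) (at_right 0)"
proof -
  have "((\<lambda>\<rho>. a + b * (real k * (4 * c * (\<rho> powr (2 - 2 * s) / (2 - 2 * s)))))
      \<longlongrightarrow> a + b * (real k * (4 * c * (0 / (2 - 2 * s))))) (at_right 0)"
    using assms
    by (intro tendsto_intros tendsto_zero_powrI[where b = "2 - 2 * s"]
        eventually_at_right_less[THEN eventually_mono]) auto
  then show ?thesis by simp
qed

lemma C2_second_diff_bound:
  fixes \<phi> :: "'a::euclidean_space \<Rightarrow> real"
  assumes "\<And>y. y \<in> ball x r \<Longrightarrow> \<bar>\<phi> y - \<phi> x - p \<bullet> (y - x)\<bar> \<le> c * (norm (y - x))\<^sup>2"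
    and "norm \<xi> = 1" "0 < \<tau>" "\<tau> < r"
  shows "\<bar>second_diff \<phi> x (\<tau> *\<^sub>R \<xi>)\<bar> \<le> 2 * c * \<tau>\<^sup>2"
proof -
  have "\<bar>\<phi> (x + \<tau> *\<^sub>R \<xi>) - \<phi> x - p \<bullet> (\<tau> *\<^sub>R \<xi>)\<bar> \<le> c * \<tau>\<^sup>2"
    "\<bar>\<phi> (x - \<tau> *\<^sub>R \<xi>) - \<phi> x + p \<bullet> (\<tau> *\<^sub>R \<xi>)\<bar> \<le> c * \<tau>\<^sup>2"
    using assms(1)[of "x + \<tau> *\<^sub>R \<xi>"] assms(1)[of "x - \<tau> *\<^sub>R \<xi>"] assms(2-4) by (simp_all add: dist_norm)
  then show ?thesis
    unfolding second_diff_def by linarith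
qed

text \<open>The contact paraboloid above \<open>u\<close> gives the inequality with opening
  \<open>c\<close> below \<open>\<rho>'\<close>. The test function is bounded below by the opening
  \<open>- c\<close> there and by \<open>u\<close> between \<open>\<rho>'\<close> and
  \<open>\<rho>\<close>, so its test value is at least the extremum with \<open>- c\<close>. The gap
  disappears as \<open>\<rho>'\<close> tends to 0; since only a lower bound is used, an infinite
  test value is harmless.\<close>

lemma quad_imp_visc_subsolution:
  fixes u :: "'a::euclidean_space \<Rightarrow> real"
  assumes s: "0 < s" "s < 1" and k: "k \<le> DIM('a)"
    and u: "continuous_on UNIV u" "bounded (range u)"
    and quad: "quad_subsolution s k \<Omega> upper (\<lambda>x. f x / frac_const s) u"
  shows "visc_subsolution (if upper then Sup else Inf) s k \<Omega> f u"
  unfolding visc_subsolution_def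
proof (intro conjI ballI allI impI)
  have meas: "u \<in> borel_measurable borel"
    using u(1) by (rule borel_measurable_continuous_onI)
  then show "bounded_measurable u"
    using u(2) by (simp add: bounded_measurable_def)
  have "openin (top_of_set \<Omega>) (\<Omega> \<inter> {x. u x < c})" for c
    using open_Collect_less[OF u(1) continuous_on_const] by blast
  then show "usc_on \<Omega> u"
    by (simp add: usc_on_def Int_def)
  obtain M where M: "\<And>z. \<bar>u z\<bar> \<le> M" using u(2) by (auto simp: bounded_iff)
  have C: "0 < frac_const s" using frac_const_pos[OF s] .
  fix x \<rho> \<phi>
  assume x: "x \<in> \<Omega>" and \<rho>: "(0::real) < \<rho>"
    and \<phi>: "C2_on (ball x \<rho>) \<phi> \<and> (\<forall>y\<in>ball x \<rho>. u y - \<phi> y \<le> u x - \<phi> x)"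
  obtain p c r where c: "0 \<le> c" and r: "0 < r" "r \<le> \<rho>"
    and quad_bound: "\<And>y. y \<in> ball x r \<Longrightarrow> \<bar>\<phi> y - \<phi> x - p \<bullet> (y - x)\<bar> \<le> c * (norm (y - x))\<^sup>2"
    using C2_on_quadratic_bound[of x \<rho> \<phi>] \<phi> \<rho> by metis
  let ?tv = "test_value (if upper then Sup else Inf) s k u \<phi> \<rho> x"
  have "ereal (f x + (- frac_const s) * (real k * (4 * c * (\<rho>' powr (2 - 2 * s) / (2 - 2 * s))))) \<le> ?tv"
    if \<rho>': "0 < \<rho>'" "\<rho>' < r" for \<rho>'
  proof -
    have "f x / frac_const s \<le> extremum upper k (trunc_op s c \<rho>' u x)"
    proof (rule quad_subsolutionD[OF quad x c \<rho>'])
      fix y assume y: "y \<in> ball x r"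
      then have "u y - \<phi> y \<le> u x - \<phi> x" using \<phi> r(2) by auto
      then show "u y \<le> u x + p \<bullet> (y - x) + c * (norm (y - x))\<^sup>2"
        using quad_bound[OF y] by linarith
    qed
    also have "\<dots> \<le> extremum upper k (trunc_op s (- c) \<rho>' u x)
        + real k * (4 * c * (\<rho>' powr (2 - 2 * s) / (2 - 2 * s)))"
      by (rule extremum_trunc_op_shift[OF s k \<rho>'(1) meas M])
    finally have "f x + (- frac_const s) * (real k * (4 * c * (\<rho>' powr (2 - 2 * s) / (2 - 2 * s))))
        \<le> frac_const s * extremum upper k (trunc_op s (- c) \<rho>' u x)"
      using C by (simp add: divide_le_eq distrib_left mult.commute)
    also have "ereal \<dots> \<le> ?tv"
    proof (rule test_value_lower[OF s k \<rho>'(1) _ meas M])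
      show "\<rho>' \<le> \<rho>" using \<rho>' r by simp
      fix \<tau> and \<xi> :: 'a assume \<tau>: "norm \<xi> = 1" "0 < \<tau>" "\<tau> < \<rho>"
      have "u (x + \<tau> *\<^sub>R \<xi>) - \<phi> (x + \<tau> *\<^sub>R \<xi>) \<le> u x - \<phi> x" "u (x - \<tau> *\<^sub>R \<xi>) - \<phi> (x - \<tau> *\<^sub>R \<xi>) \<le> u x - \<phi> x"
        using conjunct2[OF \<phi>] \<tau> by (simp_all add: dist_norm)
      then have "second_diff u x (\<tau> *\<^sub>R \<xi>) \<le> second_diff \<phi> x (\<tau> *\<^sub>R \<xi>)"
        unfolding second_diff_def by linarith
      moreover have "- (2 * c * \<tau>\<^sup>2) \<le> second_diff \<phi> x (\<tau> *\<^sub>R \<xi>)" if "\<tau> < \<rho>'"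
        using C2_second_diff_bound[where r = r, OF quad_bound \<tau>(1,2)] that \<rho>' by (simp add: abs_le_iff)
      ultimately show "(if \<tau> < \<rho>' then 2 * - c * \<tau>\<^sup>2 else second_diff u x (\<tau> *\<^sub>R \<xi>)) \<le> second_diff \<phi> x (\<tau> *\<^sub>R \<xi>)"
        by simp
    qed
    finally show ?thesis by simp
  qed
  then have ev: "\<forall>\<^sub>F \<rho>' in at_right 0.
      ereal (f x + (- frac_const s) * (real k * (4 * c * (\<rho>' powr (2 - 2 * s) / (2 - 2 * s))))) \<le> ?tv"
    using r(1) by (auto simp: eventually_at_right[OF r(1)] intro!: exI[of _ r])
  show "ereal (f x) \<le> ?tv"
    by (rule tendsto_upperbound[OF tendsto_ereal[OF powr_error_tendsto[OF s]] ev]) simp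
qed

text \<open>The mirror image: contact from below for \<open>u\<close> is contact from above for
  \<open>- u\<close>, which turns the opening \<open>c\<close> for \<open>- u\<close> into
  \<open>- c\<close> for \<open>u\<close>, while the test function is now bounded above by
  \<open>c\<close>.\<close>

lemma quad_imp_visc_supersolution:
  fixes u :: "'a::euclidean_space \<Rightarrow> real"
  assumes s: "0 < s" "s < 1" and k: "k \<le> DIM('a)"
    and u: "continuous_on UNIV u" "bounded (range u)"
    and quad: "quad_subsolution s k \<Omega> (\<not> upper) (\<lambda>x. - (f x / frac_const s)) (\<lambda>x. - u x)"
  shows "visc_supersolution (if upper then Sup else Inf) s k \<Omega> f u"
  unfolding visc_supersolution_def
proof (intro conjI ballI allI impI)
  have meas: "u \<in> borel_measurable borel"
    using u(1) by (rule borel_measurable_continuous_onI)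
  then show "bounded_measurable u"
    using u(2) by (simp add: bounded_measurable_def)
  have "openin (top_of_set \<Omega>) (\<Omega> \<inter> {x. c < u x})" for c
    using open_Collect_less[OF continuous_on_const u(1)] by blast
  then show "lsc_on \<Omega> u"
    by (simp add: lsc_on_def Int_def)
  obtain M where M: "\<And>z. \<bar>u z\<bar> \<le> M" using u(2) by (auto simp: bounded_iff)
  have C: "0 < frac_const s" using frac_const_pos[OF s] .
  fix x \<rho> \<phi>
  assume x: "x \<in> \<Omega>" and \<rho>: "(0::real) < \<rho>"
    and \<phi>: "C2_on (ball x \<rho>) \<phi> \<and> (\<forall>y\<in>ball x \<rho>. u x - \<phi> x \<le> u y - \<phi> y)"
  obtain p c r where c: "0 \<le> c" and r: "0 < r" "r \<le> \<rho>"
    and quad_bound: "\<And>y. y \<in> ball x r \<Longrightarrow> \<bar>\<phi> y - \<phi> x - p \<bullet> (y - x)\<bar> \<le> c * (norm (y - x))\<^sup>2"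
    using C2_on_quadratic_bound[of x \<rho> \<phi>] \<phi> \<rho> by metis
  let ?tv = "test_value (if upper then Sup else Inf) s k u \<phi> \<rho> x"
  have "?tv \<le> ereal (f x + frac_const s * (real k * (4 * c * (\<rho>' powr (2 - 2 * s) / (2 - 2 * s)))))"
    if \<rho>': "0 < \<rho>'" "\<rho>' < r" for \<rho>'
  proof -
    have "?tv \<le> ereal (frac_const s * extremum upper k (trunc_op s c \<rho>' u x))"
    proof (rule test_value_upper[OF s k \<rho>'(1) _ meas M])
      show "\<rho>' \<le> \<rho>" using \<rho>' r by simp
      fix \<tau> and \<xi> :: 'a assume \<tau>: "norm \<xi> = 1" "0 < \<tau>" "\<tau> < \<rho>"
      have "u x - \<phi> x \<le> u (x + \<tau> *\<^sub>R \<xi>) - \<phi> (x + \<tau> *\<^sub>R \<xi>)" "u x - \<phi> x \<le> u (x - \<tau> *\<^sub>R \<xi>) - \<phi> (x - \<tau> *\<^sub>R \<xi>)"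
        using conjunct2[OF \<phi>] \<tau> by (simp_all add: dist_norm)
      then have "second_diff \<phi> x (\<tau> *\<^sub>R \<xi>) \<le> second_diff u x (\<tau> *\<^sub>R \<xi>)"
        unfolding second_diff_def by linarith
      moreover have "second_diff \<phi> x (\<tau> *\<^sub>R \<xi>) \<le> 2 * c * \<tau>\<^sup>2" if "\<tau> < \<rho>'"
        using C2_second_diff_bound[where r = r, OF quad_bound \<tau>(1,2)] that \<rho>' by (simp add: abs_le_iff)
      ultimately show "second_diff \<phi> x (\<tau> *\<^sub>R \<xi>) \<le> (if \<tau> < \<rho>' then 2 * c * \<tau>\<^sup>2 else second_diff u x (\<tau> *\<^sub>R \<xi>))"
        by simp
    qed
    also have "frac_const s * extremum upper k (trunc_op s c \<rho>' u x)
        \<le> f x + frac_const s * (real k * (4 * c * (\<rho>' powr (2 - 2 * s) / (2 - 2 * s))))"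
    proof -
      have "- (f x / frac_const s) \<le> extremum (\<not> upper) k (trunc_op s c \<rho>' (\<lambda>x. - u x) x)"
      proof (rule quad_subsolutionD[OF quad x c \<rho>'])
        fix y assume y: "y \<in> ball x r"
        then have "u x - \<phi> x \<le> u y - \<phi> y" using \<phi> r(2) by auto
        then show "- u y \<le> - u x + (- p) \<bullet> (y - x) + c * (norm (y - x))\<^sup>2"
          using quad_bound[OF y] by simp
      qed
      also have "trunc_op s c \<rho>' (\<lambda>x. - u x) x = (\<lambda>\<xi>. - trunc_op s (- c) \<rho>' u x \<xi>)"
        by (simp add: fun_eq_iff trunc_op_minus)
      finally have "extremum upper k (trunc_op s (- c) \<rho>' u x) \<le> f x / frac_const s"
        by (simp add: extremum_neg)
      then have "extremum upper k (trunc_op s c \<rho>' u x)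
          \<le> f x / frac_const s + real k * (4 * c * (\<rho>' powr (2 - 2 * s) / (2 - 2 * s)))"
        using extremum_trunc_op_shift[OF s k \<rho>'(1) meas M, of upper c x] by linarith
      then have "frac_const s * extremum upper k (trunc_op s c \<rho>' u x)
          \<le> frac_const s * (f x / frac_const s + real k * (4 * c * (\<rho>' powr (2 - 2 * s) / (2 - 2 * s))))"
        using C by (intro mult_left_mono) auto
      then show ?thesis
        using C by (simp add: distrib_left)
    qed
    finally show ?thesis by simp
  qed
  then have ev: "\<forall>\<^sub>F \<rho>' in at_right 0.
      ?tv \<le> ereal (f x + frac_const s * (real k * (4 * c * (\<rho>' powr (2 - 2 * s) / (2 - 2 * s)))))"
    using r(1) by (auto simp: eventually_at_right[OF r(1)] intro!: exI[of _ r])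
  show "?tv \<le> ereal (f x)"
    by (rule tendsto_lowerbound[OF tendsto_ereal[OF powr_error_tendsto[OF s]] ev]) simp
qed

section \<open>Uniqueness and existence for the Dirichlet problem\<close>

lemma usc_on_dual_imp_continuous:
  fixes u :: "'a::topological_space \<Rightarrow> real"
  assumes "usc_on UNIV u" "usc_on UNIV (\<lambda>x. - u x)"
  shows "continuous_on UNIV u"
  unfolding continuous_on_def
proof (intro ballI order_tendstoI)
  fix x a
  show "\<forall>\<^sub>F y in at x. u y < a" if "u x < a"
    using usc_onD[OF assms(1), of a] that by (auto simp: eventually_at_topological)
  show "\<forall>\<^sub>F y in at x. a < u y" if "a < u x"
    using usc_onD[OF assms(2), of "- a"] that by (auto simp: eventually_at_topological)
qed

lemma dirichlet_problem_le:
  fixes u v :: "'a::euclidean_space \<Rightarrow> real"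
  assumes s: "0 < s" "s < 1" and k: "1 \<le> k" "k \<le> DIM('a)"
    and \<Omega>: "open \<Omega>" "bounded \<Omega>" and f: "continuous_on \<Omega> f"
    and u: "visc_solution (if upper then Sup else Inf) s k \<Omega> f u" "\<And>x. x \<notin> \<Omega> \<Longrightarrow> u x = 0"
    and v: "visc_solution (if upper then Sup else Inf) s k \<Omega> f v" "\<And>x. x \<notin> \<Omega> \<Longrightarrow> v x = 0"
  shows "u x \<le> v x"
proof -
  have cont: "continuous_on UNIV u" "continuous_on UNIV v"
    and bdd: "bounded (range u)" "bounded (range v)"
    and sub: "visc_subsolution (if upper then Sup else Inf) s k \<Omega> f u"
    and super: "visc_supersolution (if upper then Sup else Inf) s k \<Omega> f v"
    using u(1) v(1) by (auto simp: visc_solution_def visc_subsolution_def bounded_measurable_def)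
  have "u x + - v x \<le> 0"
  proof (rule quad_comparison[OF s k \<Omega> _ _ _ _ visc_subsolution_imp_quad[OF s k(2) sub] _ _ _
        visc_supersolution_imp_quad[OF s k(2) super]])
    show "continuous_on \<Omega> (\<lambda>x. f x / frac_const s)"
      using f frac_const_pos[OF s] by (intro continuous_intros) auto
    show "usc_on UNIV u" "usc_on UNIV (\<lambda>x. - v x)"
      using cont by (auto intro!: continuous_on_imp_usc_on continuous_intros)
    show "bounded (range (\<lambda>x. - v x))"
      using bdd(2) by (auto simp: bounded_iff)
  qed (use bdd u(2) v(2) in auto)
  then show ?thesis by simp
qed

theorem dirichlet_problem_solvable:
  fixes \<Omega> :: "'a::euclidean_space set"
  assumes s: "0 < s" "s < 1" and k: "1 \<le> k" "k \<le> DIM('a)"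
    and \<Omega>: "uniformly_convex_domain \<Omega>" and f: "continuous_on \<Omega> f" "bounded (f ` \<Omega>)"
  obtains u where "visc_solution (if upper then Sup else Inf) s k \<Omega> f u" "\<And>x. x \<notin> \<Omega> \<Longrightarrow> u x = 0"
proof -
  have op: "open \<Omega>" "bounded \<Omega>"
    using \<Omega> by (auto simp: uniformly_convex_domain_def)
  have C: "0 < frac_const s" using frac_const_pos[OF s] .
  define F where "F x = f x / frac_const s" for x
  have F: "continuous_on \<Omega> F"
    unfolding F_def using f(1) C by (intro continuous_intros) auto
  obtain K where K: "0 < K" "\<And>x. x \<in> \<Omega> \<Longrightarrow> \<bar>f x\<bar> \<le> K"
    using f(2) by (auto simp: bounded_pos)
  obtain W0 c where W0: "continuous_on UNIV W0" "bounded (range W0)" "\<And>x. 0 \<le> W0 x" "\<And>x. x \<notin> \<Omega> \<Longrightarrow> W0 x = 0"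
    and c: "0 < c"
    and barrier0: "\<And>x h \<xi>. 0 < h \<Longrightarrow> ball x h \<subseteq> \<Omega> \<Longrightarrow> norm \<xi> = 1 \<Longrightarrow> step_op s h W0 x \<xi> \<le> - c"
    using uniformly_convex_barrier[OF s \<Omega>] by metis
  \<comment> \<open>The scale at which the barrier dominates the right-hand side already in one
    direction; \<open>1 \<le> k\<close> then gives the bound \<open>real k * (a * c)\<close> that
    the scheme asks for.\<close>
  define a where "a = K / frac_const s / c"
  have a: "0 < a" "a * c = K / frac_const s"
    using K C c by (auto simp: a_def)
  define W where "W x = a * W0 x" for x
  have W: "continuous_on UNIV W" "bounded (range W)" "\<And>x. 0 \<le> W x" "\<And>x. x \<notin> \<Omega> \<Longrightarrow> W x = 0"
    using W0 a(1) bounded_scaling[OF W0(2), of a]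
    by (auto simp: W_def image_image intro!: continuous_intros)
  have barrier: "step_op s h W x \<xi> \<le> - (a * c)" if "0 < h" "ball x h \<subseteq> \<Omega>" "norm \<xi> = 1" for x h \<xi>
    using mult_left_mono[OF barrier0[OF that], of a] a(1) unfolding W_def step_op_cmult by simp
  have F_le: "\<bar>F x\<bar> \<le> real k * (a * c)" if "x \<in> \<Omega>" for x
  proof -
    have "\<bar>F x\<bar> \<le> 1 * (a * c)"
      using K(2)[OF that] C by (simp add: F_def a(2) abs_divide divide_right_mono)
    also have "\<dots> \<le> real k * (a * c)"
      using k(1) a(1) c by (intro mult_right_mono) auto
    finally show ?thesis .
  qed
  have "\<forall>n. \<exists>u. (\<forall>x. \<bar>u x\<bar> \<le> W x) \<and> (\<forall>x. ball x (inverse (real (Suc n))) \<subseteq> \<Omega> \<longrightarrow>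
      extremum upper k (step_op s (inverse (real (Suc n))) u x) = F x)"
  proof
    fix n
    define h where "h = inverse (real (Suc n))"
    have h: "0 < h" by (simp add: h_def)
    obtain u where "\<And>x. \<bar>u x\<bar> \<le> W x" "\<And>x. ball x h \<subseteq> \<Omega> \<Longrightarrow> extremum upper k (step_op s h u x) = F x"
      by (rule step_scheme_solvable[OF s k h W(2,3), of \<Omega> "a * c" F upper]) (use barrier h F_le in auto)
    then show "\<exists>u. (\<forall>x. \<bar>u x\<bar> \<le> W x) \<and> (\<forall>x. ball x (inverse (real (Suc n))) \<subseteq> \<Omega> \<longrightarrow>
        extremum upper k (step_op s (inverse (real (Suc n))) u x) = F x)"
      unfolding h_def by blast
  qed
  from choice[OF this] obtain u where u: "\<And>n x. \<bar>u n x\<bar> \<le> W x"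
    and eq: "\<And>n x. ball x (inverse (real (Suc n))) \<subseteq> \<Omega> \<Longrightarrow>
      extremum upper k (step_op s (inverse (real (Suc n))) (u n) x) = F x"
    by blast
  obtain M where M: "\<And>x. W x \<le> M"
    using W(2) by (auto simp: bounded_iff abs_le_iff)
  have uM: "\<bar>u n x\<bar> \<le> M" for n x
    using u M order_trans by blast
  have uM': "\<bar>- u n x\<bar> \<le> M" for n x
    using uM by simp
  define U V where "U = upper_limit u" and "V = upper_limit (\<lambda>n x. - u n x)"
  have U_sub: "quad_subsolution s k \<Omega> upper F U"
    unfolding U_def using eq by (intro upper_limit_quad_subsolution[OF s k(2) op(1) F uM]) simp
  have V_sub: "quad_subsolution s k \<Omega> (\<not> upper) (\<lambda>x. - F x) V"
    unfolding V_def
  proof (rule upper_limit_quad_subsolution[OF s k(2) op(1) continuous_on_minus[OF F] uM'])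
    fix n x assume x: "ball x (inverse (real (Suc n))) \<subseteq> \<Omega>"
    have "step_op s (inverse (real (Suc n))) (\<lambda>x. - u n x) x =
        (\<lambda>\<xi>. - step_op s (inverse (real (Suc n))) (u n) x \<xi>)"
      by (rule ext) (rule step_op_minus)
    then show "- F x \<le> extremum (\<not> upper) k (step_op s (inverse (real (Suc n))) (\<lambda>x. - u n x) x)"
      using eq[OF x] by (simp add: extremum_neg)
  qed
  have usc: "usc_on UNIV U" "usc_on UNIV V"
    unfolding U_def V_def using usc_on_upper_limit[where u = u, OF uM] usc_on_upper_limit[where u = "\<lambda>n x. - u n x", OF uM'] by auto
  have bdd: "bounded (range U)" "bounded (range V)"
    unfolding U_def V_def
    using abs_upper_limit_le[where u = u, OF uM] abs_upper_limit_le[where u = "\<lambda>n x. - u n x", OF uM']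
    by (auto simp: bounded_iff)
  have "u n y \<le> W y" "- u n y \<le> W y" for n y
    using u[of n y] by auto
  then have le_W: "U x \<le> W x" "V x \<le> W x" for x
    unfolding U_def V_def
    using upper_limit_le_continuous[where u = u, OF uM W(1)]
      upper_limit_le_continuous[where u = "\<lambda>n x. - u n x", OF uM' W(1)] by auto
  have "U x + V x \<le> 0" for x
    using le_W W(4) by (intro quad_comparison[OF s k op F usc(1) bdd(1) _ U_sub usc(2) bdd(2) _ V_sub]) metis+
  moreover have "0 \<le> U x + V x" for x
    unfolding U_def V_def by (rule upper_limit_dual[OF uM])
  \<comment> \<open>The half-relaxed lower limit is \<open>- V\<close>, so both half-relaxed limits
    coincide; \<open>U\<close> and its negative are then upper semicontinuous, whence
    continuity.\<close>
  ultimately have V_eq: "V = (\<lambda>x. - U x)"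
    by (auto simp: fun_eq_iff intro!: antisym) (smt (verit))+
  have cont: "continuous_on UNIV U"
    using usc unfolding V_eq by (rule usc_on_dual_imp_continuous)
  show thesis
  proof (rule that)
    show "visc_solution (if upper then Sup else Inf) s k \<Omega> f U"
      unfolding visc_solution_def
      using cont quad_imp_visc_subsolution[OF s k(2) cont bdd(1) U_sub[unfolded F_def]]
        quad_imp_visc_supersolution[OF s k(2) cont bdd(1) V_sub[unfolded F_def V_eq]] by blast
    show "U x = 0" if "x \<notin> \<Omega>" for x
      using le_W[of x] W(4)[OF that] by (simp add: V_eq)
  qed
qed

theorem theorem5p5:
  fixes \<Omega> :: "(real ^ 'n) set" and f :: "real ^ 'n \<Rightarrow> real"
    and s :: real and k :: nat and ext :: "ereal set \<Rightarrow> ereal"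
  assumes "0 < s" and "s < 1"
    and "uniformly_convex_domain \<Omega>"
    and "continuous_on \<Omega> f" and "bounded (f ` \<Omega>)"
    and "1 \<le> k" and "k \<le> CARD('n)"
    and "ext = Sup \<or> ext = Inf"
  shows "\<exists>!u :: real ^ 'n \<Rightarrow> real.
           continuous_on UNIV u \<and> visc_solution ext s k \<Omega> f u \<and> (\<forall>x. x \<notin> \<Omega> \<longrightarrow> u x = 0)"
proof -
  define upper where "upper \<longleftrightarrow> ext = Sup"
  have ext: "ext = (if upper then Sup else Inf)"
    using assms(8) by (auto simp: upper_def)
  have k: "1 \<le> k" "k \<le> DIM(real ^ 'n)"
    using assms(6,7) by simp_all
  have \<Omega>: "open \<Omega>" "bounded \<Omega>"
    using assms(3) by (auto simp: uniformly_convex_domain_def)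
  obtain u where u: "visc_solution ext s k \<Omega> f u" "\<And>x. x \<notin> \<Omega> \<Longrightarrow> u x = 0"
    using dirichlet_problem_solvable[OF assms(1,2) k assms(3-5), of upper] unfolding ext by blast
  show ?thesis
  proof (rule ex1I[of _ u])
    show "continuous_on UNIV u \<and> visc_solution ext s k \<Omega> f u \<and> (\<forall>x. x \<notin> \<Omega> \<longrightarrow> u x = 0)"
      using u by (simp add: visc_solution_def)
    fix v assume v: "continuous_on UNIV v \<and> visc_solution ext s k \<Omega> f v \<and> (\<forall>x. x \<notin> \<Omega> \<longrightarrow> v x = 0)"
    have "v x \<le> u x" "u x \<le> v x" for x
      using dirichlet_problem_le[OF assms(1,2) k \<Omega> assms(4), of upper] u v unfolding ext by blast+
    then show "v = u"
      by (simp add: fun_eq_iff antisym)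
  qed
qed

end
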